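(* Let $\Gamma$ be a countable subgroup of $\mathrm{Diff}^1_+(\mathrm{S}^1)$ which preserves no probability measure on $\mathrm{S}^1$. Then $\Gamma$ contains an element $g$ which has fixed points and all of whose fixed points are hyperbolic.
   Context: $\mathrm{Diff}^1_+(\mathrm{S}^1)$ is the group of orientation-preserving $C^1$ diffeomorphisms of the circle. A fixed point $x$ of $g$ is hyperbolic if $g'(x)\neq 1$. $\Gamma$ preserves a probability measure $m$ if $g_*m=m$ for all $g\in\Gamma$. *)

theory Defs
  imports "HOL-Probability.Probability" "HOL-Algebra.Bij"
begin

text \<open>The circle is the unit circle of the complex plane, with the angular charts
  \<open>t \<mapsto> x * cis t\<close> around each of its points \<open>x\<close>.\<close>

abbreviation S1 :: "complex set" where
  "S1 \<equiv> sphere 0 1"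

text \<open>The positively oriented unit tangent vector of the circle at \<open>x\<close> is \<open>\<i> * x\<close>.
  A circle map with derivative \<open>D\<close> at \<open>x\<close> sends it to \<open>D\<close> times the unit tangent
  vector at \<open>f x\<close>; in terms of a lift \<open>F\<close> of \<open>f\<close> to the real line, \<open>D\<close> is the
  derivative of \<open>F\<close>.\<close>

definition has_circle_deriv :: "(complex \<Rightarrow> complex) \<Rightarrow> real \<Rightarrow> complex \<Rightarrow> bool" where
  "has_circle_deriv f D x \<longleftrightarrow>
     ((\<lambda>t::real. f (x * cis t)) has_vector_derivative (of_real D * (\<i> * f x))) (at 0)"

definition circle_deriv :: "(complex \<Rightarrow> complex) \<Rightarrow> complex \<Rightarrow> real" where
  "circle_deriv f x = (THE D. has_circle_deriv f D x)"

definition C1_circle_map :: "(complex \<Rightarrow> complex) \<Rightarrow> bool" where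
  "C1_circle_map f \<longleftrightarrow> f \<in> S1 \<rightarrow> S1 \<and> (\<forall>x\<in>S1. \<exists>D. has_circle_deriv f D x) \<and>
     continuous_on S1 (circle_deriv f)"

text \<open>Diffeomorphisms are represented as elements of \<^term>\<open>Bij S1\<close>, that is, as bijections
  of \<^term>\<open>S1\<close> that take the value \<^term>\<open>undefined\<close> elsewhere, so that equality of
  functions is equality of circle maps.\<close>

definition Diff1_plus :: "(complex \<Rightarrow> complex) set" where
  "Diff1_plus = {f \<in> Bij S1. C1_circle_map f \<and> C1_circle_map (\<lambda>x\<in>S1. inv_into S1 f x) \<and>
     (\<forall>x\<in>S1. circle_deriv f x > 0)}"

definition Diff1_plus_group :: "(complex \<Rightarrow> complex) monoid" where
  "Diff1_plus_group = (BijGroup S1)\<lparr>carrier := Diff1_plus\<rparr>"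

definition preserves_measure :: "(complex \<Rightarrow> complex) set \<Rightarrow> complex measure \<Rightarrow> bool" where
  "preserves_measure \<Gamma> m \<longleftrightarrow> (\<forall>g\<in>\<Gamma>. distr m m g = m)"

definition hyperbolic_fixed_point :: "(complex \<Rightarrow> complex) \<Rightarrow> complex \<Rightarrow> bool" where
  "hyperbolic_fixed_point g x \<longleftrightarrow> x \<in> S1 \<and> g x = x \<and> circle_deriv g x \<noteq> 1"

lemma has_circle_deriv_unique:
  assumes "has_circle_deriv f D x" "has_circle_deriv f E x" "f x \<noteq> 0"
  shows "D = E"
  using vector_derivative_unique_at[OF assms(1,2)[unfolded has_circle_deriv_def]] assms(3)
  by simp

lemma circle_derivI:
  assumes "has_circle_deriv f D x" "f x \<noteq> 0"
  shows "circle_deriv f x = D"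
  unfolding circle_deriv_def using assms has_circle_deriv_unique by blast

lemma S1_nonzero: "x \<in> S1 \<Longrightarrow> x \<noteq> 0"
  by auto

lemma S1_cis: "x \<in> S1 \<Longrightarrow> x * cis t \<in> S1"
  by (simp add: norm_mult)

lemma C1_circle_map_deriv:
  assumes "C1_circle_map f" "x \<in> S1"
  shows "has_circle_deriv f (circle_deriv f x) x"
proof -
  obtain D where D: "has_circle_deriv f D x"
    using assms unfolding C1_circle_map_def by blast
  have "f x \<in> S1" using assms unfolding C1_circle_map_def by blast
  then have "circle_deriv f x = D" using circle_derivI[OF D] S1_nonzero by blast
  then show ?thesis using D by simp
qed

lemma has_circle_deriv_compose:
  assumes x: "x \<in> S1" and f: "f \<in> S1 \<rightarrow> S1"
    and D: "has_circle_deriv f D x" and E: "has_circle_deriv g E (f x)"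
  shows "has_circle_deriv (compose S1 g f) (E * D) x"
proof -
  have fx: "f x \<in> S1" "f x \<noteq> 0" using f x S1_nonzero by blast+
  define z where "z = (\<lambda>t::real. f (x * cis t) / f x)"
  define \<theta> where "\<theta> = (\<lambda>t. Im (Ln (z t)))"
  have z1: "norm (z t) = 1" for t
    using f S1_cis[OF x, of t] fx unfolding z_def by (auto simp: norm_divide Pi_iff)
  have lift: "f (x * cis t) = f x * cis (\<theta> t)" for t
  proof -
    have "z t \<noteq> 0" using z1[of t] by auto
    then have "z t = exp (Ln (z t))" by simp
    also have "\<dots> = cis (\<theta> t)"
      using z1[of t] \<open>z t \<noteq> 0\<close> by (simp add: exp_eq_polar \<theta>_def Re_Ln)
    finally show ?thesis using fx by (simp add: z_def field_simps)
  qed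
  have z0: "z 0 = 1" using fx by (simp add: z_def)
  have "(z has_vector_derivative (of_real D * (\<i> * f x)) / f x) (at 0)"
    unfolding z_def using D[unfolded has_circle_deriv_def] by (rule has_vector_derivative_divide)
  then have "((Ln \<circ> z) has_vector_derivative (of_real D * \<i>) * 1) (at 0)"
    using fx z0 by (intro field_vector_diff_chain_at) (auto intro!: derivative_eq_intros)
  then have "((\<lambda>t. Im ((Ln \<circ> z) t)) has_vector_derivative Im (of_real D * \<i> * 1)) (at 0)"
    by (rule bounded_linear.has_vector_derivative[OF bounded_linear_Im])
  then have th: "(\<theta> has_vector_derivative D) (at 0)"
    by (simp add: \<theta>_def o_def)
  have "\<theta> 0 = 0" by (simp add: \<theta>_def z0)
  then have "((\<lambda>s. g (f x * cis s)) \<circ> \<theta> has_vector_derivative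
      D *\<^sub>R (of_real E * (\<i> * g (f x)))) (at 0)"
    using E by (intro vector_diff_chain_at[OF th]) (simp add: has_circle_deriv_def)
  moreover have "(\<lambda>s. g (f x * cis s)) \<circ> \<theta> = (\<lambda>t. compose S1 g f (x * cis t))"
    using S1_cis[OF x] by (auto simp: compose_def lift)
  moreover have "compose S1 g f x = g (f x)" using x by (simp add: compose_def)
  ultimately show ?thesis
    by (simp add: has_circle_deriv_def scaleR_conv_of_real mult_ac)
qed

lemma has_circle_deriv_id:
  assumes "x \<in> S1"
  shows "has_circle_deriv (\<lambda>x\<in>S1. x) 1 x"
proof -
  have "((\<lambda>t::real. x * cis t) has_vector_derivative \<i> * x) (at 0)"
    unfolding cis_conv_exp
    by (rule has_vector_derivative_eq_rhs, rule has_vector_derivative_mult_right,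
        rule field_vector_diff_chain_at[unfolded o_def, where g = exp and f = "\<lambda>t::real. \<i> * of_real t"
          and f' = \<i> and g' = 1])
      (auto intro!: derivative_eq_intros simp: has_vector_derivative_def scaleR_conv_of_real)
  moreover have "(\<lambda>t. (\<lambda>x\<in>S1. x) (x * cis t)) = (\<lambda>t. x * cis t)"
    using S1_cis[OF assms] by auto
  ultimately show ?thesis using assms by (simp add: has_circle_deriv_def)
qed

lemma C1_circle_map_continuous:
  assumes "C1_circle_map f"
  shows "continuous_on S1 f"
  unfolding continuous_on_def
proof -
  show "\<forall>x\<in>S1. (f \<longlongrightarrow> f x) (at x within S1)"
  proof
    fix x assume x: "x \<in> S1"
    then have x0: "x \<noteq> 0" by auto
    have "isCont (\<lambda>t::real. f (x * cis t)) 0"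
      using C1_circle_map_deriv[OF assms x] has_vector_derivative_continuous
      unfolding has_circle_deriv_def by blast
    moreover have "((\<lambda>y. Im (Ln (y / x))) \<longlongrightarrow> Im (Ln (x / x))) (at x within S1)"
      using x0 by (intro tendsto_intros) auto
    ultimately have *: "((\<lambda>y. f (x * cis (Im (Ln (y / x))))) \<longlongrightarrow> f (x * cis 0)) (at x within S1)"
      using x0 by (intro isCont_tendsto_compose[where g = "\<lambda>t::real. f (x * cis t)"]) auto
    have **: "x * cis (Im (Ln (y / x))) = y" if "y \<in> S1" for y
    proof -
      have "y / x \<noteq> 0" "norm (y / x) = 1" using that x by (auto simp: norm_divide)
      then have "cis (Im (Ln (y / x))) = exp (Ln (y / x))" 
        by (simp only: exp_eq_polar Re_Ln) simp
      then show ?thesis using x0 \<open>y / x \<noteq> 0\<close> by simp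
    qed
    have "eventually (\<lambda>y. f (x * cis (Im (Ln (y / x)))) = f y) (at x within S1)"
      using ** by (auto simp: eventually_at_filter)
    from tendsto_cong[OF this] * show "(f \<longlongrightarrow> f x) (at x within S1)" by simp
  qed
qed

lemma C1_circle_map_compose:
  assumes f: "C1_circle_map f" and g: "C1_circle_map g"
  shows "C1_circle_map (compose S1 g f)"
    and "x \<in> S1 \<Longrightarrow> circle_deriv (compose S1 g f) x = circle_deriv g (f x) * circle_deriv f x"
proof -
  have fS: "f \<in> S1 \<rightarrow> S1" and gS: "g \<in> S1 \<rightarrow> S1"
    using f g unfolding C1_circle_map_def by blast+
  have cS: "compose S1 g f \<in> S1 \<rightarrow> S1" using fS gS by (auto simp: compose_def Pi_iff)
  have *: "has_circle_deriv (compose S1 g f) (circle_deriv g (f x) * circle_deriv f x) x"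
    if "x \<in> S1" for x
    using has_circle_deriv_compose[OF that fS C1_circle_map_deriv[OF f that]]
      C1_circle_map_deriv[OF g] fS that by blast
  have **: "circle_deriv (compose S1 g f) x = circle_deriv g (f x) * circle_deriv f x"
    if "x \<in> S1" for x
    using circle_derivI[OF *[OF that]] cS that S1_nonzero by blast
  show "x \<in> S1 \<Longrightarrow> circle_deriv (compose S1 g f) x = circle_deriv g (f x) * circle_deriv f x"
    by (rule **)
  have "continuous_on S1 (\<lambda>x. circle_deriv g (f x) * circle_deriv f x)"
    using f g fS C1_circle_map_continuous[OF f] unfolding C1_circle_map_def
    by (intro continuous_on_mult continuous_on_compose2[where g = "circle_deriv g" and f = f]) auto
  then have "continuous_on S1 (circle_deriv (compose S1 g f))"
    using ** continuous_on_cong by (metis (mono_tags, lifting))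
  then show "C1_circle_map (compose S1 g f)"
    unfolding C1_circle_map_def using cS * by blast
qed

lemma C1_circle_map_id: "C1_circle_map (\<lambda>x\<in>S1. x)"
  and circle_deriv_id: "x \<in> S1 \<Longrightarrow> circle_deriv (\<lambda>x\<in>S1. x) x = 1"
proof -
  have *: "circle_deriv (\<lambda>x\<in>S1. x) x = 1" if "x \<in> S1" for x
    using circle_derivI[OF has_circle_deriv_id[OF that]] that S1_nonzero[OF that] by simp
  then show "x \<in> S1 \<Longrightarrow> circle_deriv (\<lambda>x\<in>S1. x) x = 1" by blast
  have "continuous_on S1 (circle_deriv (\<lambda>x\<in>S1. x))"
    using * continuous_on_cong[of S1 S1 "circle_deriv (\<lambda>x\<in>S1. x)" "\<lambda>_. 1"] by auto
  then show "C1_circle_map (\<lambda>x\<in>S1. x)"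
    unfolding C1_circle_map_def using has_circle_deriv_id by (blast intro: restrictI)
qed

lemma inv_restrict_compose:
  assumes "f \<in> Bij S" "g \<in> Bij S"
  shows "(\<lambda>x\<in>S. inv_into S (compose S g f) x) =
    compose S (\<lambda>x\<in>S. inv_into S f x) (\<lambda>x\<in>S. inv_into S g x)"
proof -
  interpret G: group "BijGroup S" by (rule group_BijGroup)
  have c: "f \<in> carrier (BijGroup S)" "g \<in> carrier (BijGroup S)"
    using assms by (simp_all add: BijGroup_def)
  have "inv\<^bsub>BijGroup S\<^esub> (g \<otimes>\<^bsub>BijGroup S\<^esub> f) =
      inv\<^bsub>BijGroup S\<^esub> f \<otimes>\<^bsub>BijGroup S\<^esub> inv\<^bsub>BijGroup S\<^esub> g"
    by (rule G.inv_mult_group[OF c(2,1)])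
  moreover have "g \<otimes>\<^bsub>BijGroup S\<^esub> f = compose S g f"
    using assms by (simp add: BijGroup_def)
  moreover have "compose S g f \<in> Bij S" using assms by (intro compose_Bij)
  ultimately show ?thesis
    using assms restrict_inv_into_Bij[OF assms(1)] restrict_inv_into_Bij[OF assms(2)]
    by (simp add: inv_BijGroup) (simp add: BijGroup_def)
qed

lemma subgroup_Diff1_plus: "subgroup Diff1_plus (BijGroup S1)"
proof -
  interpret G: group "BijGroup S1" by (rule group_BijGroup)
  have id: "(\<lambda>x\<in>S1. x) \<in> Diff1_plus"
  proof -
    have "(\<lambda>x\<in>S1. inv_into S1 (\<lambda>x\<in>S1. x) x) = (\<lambda>x\<in>S1. x)"
      using G.inv_one id_Bij[of S1] inv_BijGroup[OF id_Bij[of S1]] by (simp add: BijGroup_def)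
    then show ?thesis unfolding Diff1_plus_def
      using C1_circle_map_id circle_deriv_id id_Bij[of S1] by simp
  qed
  have inv: "(\<lambda>x\<in>S1. inv_into S1 f x) \<in> Diff1_plus" if f: "f \<in> Diff1_plus" for f
  proof -
    let ?h = "\<lambda>x\<in>S1. inv_into S1 f x"
    have fB: "f \<in> Bij S1" and fC: "C1_circle_map f" and hC: "C1_circle_map ?h"
      and pos: "\<And>x. x \<in> S1 \<Longrightarrow> circle_deriv f x > 0"
      using f unfolding Diff1_plus_def by auto
    have hB: "?h \<in> Bij S1" using fB by (rule restrict_inv_into_Bij)
    have "(\<lambda>x\<in>S1. inv_into S1 ?h x) = f"
      using G.inv_inv[of f] inv_BijGroup[OF hB] inv_BijGroup[OF fB] fB by (simp add: BijGroup_def)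
    moreover have "circle_deriv ?h x > 0" if x: "x \<in> S1" for x
    proof -
      have hx: "?h x \<in> S1" using hC x unfolding C1_circle_map_def by blast
      have "compose S1 f ?h = (\<lambda>x\<in>S1. x)"
        using G.r_inv[of f] inv_BijGroup[OF fB] fB hB by (simp add: BijGroup_def)
      then have "circle_deriv f (?h x) * circle_deriv ?h x = 1"
        using C1_circle_map_compose(2)[OF hC fC x] circle_deriv_id[OF x] by simp
      then show ?thesis using pos[OF hx] by (metis zero_less_mult_pos zero_less_one)
    qed
    ultimately show ?thesis unfolding Diff1_plus_def using hB hC fC by auto
  qed
  have comp: "compose S1 g f \<in> Diff1_plus" if f: "f \<in> Diff1_plus" and g: "g \<in> Diff1_plus" for f g
  proof -
    have B: "f \<in> Bij S1" "g \<in> Bij S1" using f g unfolding Diff1_plus_def by auto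
    have C: "C1_circle_map f" "C1_circle_map g" "C1_circle_map (\<lambda>x\<in>S1. inv_into S1 f x)"
      "C1_circle_map (\<lambda>x\<in>S1. inv_into S1 g x)" using f g unfolding Diff1_plus_def by auto
    have "circle_deriv (compose S1 g f) x > 0" if x: "x \<in> S1" for x
    proof -
      have "f x \<in> S1" using C(1) x unfolding C1_circle_map_def by blast
      then show ?thesis using f g x C1_circle_map_compose(2)[OF C(1,2) x]
        unfolding Diff1_plus_def by auto
    qed
    then show ?thesis unfolding Diff1_plus_def
      using compose_Bij B C1_circle_map_compose(1) C inv_restrict_compose[OF B] by auto
  qed
  show ?thesis
  proof (rule G.subgroupI)
    show "Diff1_plus \<subseteq> carrier (BijGroup S1)" by (auto simp: Diff1_plus_def BijGroup_def)
    show "Diff1_plus \<noteq> {}" using id by blast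
    show "inv\<^bsub>BijGroup S1\<^esub> f \<in> Diff1_plus" if "f \<in> Diff1_plus" for f
      using inv[OF that] that inv_BijGroup[of f S1] by (simp add: Diff1_plus_def)
    show "g \<otimes>\<^bsub>BijGroup S1\<^esub> f \<in> Diff1_plus" if "g \<in> Diff1_plus" "f \<in> Diff1_plus" for f g
      using comp[OF that(2,1)] that by (simp add: BijGroup_def Diff1_plus_def)
  qed
qed

lemma group_Diff1_plus_group: "group Diff1_plus_group"
  unfolding Diff1_plus_group_def
  by (rule subgroup.subgroup_is_group[OF subgroup_Diff1_plus group_BijGroup])

lemma Diff1_plus_measurable:
  assumes "f \<in> Diff1_plus" "sets m = sets (restrict_space borel S1)"
  shows "f \<in> measurable m m"
proof -
  have f: "C1_circle_map f" using assms(1) unfolding Diff1_plus_def by blast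
  have "f \<in> borel_measurable (restrict_space borel S1)"
    by (rule borel_measurable_continuous_on_restrict[OF C1_circle_map_continuous[OF f]])
  then have "f \<in> measurable (restrict_space borel S1) (restrict_space borel S1)"
    using f unfolding C1_circle_map_def
    by (intro measurable_restrict_space2) (auto simp: space_restrict_space)
  then show ?thesis using measurable_cong_sets[OF assms(2) assms(2)] by simp
qed

end

theory Submission
  imports Defs
begin

text \<open>
The element is found by counting words in a ping-pong semigroup, so everything rests on producing
ping-pong from the absence of an invariant measure.

Contraction. Suppose that a point \<open>x\<close> has infinite orbit and that no arc around it can be made
arbitrarily short by the group. Then pairwise disjoint translates of a small arc \<open>I\<close> around \<open>x\<close> are bounded in
number, and, as in the construction of Haar measure, one may count: take a largest family of disjoint
translates of \<open>I\<close> and put equal masses at the translates of \<open>x\<close>. Two largest families put almost the same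
number of points into any interval of the circle, since exchanging the part of one family inside the
interval for that of the other cannot increase the total and only the two ends of the interval
interfere. Translating a largest family by a group element gives another one, so a weak limit of these
measures, as \<open>I\<close> shrinks to \<open>x\<close>, is invariant. A finite orbit carries an invariant measure as well.
Hence without invariant measure all orbits are infinite and every point has a contractible arc
(\<open>contractible_arc_or_invariant_measure\<close>), and close pairs of points can be brought together
uniformly (\<open>close_pairs_contractible\<close>).

Collapse. Among all group elements choose one that brings together as many pairs from a given finite
set \<open>P\<close> as possible. The image of \<open>P\<close> then consists of clusters that are a definite distance apart, so
the number of clusters is bounded independently of \<open>P\<close> (\<open>finite_sets_concentrate\<close>). For finer and
finer \<open>P\<close> the inverses of these elements send everything away from a fixed finite set \<open>R\<close> close to a
fixed finite set \<open>A\<close> (\<open>collapses_exists\<close>). Orbits being infinite, B. H. Neumann's lemma on coverings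
by cosets lets one move these finite sets off each other, which yields two elements \<open>a\<close>, \<open>b\<close> with
four pairwise disjoint finite unions of small arcs as attractors and repellers (\<open>ping_pong\<close>).

Counting. The \<open>2 ^ n\<close> words of length \<open>n\<close> in \<open>a\<close> and \<open>b\<close> map the complement \<open>K\<close> of the repellers to
disjoint sets, so most of these images have length of the order \<open>2 ^ (-n)\<close>, and along most words the
image of \<open>K\<close> is short after all but a bounded number of letters. On short arcs continuity of the
derivatives bounds the distortion of each further letter by the factor \<open>3 / 2\<close>, which loses against
the factor \<open>2\<close> from counting: continuous differentiability suffices. Thus the derivative of most words
is below \<open>1\<close> everywhere away from the repellers (\<open>most_words_contract\<close>). The same holds for the
inverses, which play ping-pong with the roles exchanged, so some word \<open>w\<close> contracts away from the
repellers while its inverse contracts away from the attractors. Every periodic point of \<open>w\<close> is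
therefore hyperbolic. Finally, some power of \<open>w\<close> maps one of the finitely many attracting arcs into itself, and this power
has a fixed point.
\<close>

section \<open>Arcs, lengths and lifts\<close>

lemma cis_eq_imp_eq:
  assumes "cis s = cis t" "\<bar>s - t\<bar> < 2 * pi"
  shows "s = t"
proof -
  have "cis (s - t) = 1" using assms(1) by (simp add: cis_divide[symmetric])
  then have "cos (s - t) = 1" by (metis cis.simps(1) one_complex.simps(1))
  then obtain n :: int where n: "s - t = real_of_int n * 2 * pi" using cos_one_2pi_int[of "s - t"] by auto
  have "n = 0"
  proof (rule ccontr)
    assume "n \<noteq> 0"
    then have "1 \<le> \<bar>real_of_int n\<bar>" by linarith
    then have "2 * pi \<le> \<bar>real_of_int n\<bar> * (2 * pi)" by simp
    then show False using assms(2) n by (simp add: abs_mult)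
  qed
  then show ?thesis using n by simp
qed

lemma dist_cis_le: "dist (cis s) (cis t) \<le> \<bar>s - t\<bar>"
proof -
  have "norm (cis s - cis t) \<le> 1 * norm (s - t)"
  proof (rule differentiable_bound[where S = UNIV])
    show "(cis has_derivative (\<lambda>t. t *\<^sub>R (\<i> * cis x))) (at x within UNIV)" for x
      by (auto intro!: derivative_eq_intros)
    show "onorm (\<lambda>t. t *\<^sub>R (\<i> * cis x)) \<le> 1" for x
      by (rule onorm_le) (simp add: norm_mult)
  qed auto
  then show ?thesis by (simp add: dist_norm)
qed

lemma cis_Arg2pi: "z \<in> S1 \<Longrightarrow> cis (Arg2pi z) = z"
  using complex_norm_eq_1_exp[of z] by (simp add: cis_conv_exp)

lemma S1_eq_cis: "x \<in> S1 \<Longrightarrow> \<exists>t. 0 \<le> t \<and> t < 2 * pi \<and> x = cis t"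
  using cis_Arg2pi[of x] Arg2pi_ge_0[of x] Arg2pi_lt_2pi[of x] by metis

text \<open>Lebesgue measure of the set of angles, so that the whole circle has length \<open>2 * pi\<close>.\<close>

definition circle_length :: "complex set \<Rightarrow> real" where
  "circle_length A = measure lborel {t \<in> {0..<2 * pi}. cis t \<in> A}"

lemma circle_length_sets:
  assumes "A \<in> sets borel"
  shows "{t \<in> {0..<2 * pi}. cis t \<in> A} \<in> fmeasurable lborel"
proof -
  have [measurable]: "A \<in> sets borel" by fact
  have [measurable]: "cis \<in> borel_measurable borel"
    by (intro borel_measurable_continuous_onI continuous_intros)
  have "{t \<in> space borel. t \<in> {0..<2 * pi} \<and> cis t \<in> A} \<in> sets borel"
    by measurable
  then have *: "{t \<in> {0..<2 * pi}. cis t \<in> A} \<in> sets lborel" by simp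
  have "emeasure lborel {t \<in> {0..<2 * pi}. cis t \<in> A} \<le> emeasure lborel {0..<2 * pi}"
    by (rule emeasure_mono) auto
  also have "\<dots> < \<infinity>" by simp
  finally show ?thesis using * by (intro fmeasurableI) auto
qed

lemma circle_length_mono:
  assumes "A \<subseteq> B" "A \<in> sets borel" "B \<in> sets borel"
  shows "circle_length A \<le> circle_length B"
  unfolding circle_length_def
  using circle_length_sets[OF assms(2)] circle_length_sets[OF assms(3)] assms(1)
  by (intro measure_mono_fmeasurable) (auto simp: fmeasurable_def)

lemma sum_circle_length_le:
  assumes "finite I" "\<And>i. i \<in> I \<Longrightarrow> A i \<in> sets borel" "disjoint_family_on A I"
  shows "(\<Sum>i\<in>I. circle_length (A i)) \<le> 2 * pi"
proof -
  let ?B = "\<lambda>i. {t \<in> {0..<2 * pi}. cis t \<in> A i}"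
  have "(\<Sum>i\<in>I. circle_length (A i)) = measure lborel (\<Union>i\<in>I. ?B i)"
    unfolding circle_length_def
  proof (rule measure_finite_Union[symmetric])
    show "disjoint_family_on ?B I" using assms(3) unfolding disjoint_family_on_def by blast
    show "?B ` I \<subseteq> sets lborel" using circle_length_sets assms(2) by (auto simp: fmeasurable_def)
    show "emeasure lborel (?B i) \<noteq> \<infinity>" if "i \<in> I" for i
      using circle_length_sets[OF assms(2)[OF that]] by (auto simp: fmeasurable_def)
  qed fact
  also have "\<dots> \<le> measure lborel {0..<2 * pi}"
    using circle_length_sets assms(1,2)
    by (intro measure_mono_fmeasurable) (auto simp: fmeasurable_def)
  also have "\<dots> = 2 * pi" by simp
  finally show ?thesis .
qed

lemma compact_cis_image: "compact (cis ` {c..d})"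
  by (intro compact_continuous_image continuous_intros) auto

text \<open>This turns bounds on the length of an image into bounds on displacements of a lift. The two cases of the proof are whether the arc, moved to start in
  \<open>[0, 2 * pi)\<close>, runs past the angle \<open>2 * pi\<close>.\<close>

lemma circle_length_arc_ge:
  assumes "c \<le> d" "d - c < 2 * pi"
  shows "d - c \<le> circle_length (cis ` {c..d})"
proof -
  define k where "k = \<lfloor>c / (2 * pi)\<rfloor>"
  define c' where "c' = c - 2 * pi * k"
  define d' where "d' = d - 2 * pi * k"
  have cis_k: "cis (t + 2 * pi * k) = cis t" for t
    by (simp add: cis_mult[symmetric])
  have im: "cis ` {c..d} = cis ` {c'..d'}"
  proof -
    have "{c..d} = (\<lambda>t. t + 2 * pi * k) ` {c'..d'}"
      by (simp add: c'_def d'_def)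
    then show ?thesis by (simp only: image_image cis_k)
  qed
  have c': "0 \<le> c'" "c' < 2 * pi"
  proof -
    have "k \<le> c / (2 * pi)" "c / (2 * pi) < k + 1" unfolding k_def by linarith+
    then show "0 \<le> c'" "c' < 2 * pi" by (simp_all add: c'_def field_simps)
  qed
  have dc: "d' - c' = d - c" by (simp add: c'_def d'_def)
  let ?B = "{t \<in> {0..<2 * pi}. cis t \<in> cis ` {c'..d'}}"
  have B: "?B \<in> fmeasurable lborel"
    by (intro circle_length_sets borel_closed compact_imp_closed compact_cis_image)
  have "d' - c' \<le> measure lborel ?B"
  proof (cases "d' \<le> 2 * pi")
    case True
    have "measure lborel {c'..<d'} \<le> measure lborel ?B"
      using B c' True by (intro measure_mono_fmeasurable) auto
    then show ?thesis using assms(1) dc by simp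
  next
    case False
    have sub: "{0..d' - 2 * pi} \<union> {c'..<2 * pi} \<subseteq> ?B"
    proof
      fix t assume "t \<in> {0..d' - 2 * pi} \<union> {c'..<2 * pi}"
      then consider "t \<in> {c'..<2 * pi}" | "t \<in> {0..d' - 2 * pi}" by blast
      then show "t \<in> ?B"
      proof cases
        case 1 then show ?thesis using False c' by auto
      next
        case 2
        then have "t + 2 * pi \<in> {c'..d'}" using c' by auto
        moreover have "cis t = cis (t + 2 * pi)" by (simp add: cis_mult[symmetric])
        ultimately show ?thesis using 2 c' dc assms by (auto intro: image_eqI)
      qed
    qed
    have "d' - c' = measure lborel {0..d' - 2 * pi} + measure lborel {c'..<2 * pi}"
      using False c' by simp
    also have "\<dots> = measure lborel ({0..d' - 2 * pi} \<union> {c'..<2 * pi})"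
      using dc assms False c' by (intro measure_Union[symmetric]) auto
    also have "\<dots> \<le> measure lborel ?B"
      using B sub by (intro measure_mono_fmeasurable) auto
    finally show ?thesis .
  qed
  then show ?thesis by (simp add: circle_length_def im dc)
qed

text \<open>Arcs are measured by angle, not by chord, so that the triangle inequality \<open>arc_overlap\<close> holds
  without loss.\<close>

definition circle_arc :: "complex \<Rightarrow> real \<Rightarrow> complex set" where
  "circle_arc x r = (\<lambda>t. x * cis t) ` {-r..r}"

lemma arc_cis: "circle_arc (cis \<theta>) r = cis ` {\<theta> - r..\<theta> + r}"
proof -
  have "{\<theta> - r..\<theta> + r} = (\<lambda>t. \<theta> + t) ` {-r..r}" by simp
  then show ?thesis by (simp only: image_image circle_arc_def cis_mult[symmetric])
qed

lemma arc_subset_S1: "x \<in> S1 \<Longrightarrow> circle_arc x r \<subseteq> S1"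
  by (auto simp: circle_arc_def norm_mult)

lemma compact_arc: "compact (circle_arc x r)"
  unfolding circle_arc_def by (intro compact_continuous_image continuous_intros) auto

lemma connected_arc: "connected (circle_arc x r)"
  unfolding circle_arc_def by (intro connected_continuous_image continuous_intros) auto

lemma center_in_arc: "0 \<le> r \<Longrightarrow> x \<in> circle_arc x r"
  unfolding circle_arc_def by (rule image_eqI[where x = 0]) auto

lemma arc_mono: "r \<le> s \<Longrightarrow> circle_arc x r \<subseteq> circle_arc x s"
  unfolding circle_arc_def by (intro image_mono) auto

lemma dist_arc_center:
  assumes "y \<in> circle_arc x r" "x \<in> S1"
  shows "dist y x \<le> r"
proof -
  obtain \<theta> where \<theta>: "x = cis \<theta>" using S1_eq_cis[OF assms(2)] by blast
  then obtain t where "t \<in> {\<theta> - r..\<theta> + r}" "y = cis t" using assms(1) arc_cis by blast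
  then show ?thesis using dist_cis_le[of t \<theta>] \<theta> by auto
qed

lemma arc_overlap:
  assumes "z \<in> circle_arc x r" "z \<in> circle_arc y s"
  shows "y \<in> circle_arc x (r + s)"
proof -
  obtain t u where t: "t \<in> {-r..r}" "z = x * cis t" and u: "u \<in> {-s..s}" "z = y * cis u"
    using assms unfolding circle_arc_def by blast
  have "y = y * cis u * cis (- u)" by (simp add: mult.assoc cis_mult)
  also have "\<dots> = x * cis (t - u)" using t u by (simp add: mult.assoc cis_mult)
  finally show ?thesis using t u unfolding circle_arc_def by (intro image_eqI[where x = "t - u"]) auto
qed

lemma close_imp_in_arc:
  assumes "0 < r"
  obtains e where "0 < e" "\<And>x y. x \<in> S1 \<Longrightarrow> y \<in> S1 \<Longrightarrow> dist y x < e \<Longrightarrow> y \<in> circle_arc x r"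
proof -
  have "isCont (\<lambda>w. Im (Ln w)) 1" by (intro isCont_Im isCont_Ln') auto
  then obtain e where e: "e > 0" "\<And>w. dist w 1 < e \<Longrightarrow> dist (Im (Ln w)) (Im (Ln 1)) < r"
    using assms unfolding continuous_at_eps_delta by blast
  show ?thesis
  proof (rule that[OF e(1)])
    fix x y assume xy: "x \<in> S1" "y \<in> S1" "dist y x < e"
    let ?w = "y / x"
    have x0: "x \<noteq> 0" "?w \<noteq> 0" and n: "norm ?w = 1" using xy by (auto simp: norm_divide)
    have "dist ?w 1 = norm ((y - x) / x)" using x0 by (simp add: dist_norm diff_divide_distrib)
    also have "\<dots> = dist y x" using xy by (simp add: norm_divide dist_norm)
    finally have "\<bar>Im (Ln ?w)\<bar> < r" using e(2)[of ?w] xy by simp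
    moreover have "cis (Im (Ln ?w)) = exp (Ln ?w)"
      using n x0 by (simp only: exp_eq_polar Re_Ln) simp
    then have "y = x * cis (Im (Ln ?w))" using x0 by simp
    ultimately show "y \<in> circle_arc x r" unfolding circle_arc_def by (intro image_eqI[where x = "Im (Ln ?w)"]) auto
  qed
qed

lemma
  assumes "f \<in> Diff1_plus"
  shows Diff1_plus_Bij: "f \<in> Bij S1"
    and Diff1_plus_C1: "C1_circle_map f"
    and Diff1_plus_maps: "x \<in> S1 \<Longrightarrow> f x \<in> S1"
    and Diff1_plus_bij_betw: "bij_betw f S1 S1"
    and Diff1_plus_inj_on: "inj_on f S1"
    and Diff1_plus_continuous: "continuous_on S1 f"
    and Diff1_plus_deriv_pos: "x \<in> S1 \<Longrightarrow> circle_deriv f x > 0"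
    and Diff1_plus_deriv_continuous: "continuous_on S1 (circle_deriv f)"
  using assms C1_circle_map_continuous
  unfolding Diff1_plus_def Bij_def C1_circle_map_def bij_betw_def by auto

lemma circle_deriv_compose:
  assumes "f \<in> Diff1_plus" "g \<in> Diff1_plus" "x \<in> S1"
  shows "circle_deriv (compose S1 g f) x = circle_deriv g (f x) * circle_deriv f x"
  using C1_circle_map_compose(2) assms Diff1_plus_C1 by blast

lemma has_vector_derivative_along_circle:
  assumes "f \<in> Diff1_plus"
  shows "((\<lambda>t. f (cis t)) has_vector_derivative
    of_real (circle_deriv f (cis t)) * (\<i> * f (cis t))) (at t)"
proof -
  have "has_circle_deriv f (circle_deriv f (cis t)) (cis t)"
    by (rule C1_circle_map_deriv[OF Diff1_plus_C1[OF assms]]) simp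
  then have "((\<lambda>s. f (cis t * cis s)) has_vector_derivative
      of_real (circle_deriv f (cis t)) * (\<i> * f (cis t))) (at (t - t))"
    unfolding has_circle_deriv_def by simp
  moreover have "((\<lambda>u. u - t) has_vector_derivative 1) (at t)"
    by (auto intro!: derivative_eq_intros)
  ultimately have "((\<lambda>s. f (cis t * cis s)) \<circ> (\<lambda>u. u - t) has_vector_derivative
      1 *\<^sub>R (of_real (circle_deriv f (cis t)) * (\<i> * f (cis t)))) (at t)"
    by (intro vector_diff_chain_at)
  then show ?thesis by (simp add: o_def cis_mult)
qed

text \<open>A lift comes from integration instead of covering space theory: if \<open>F\<close> is an antiderivative of
  the circle derivative, then \<open>f (cis t) * cis (- F t)\<close> has derivative zero.\<close>

lemma Diff1_plus_lift:
  assumes "f \<in> Diff1_plus"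
  obtains F where "\<And>t. f (cis t) = cis (F t)"
    "\<And>t. (F has_real_derivative circle_deriv f (cis t)) (at t)"
proof -
  have "continuous_on UNIV (\<lambda>t. circle_deriv f (cis t))"
    by (rule continuous_on_compose2[OF Diff1_plus_deriv_continuous[OF assms]])
      (auto intro!: continuous_intros)
  then have cont: "isCont (\<lambda>t. circle_deriv f (cis t)) t" for t
    by (simp add: continuous_on_eq_continuous_at)
  obtain G where G: "\<And>t. (G has_vector_derivative circle_deriv f (cis t)) (at t)"
    using einterval_antiderivative[of "-\<infinity>" "\<infinity>" "\<lambda>t. circle_deriv f (cis t)"] cont by auto
  obtain a where a: "f (cis 0) = cis a"
    using S1_eq_cis Diff1_plus_maps[OF assms, of "cis 0"] by auto
  define F where "F t = G t - G 0 + a" for t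
  have F: "(F has_vector_derivative circle_deriv f (cis t)) (at t)" for t
    unfolding F_def using G[of t] by (auto intro!: derivative_eq_intros)
  have F0: "F 0 = a" by (simp add: F_def)
  let ?H = "\<lambda>t. f (cis t) * cis (- F t)"
  have "(?H has_vector_derivative 0) (at t within UNIV)" for t
  proof -
    have "((\<lambda>t. cis (- F t)) has_vector_derivative
        (- circle_deriv f (cis t)) *\<^sub>R (\<i> * cis (- F t))) (at t)"
      using F[of t] unfolding has_vector_derivative_def
      by (auto intro!: derivative_eq_intros)
    from has_vector_derivative_mult[OF has_vector_derivative_along_circle[OF assms] this]
    show ?thesis by (simp add: scaleR_conv_of_real algebra_simps)
  qed
  then obtain c where c: "\<And>t. ?H t = c"
    using has_vector_derivative_zero_constant[of UNIV ?H] by auto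
  have "c = 1" using c[of 0] a by (simp add: F0 cis_mult)
  then have "f (cis t) = cis (F t)" for t
    using c[of t] by (simp add: cis_inverse[symmetric] field_simps)
  moreover have "(F has_real_derivative circle_deriv f (cis t)) (at t)" for t
    using F by (simp add: has_real_derivative_iff_has_vector_derivative)
  ultimately show ?thesis using that by blast
qed

text \<open>Both bounds come from a lift \<open>F\<close>. It increases by less than \<open>2 * pi\<close> along the arc because \<open>f\<close> is
  injective, so the length of the image dominates the increase of \<open>F\<close>; the mean value theorem
  supplies \<open>q\<close>.\<close>

lemma Diff1_plus_image_arc:
  assumes f: "f \<in> Diff1_plus" and x: "x \<in> S1" and r: "0 < r" "r < pi"
  shows "\<exists>q\<in>circle_arc x r. 2 * r * circle_deriv f q \<le> circle_length (f ` circle_arc x r)"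
    and "y \<in> circle_arc x r \<Longrightarrow> z \<in> circle_arc x r \<Longrightarrow> dist (f y) (f z) \<le> circle_length (f ` circle_arc x r)"
proof -
  obtain \<theta> where \<theta>: "x = cis \<theta>" using S1_eq_cis[OF x] by blast
  obtain F where F: "\<And>t. f (cis t) = cis (F t)"
    and F': "\<And>t. (F has_real_derivative circle_deriv f (cis t)) (at t)"
    using Diff1_plus_lift[OF f] by blast
  define c where "c = \<theta> - r"
  define d where "d = \<theta> + r"
  have arc: "circle_arc x r = cis ` {c..d}" using \<theta> by (simp add: arc_cis c_def d_def)
  have cd: "c < d" "d - c = 2 * r" using r by (auto simp: c_def d_def)
  have pos: "circle_deriv f (cis t) > 0" for t using Diff1_plus_deriv_pos[OF f] by simp
  have strict: "F s < F t" if "s < t" for s t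
    by (rule DERIV_pos_imp_increasing[OF that]) (use F' pos in blast)
  have mono: "F s \<le> F t" if "s \<le> t" for s t
    using that by (cases "s < t") (auto intro!: less_imp_le strict)
  have contF: "continuous_on A F" for A
    using F' by (meson DERIV_isCont continuous_at_imp_continuous_on)
  have short: "F d - F c < 2 * pi"
  proof (rule ccontr)
    assume "\<not> ?thesis"
    then obtain t where t: "c \<le> t" "t \<le> d" "F t = F c + 2 * pi"
      using IVT'[of F c "F c + 2 * pi" d] contF cd by auto
    then have "f (cis t) = f (cis c)" by (simp add: F cis_mult[symmetric])
    then have "cis t = cis c" using Diff1_plus_inj_on[OF f] by (auto simp: inj_on_def)
    then have "t = c" using t cd r by (intro cis_eq_imp_eq) auto
    then show False using t by simp
  qed
  have "F ` {c..d} = {F c..F d}"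
  proof
    show "F ` {c..d} \<subseteq> {F c..F d}" using mono by auto
    show "{F c..F d} \<subseteq> F ` {c..d}"
    proof
      fix y assume "y \<in> {F c..F d}"
      then obtain t where "c \<le> t" "t \<le> d" "F t = y"
        using IVT'[of F c y d] contF cd by auto
      then show "y \<in> F ` {c..d}" by auto
    qed
  qed
  then have "f ` circle_arc x r = cis ` {F c..F d}"
    unfolding arc by (simp only: image_image F flip: \<open>F ` {c..d} = {F c..F d}\<close>)
  then have len: "F d - F c \<le> circle_length (f ` circle_arc x r)"
    using circle_length_arc_ge[of "F c" "F d"] short mono cd by auto
  show "\<exists>q\<in>circle_arc x r. 2 * r * circle_deriv f q \<le> circle_length (f ` circle_arc x r)"
  proof -
    obtain t where "c < t" "t < d" "F d - F c = (d - c) * circle_deriv f (cis t)"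
      using MVT2[OF cd(1), of F "\<lambda>t. circle_deriv f (cis t)"] F' by blast
    then have "cis t \<in> circle_arc x r" "2 * r * circle_deriv f (cis t) = F d - F c"
      using cd unfolding arc by auto
    then show ?thesis using len by force
  qed
  show "dist (f y) (f z) \<le> circle_length (f ` circle_arc x r)" if yz: "y \<in> circle_arc x r" "z \<in> circle_arc x r"
  proof -
    obtain s t where s: "s \<in> {c..d}" "y = cis s" and t: "t \<in> {c..d}" "z = cis t"
      using yz arc by blast
    have "dist (f y) (f z) \<le> \<bar>F s - F t\<bar>" using s t dist_cis_le F by simp
    also have "\<dots> \<le> F d - F c" using mono[of c s] mono[of c t] mono[of s d] mono[of t d] s t by auto
    finally show ?thesis using len by simp
  qed
qed

section \<open>Groups of circle diffeomorphisms and their invariant measures\<close>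

abbreviation circle_inv :: "(complex \<Rightarrow> complex) \<Rightarrow> complex \<Rightarrow> complex" where
  "circle_inv f \<equiv> (\<lambda>x\<in>S1. inv_into S1 f x)"

locale circle_diff_group =
  fixes \<Gamma> :: "(complex \<Rightarrow> complex) set"
  assumes Diff: "g \<in> \<Gamma> \<Longrightarrow> g \<in> Diff1_plus"
    and one_in: "(\<lambda>x\<in>S1. x) \<in> \<Gamma>"
    and compose_in: "g \<in> \<Gamma> \<Longrightarrow> h \<in> \<Gamma> \<Longrightarrow> compose S1 g h \<in> \<Gamma>"
    and inv_in: "g \<in> \<Gamma> \<Longrightarrow> circle_inv g \<in> \<Gamma>"
begin

lemma maps: "g \<in> \<Gamma> \<Longrightarrow> x \<in> S1 \<Longrightarrow> g x \<in> S1"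
  using Diff1_plus_maps[OF Diff] .

lemma inv_apply: "g \<in> \<Gamma> \<Longrightarrow> x \<in> S1 \<Longrightarrow> circle_inv g (g x) = x"
  using Diff1_plus_inj_on[OF Diff] maps by simp

lemma apply_inv: "g \<in> \<Gamma> \<Longrightarrow> x \<in> S1 \<Longrightarrow> g (circle_inv g x) = x"
  using Diff1_plus_bij_betw[OF Diff, of g] by (auto simp: bij_betw_def f_inv_into_f)

lemma inj: "g \<in> \<Gamma> \<Longrightarrow> x \<in> S1 \<Longrightarrow> y \<in> S1 \<Longrightarrow> g x = g y \<longleftrightarrow> x = y"
  using Diff1_plus_inj_on[OF Diff, of g] by (auto simp: inj_on_def)

lemma compose_left_inj: "g \<in> \<Gamma> \<Longrightarrow> inj_on (compose S1 g) \<Gamma>"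
proof (rule inj_onI)
  fix h k assume *: "g \<in> \<Gamma>" "h \<in> \<Gamma>" "k \<in> \<Gamma>" "compose S1 g h = compose S1 g k"
  show "h = k"
  proof (rule extensionalityI)
    show "h \<in> extensional S1" "k \<in> extensional S1"
      using * Diff1_plus_Bij[OF Diff] by (auto simp: Bij_def)
    show "h x = k x" if "x \<in> S1" for x
    proof -
      have "g (h x) = g (k x)" using fun_cong[OF *(4), of x] that by (simp add: compose_def)
      then show ?thesis using inj[OF *(1) maps[OF *(2) that] maps[OF *(3) that]] by blast
    qed
  qed
qed

end

lemma (in circle_diff_group) finite_orbit_imp_invariant_measure:
  assumes x: "x \<in> S1" and fin: "finite ((\<lambda>g. g x) ` \<Gamma>)"
  shows "\<exists>m. prob_space m \<and> sets m = sets (restrict_space borel S1) \<and> preserves_measure \<Gamma> m"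
proof -
  define Orb where "Orb = (\<lambda>g. g x) ` \<Gamma>"
  have Orb: "finite Orb" "Orb \<noteq> {}" "Orb \<subseteq> S1" using fin one_in maps x by (auto simp: Orb_def)
  let ?S = "restrict_space borel S1 :: complex measure"
  define m where "m = distr (uniform_count_measure Orb) ?S (\<lambda>z. z)"
  have ms: "(\<lambda>z. z) \<in> measurable (uniform_count_measure Orb) ?S"
    using Orb by (auto simp: measurable_def space_restrict_space sets_uniform_count_measure
        space_uniform_count_measure)
  have sets_m: "sets m = sets ?S" and space_m: "space m = S1" by (auto simp: m_def space_restrict_space)
  have em: "emeasure m A = ennreal (card (A \<inter> Orb) / card Orb)" if "A \<in> sets m" for A
  proof -
    have "emeasure m A = emeasure (uniform_count_measure Orb) (A \<inter> Orb)"
      unfolding m_def using that sets_m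
      by (subst emeasure_distr[OF ms]) (auto simp: space_uniform_count_measure)
    also have "\<dots> = ennreal (card (A \<inter> Orb) / card Orb)"
      using Orb by (subst emeasure_uniform_count_measure) auto
    finally show ?thesis .
  qed
  have "prob_space m"
    unfolding m_def using Orb ms by (intro prob_space.prob_space_distr prob_space_uniform_count_measure)
  moreover have "distr m m h = m" if h: "h \<in> \<Gamma>" for h
  proof (rule measure_eqI)
    have hm: "h \<in> measurable m m" by (rule Diff1_plus_measurable[OF Diff[OF h] sets_m])
    fix A assume A: "A \<in> sets (distr m m h)"
    have "bij_betw h Orb Orb"
    proof (rule bij_betw_imageI)
      show "inj_on h Orb" by (rule inj_on_subset[OF Diff1_plus_inj_on[OF Diff[OF h]] Orb(3)])
      have "h ` Orb \<subseteq> Orb"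
      proof
        fix z assume "z \<in> h ` Orb"
        then obtain g where "g \<in> \<Gamma>" "z = h (g x)" by (auto simp: Orb_def)
        then show "z \<in> Orb" unfolding Orb_def using compose_in[OF h, of g] x
          by (intro image_eqI[where x = "compose S1 h g"]) (auto simp: compose_def)
      qed
      then show "h ` Orb = Orb" using \<open>inj_on h Orb\<close> Orb(1) by (metis endo_inj_surj)
    qed
    then have "inj_on h {z \<in> Orb. h z \<in> A}" "h ` {z \<in> Orb. h z \<in> A} = A \<inter> Orb"
      by (auto simp: bij_betw_def intro: inj_on_subset)
    then have "card {z \<in> Orb. h z \<in> A} = card (A \<inter> Orb)" by (metis card_image)
    moreover have "h -` A \<inter> S1 \<inter> Orb = {z \<in> Orb. h z \<in> A}" using Orb(3) by auto
    ultimately have "card (h -` A \<inter> S1 \<inter> Orb) = card (A \<inter> Orb)" by simp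
    moreover have "emeasure (distr m m h) A = emeasure m (h -` A \<inter> S1)"
      using A by (subst emeasure_distr[OF hm]) (auto simp: space_m)
    moreover have "h -` A \<inter> S1 \<in> sets m"
      using measurable_sets[OF hm, of A] A space_m by simp
    ultimately show "emeasure (distr m m h) A = emeasure m A"
      using em A by simp
  qed simp
  ultimately show ?thesis using sets_m unfolding preserves_measure_def by blast
qed

text \<open>The indicator of a closed set \<open>C\<close> is the limit of the continuous functions
  \<open>max 0 (1 - k * infdist z C)\<close>, so integrals of continuous functions determine the measure of closed
  sets, and these generate the Borel sets.\<close>

lemma measure_on_S1_eqI:
  fixes m m' :: "complex measure"
  assumes "finite_measure m" "finite_measure m'"
    and sets: "sets m = sets (restrict_space borel S1)" "sets m' = sets (restrict_space borel S1)"
    and eq: "\<And>\<phi> :: complex \<Rightarrow> real. continuous_on UNIV \<phi> \<Longrightarrow> (\<integral>z. \<phi> z \<partial>m) = (\<integral>z. \<phi> z \<partial>m')"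
  shows "m = m'"
proof -
  interpret m: finite_measure m by fact
  interpret m': finite_measure m' by fact
  have id: "(\<lambda>z. z) \<in> measurable n borel" if "sets n = sets (restrict_space borel S1)"
    for n :: "complex measure"
    using that by (simp add: measurable_restrict_space1 cong: measurable_cong_sets)
  have lim: "(\<lambda>k. \<integral>z. max 0 (1 - real k * infdist z C) \<partial>n) \<longlonglongrightarrow> measure (distr n borel (\<lambda>z. z)) C"
    if "finite_measure n" and n: "sets n = sets (restrict_space borel S1)" and C: "closed C" "C \<noteq> {}"
    for n :: "complex measure" and C
  proof -
    interpret n: finite_measure n by fact
    note [measurable] = id[OF n]
    have CB[measurable]: "C \<in> sets borel" using C by simp
    have [measurable]: "(\<lambda>z. max 0 (1 - real k * infdist z C)) \<in> borel_measurable borel" for k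
      by (intro borel_measurable_continuous_onI continuous_intros)
    have "(\<lambda>k. \<integral>z. max 0 (1 - real k * infdist z C) \<partial>(distr n borel (\<lambda>z. z)))
        \<longlonglongrightarrow> (\<integral>z. indicator C z \<partial>(distr n borel (\<lambda>z. z)))"
    proof (rule integral_dominated_convergence[where w = "\<lambda>_. 1"])
      interpret d: finite_measure "distr n borel (\<lambda>z. z)" by (rule n.finite_measure_distr) simp
      show "integrable (distr n borel (\<lambda>z. z)) (\<lambda>_. 1 :: real)" by simp
      show "AE z in distr n borel (\<lambda>z. z).
          (\<lambda>k. max 0 (1 - real k * infdist z C)) \<longlonglongrightarrow> indicator C z"
      proof (rule AE_I2)
        fix z
        show "(\<lambda>k. max 0 (1 - real k * infdist z C)) \<longlonglongrightarrow> indicator C z"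
        proof (cases "z \<in> C")
          case True then show ?thesis by simp
        next
          case False
          then have pos: "infdist z C > 0"
            using C by (metis in_closed_iff_infdist_zero infdist_nonneg order_le_less)
          obtain K :: nat where "1 < real K * infdist z C" using pos ex_less_of_nat_mult by blast
          then have "1 \<le> real k * infdist z C" if "k \<ge> K" for k
            using pos that by (smt (verit) mult_right_mono of_nat_mono)
          then have "eventually (\<lambda>k. max 0 (1 - real k * infdist z C) = indicator C z) sequentially"
            using False by (intro eventually_sequentiallyI[of K]) auto
          then show ?thesis by (rule tendsto_eventually)
        qed
      qed
      show "AE z in distr n borel (\<lambda>z. z). norm (max 0 (1 - real k * infdist z C)) \<le> 1" for k
        using infdist_nonneg by (intro AE_I2) (auto simp: max_def intro!: mult_nonneg_nonneg)
    qed simp_all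
    then show ?thesis by (simp add: integral_distr)
  qed
  have "distr m borel (\<lambda>z. z) = distr m' borel (\<lambda>z. z)"
  proof (rule measure_eqI_generator_eq[where E = "Collect closed" and \<Omega> = UNIV and A = "\<lambda>_. UNIV"])
    show "Int_stable (Collect closed :: complex set set)" by (auto simp: Int_stable_def)
    show "sets (distr m borel (\<lambda>z. z)) = sigma_sets UNIV (Collect closed)"
      "sets (distr m' borel (\<lambda>z. z)) = sigma_sets UNIV (Collect closed)"
      by (simp_all add: borel_eq_closed)
    show "emeasure (distr m borel (\<lambda>z. z)) UNIV \<noteq> \<infinity>"
      using m.finite_measure_distr[OF id[OF sets(1)]] by (simp add: finite_measure.emeasure_eq_measure)
    fix C :: "complex set" assume "C \<in> Collect closed"
    then have C: "closed C" by simp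
    have "measure (distr m borel (\<lambda>z. z)) C = measure (distr m' borel (\<lambda>z. z)) C"
    proof (cases "C = {}")
      case False
      have "(\<lambda>k. \<integral>z. max 0 (1 - real k * infdist z C) \<partial>m) =
          (\<lambda>k. \<integral>z. max 0 (1 - real k * infdist z C) \<partial>m')"
        by (intro ext eq continuous_intros)
      then show ?thesis
        using lim[OF assms(1) sets(1) C False] lim[OF assms(2) sets(2) C False] LIMSEQ_unique by metis
    qed simp
    moreover have "finite_measure (distr m borel (\<lambda>z. z))" "finite_measure (distr m' borel (\<lambda>z. z))"
      using m.finite_measure_distr[OF id[OF sets(1)]] m'.finite_measure_distr[OF id[OF sets(2)]] by auto
    ultimately show "emeasure (distr m borel (\<lambda>z. z)) C = emeasure (distr m' borel (\<lambda>z. z)) C"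
      by (simp add: finite_measure.emeasure_eq_measure)
  qed auto
  then have *: "emeasure (distr m borel (\<lambda>z. z)) A = emeasure (distr m' borel (\<lambda>z. z)) A" for A
    by simp
  show ?thesis
  proof (rule measure_eqI)
    fix A assume A: "A \<in> sets m"
    have sp: "space m = S1" "space m' = S1"
      using sets sets_eq_imp_space_eq[of m "restrict_space borel S1"]
        sets_eq_imp_space_eq[of m' "restrict_space borel S1"] by (auto simp: space_restrict_space)
    have "A \<in> sets borel" "A \<subseteq> S1"
      using A sets by (auto simp: sets_restrict_space)
    then show "emeasure m A = emeasure m' A"
      using *[of A] sp by (simp add: emeasure_distr id sets Int_absorb2)
  qed (simp add: sets)
qed

text \<open>Read through their angles, probability measures on the circle form a tight family on the real line, which
  reduces compactness to Helly's theorem.\<close>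

lemma uniform_measures_weak_limit:
  fixes T :: "nat \<Rightarrow> 'a set" and p :: "'a \<Rightarrow> complex"
  assumes T: "\<And>k. finite (T k)" "\<And>k. T k \<noteq> {}" and p: "\<And>k g. g \<in> T k \<Longrightarrow> p g \<in> S1"
  obtains r :: "nat \<Rightarrow> nat" and m :: "complex measure" where
    "strict_mono r" "prob_space m" "sets m = sets (restrict_space borel S1)"
    "\<And>\<phi> :: complex \<Rightarrow> real. continuous_on S1 \<phi> \<Longrightarrow>
      (\<lambda>k. (\<Sum>g\<in>T (r k). \<phi> (p g)) / card (T (r k))) \<longlonglongrightarrow> (\<integral>z. \<phi> z \<partial>m)"
proof -
  define \<mu> where "\<mu> k = distr (measure_pmf (pmf_of_set (T k))) borel (\<lambda>g. Arg2pi (p g))" for k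
  have dist: "real_distribution (\<mu> k)" for k
    unfolding \<mu>_def by (intro prob_space.real_distribution_distr) (auto intro: measure_pmf.prob_space_axioms)
  have "tight \<mu>"
    unfolding tight_def
  proof (intro conjI allI impI)
    fix \<epsilon> :: real assume "\<epsilon> > 0"
    have "Arg2pi (p g) \<in> {-1<..2 * pi}" for g
      using Arg2pi_ge_0[of "p g"] Arg2pi_lt_2pi[of "p g"] by simp
    then have "(\<lambda>g. Arg2pi (p g)) -` {-1<..2 * pi} = UNIV" by auto
    then have "measure (\<mu> k) {-1<..2 * pi} = 1" for k
      by (simp add: \<mu>_def measure_distr)
    moreover have "-1 < 2 * pi" using pi_gt_zero by linarith
    ultimately show "\<exists>a b. a < b \<and> (\<forall>k. 1 - \<epsilon> < measure (\<mu> k) {a<..b})"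
      using \<open>\<epsilon> > 0\<close> by (intro exI[of _ "-1"] exI[of _ "2 * pi"]) auto
  qed (rule dist)
  then obtain r M where r: "strict_mono (r :: nat \<Rightarrow> nat)" and M: "real_distribution M"
    and lim: "weak_conv_m (\<mu> \<circ> id \<circ> r) M"
    using tight_imp_convergent_subsubsequence[of \<mu> id] by (auto simp: strict_mono_def)
  interpret M: real_distribution M by (rule M)
  let ?S = "restrict_space borel S1 :: complex measure"
  have cis[measurable]: "cis \<in> borel_measurable borel"
    by (intro borel_measurable_continuous_onI continuous_intros)
  have cisM: "cis \<in> measurable M ?S"
    by (intro measurable_restrict_space2) auto
  define m where "m = distr M ?S cis"
  have "(\<lambda>k. (\<Sum>g\<in>T (r k). \<phi> (p g)) / card (T (r k))) \<longlonglongrightarrow> (\<integral>z. \<phi> z \<partial>m)"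
    if \<phi>: "continuous_on S1 \<phi>" for \<phi> :: "complex \<Rightarrow> real"
  proof -
    have cont: "continuous_on UNIV (\<lambda>t. \<phi> (cis t))"
      by (rule continuous_on_compose2[OF \<phi>]) (auto intro!: continuous_intros)
    have "bounded (\<phi> ` S1)"
      by (intro compact_imp_bounded compact_continuous_image \<phi> compact_sphere)
    then obtain B where "\<And>z. z \<in> S1 \<Longrightarrow> norm (\<phi> z) \<le> B" unfolding bounded_iff by blast
    then have B: "norm (\<phi> (cis t)) \<le> B" for t by simp
    have "(\<lambda>k. \<integral>t. \<phi> (cis t) \<partial>(\<mu> \<circ> id \<circ> r) k) \<longlonglongrightarrow> (\<integral>t. \<phi> (cis t) \<partial>M)"
      by (rule weak_conv_imp_integral_bdd_continuous_conv[OF _ M lim, where B = B])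
        (use cont B dist in \<open>simp_all add: continuous_on_eq_continuous_at\<close>)
    moreover have "(\<integral>t. \<phi> (cis t) \<partial>(\<mu> \<circ> id \<circ> r) k) = (\<Sum>g\<in>T (r k). \<phi> (p g)) / card (T (r k))" for k
    proof -
      have "(\<integral>t. \<phi> (cis t) \<partial>(\<mu> \<circ> id \<circ> r) k) =
          (\<integral>g. \<phi> (cis (Arg2pi (p g))) \<partial>measure_pmf (pmf_of_set (T (r k))))"
        unfolding \<mu>_def o_def id_def
        by (subst integral_distr) (auto intro: borel_measurable_continuous_onI cont)
      also have "\<dots> = (\<Sum>g\<in>T (r k). \<phi> (cis (Arg2pi (p g)))) / card (T (r k))"
        by (rule integral_pmf_of_set) (use T in auto)
      also have "(\<Sum>g\<in>T (r k). \<phi> (cis (Arg2pi (p g)))) = (\<Sum>g\<in>T (r k). \<phi> (p g))"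
        by (intro sum.cong refl) (metis cis_Arg2pi p)
      finally show ?thesis .
    qed
    moreover have "(\<integral>t. \<phi> (cis t) \<partial>M) = (\<integral>z. \<phi> z \<partial>m)"
      unfolding m_def using \<phi>
      by (intro integral_distr[symmetric] cisM borel_measurable_continuous_on_restrict)
    ultimately show ?thesis by simp
  qed
  moreover have "prob_space m" unfolding m_def by (rule M.prob_space_distr[OF cisM])
  moreover have "sets m = sets ?S" by (simp add: m_def)
  ultimately show ?thesis using that r by blast
qed

text \<open>The circle is the union of the closed arc from \<open>s\<close> to \<open>t\<close> and the complementary closed arc, which
  share only their end points; a connected set without end points lies in one of them. The complementary arc
  is parametrized by \<open>[t, s + 2 * pi]\<close>, so it contains the angle \<open>0\<close>.\<close>

lemma connected_meets_interval_ends: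
  assumes st: "0 \<le> s" "s < t" "t \<le> 2 * pi" and C: "connected C" "C \<subseteq> S1"
    and a: "a \<in> C" "s \<le> Arg2pi a" "Arg2pi a < t"
    and b: "b \<in> C" "\<not> (s \<le> Arg2pi b \<and> Arg2pi b < t)"
  shows "C \<inter> {cis s, cis t} \<noteq> {}"
proof
  assume empty: "C \<inter> {cis s, cis t} = {}"
  let ?X = "cis ` {s..t}" and ?Y = "cis ` {t..s + 2 * pi}"
  have in_XY: "z \<in> ?X \<union> ?Y \<and> (\<not> (s \<le> Arg2pi z \<and> Arg2pi z < t) \<longrightarrow> z \<in> ?Y) \<and>
    (s \<le> Arg2pi z \<and> Arg2pi z < t \<longrightarrow> z \<in> ?X)" if "z \<in> S1" for z
  proof -
    have z: "cis (Arg2pi z) = z" "cis (Arg2pi z + 2 * pi) = z"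
      using cis_Arg2pi[OF that] by (simp_all add: cis_mult[symmetric])
    have r: "0 \<le> Arg2pi z" "Arg2pi z < 2 * pi" by (rule Arg2pi_ge_0 Arg2pi_lt_2pi)+
    consider "s \<le> Arg2pi z \<and> Arg2pi z < t" | "Arg2pi z < s" | "t \<le> Arg2pi z" by linarith
    then show ?thesis
    proof cases
      case 1
      then have "cis (Arg2pi z) \<in> ?X" by (intro imageI) auto
      then show ?thesis using 1 unfolding z by blast
    next
      case 2
      then have "cis (Arg2pi z + 2 * pi) \<in> ?Y" using r st by (intro imageI) auto
      then show ?thesis using 2 unfolding z by auto
    next
      case 3
      then have "cis (Arg2pi z) \<in> ?Y" using r st by (intro imageI) auto
      then show ?thesis using 3 unfolding z by auto
    qed
  qed
  have XY: "?X \<inter> ?Y \<subseteq> {cis s, cis t}"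
  proof
    fix z assume "z \<in> ?X \<inter> ?Y"
    then obtain u v where u: "u \<in> {s..t}" "z = cis u" and v: "v \<in> {t..s + 2 * pi}" "z = cis v"
      by auto
    show "z \<in> {cis s, cis t}"
    proof (cases "\<bar>u - v\<bar> < 2 * pi")
      case True
      then have "u = v" using u v by (intro cis_eq_imp_eq) auto
      then show ?thesis using u v by auto
    next
      case False
      then have "u = s" using u v st by auto
      then show ?thesis using u by auto
    qed
  qed
  have "?X \<inter> C = {} \<or> ?Y \<inter> C = {}"
  proof (rule connected_closedD[OF C(1)])
    show "?X \<inter> ?Y \<inter> C = {}" using XY empty by blast
    show "C \<subseteq> ?X \<union> ?Y" using in_XY C(2) by blast
  qed (intro compact_imp_closed compact_cis_image)+
  moreover have "a \<in> ?X" "b \<in> ?Y" using in_XY[of a] in_XY[of b] C a b by auto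
  ultimately show False using a(1) b(1) by blast
qed

section \<open>Packings by translates of an arc\<close>

context circle_diff_group
begin

definition packing :: "complex set \<Rightarrow> (complex \<Rightarrow> complex) set \<Rightarrow> bool" where
  "packing I G \<longleftrightarrow> finite G \<and> G \<subseteq> \<Gamma> \<and> (\<forall>g\<in>G. \<forall>h\<in>G. g \<noteq> h \<longrightarrow> g ` I \<inter> h ` I = {})"

definition max_packing :: "complex set \<Rightarrow> (complex \<Rightarrow> complex) set \<Rightarrow> bool" where
  "max_packing I G \<longleftrightarrow> packing I G \<and> (\<forall>G'. packing I G' \<longrightarrow> card G' \<le> card G)"

lemma max_packing_exists:
  assumes I: "compact I" "I \<subseteq> S1" and \<delta>: "\<delta> > 0" "\<And>g. g \<in> \<Gamma> \<Longrightarrow> \<delta> \<le> circle_length (g ` I)"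
  shows "\<exists>G. max_packing I G"
proof -
  define K where "K = nat \<lceil>2 * pi / \<delta>\<rceil>"
  have bound: "card G \<le> K" if G: "packing I G" for G
  proof -
    have "card G * \<delta> \<le> (\<Sum>g\<in>G. circle_length (g ` I))"
      using G \<delta>(2) by (intro sum_bounded_below[where 'a = real]) (auto simp: packing_def)
    also have "\<dots> \<le> 2 * pi"
    proof (rule sum_circle_length_le)
      show "g ` I \<in> sets borel" if "g \<in> G" for g
      proof -
        have "g \<in> \<Gamma>" using that G by (auto simp: packing_def)
        then have "continuous_on I g"
          using continuous_on_subset[OF Diff1_plus_continuous[OF Diff]] I by blast
        then show ?thesis
          using compact_continuous_image I(1) by (blast intro: borel_closed compact_imp_closed)
      qed
    qed (use G in \<open>auto simp: packing_def disjoint_family_on_def\<close>)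
    finally have "card G \<le> 2 * pi / \<delta>" using \<delta>(1) by (simp add: field_simps)
    then show ?thesis unfolding K_def by linarith
  qed
  have ne: "packing I {}" by (simp add: packing_def)
  have fin: "finite (card ` Collect (packing I))"
    by (rule finite_subset[of _ "{..K}"]) (use bound in auto)
  have "Max (card ` Collect (packing I)) \<in> card ` Collect (packing I)"
    using ne by (intro Max_in fin) auto
  then obtain G where "packing I G" "card G = Max (card ` Collect (packing I))" by auto
  then show ?thesis using fin unfolding max_packing_def by (intro exI[of _ G]) auto
qed

lemma max_packing_translate:
  assumes G: "max_packing I G" and h: "h \<in> \<Gamma>" and I: "I \<subseteq> S1"
  shows "max_packing I (compose S1 h ` G)" "card (compose S1 h ` G) = card G"
proof -
  have G': "finite G" "G \<subseteq> \<Gamma>" "\<And>g k. g \<in> G \<Longrightarrow> k \<in> G \<Longrightarrow> g \<noteq> k \<Longrightarrow> g ` I \<inter> k ` I = {}"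
    using G by (auto simp: max_packing_def packing_def)
  have im: "compose S1 h g ` I = h ` g ` I" for g
    using I by (auto simp: compose_def)
  have "inj_on (compose S1 h) G" using compose_left_inj[OF h] G'(2) by (rule inj_on_subset)
  then show c: "card (compose S1 h ` G) = card G" by (rule card_image)
  have "packing I (compose S1 h ` G)"
    unfolding packing_def
  proof (intro conjI ballI impI)
    show "compose S1 h ` G \<subseteq> \<Gamma>" using compose_in[OF h] G'(2) by auto
    fix a b assume "a \<in> compose S1 h ` G" "b \<in> compose S1 h ` G" "a \<noteq> b"
    then obtain g k where gk: "g \<in> G" "k \<in> G" "g \<noteq> k" "a = compose S1 h g" "b = compose S1 h k"
      by auto
    have "g ` I \<subseteq> S1" "k ` I \<subseteq> S1" using gk G'(2) I maps by blast+
    then have "h ` g ` I \<inter> h ` k ` I = h ` (g ` I \<inter> k ` I)"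
      using inj_on_image_Int[OF Diff1_plus_inj_on[OF Diff[OF h]]] by metis
    then show "a ` I \<inter> b ` I = {}" using G'(3) gk im by simp
  qed (use G' in auto)
  then show "max_packing I (compose S1 h ` G)"
    using G c by (simp add: max_packing_def)
qed

text \<open>The exchange argument: the translates of one maximal packing that lie inside \<open>J\<close>, together with the
  translates of the other that avoid \<open>J\<close>, form a packing and hence number at most \<open>card G'\<close>. Translates
  that are cut by \<open>J\<close> contain a boundary point from \<open>E\<close>; being disjoint, there are at most two of
  them in each packing, whence the error \<open>2 + 2\<close>.\<close>

lemma max_packing_counts:
  assumes G: "max_packing I G" and G': "max_packing I G'"
    and I: "connected I" "I \<subseteq> S1" "x \<in> I"
    and E: "finite E" "card E \<le> 2"
      "\<And>C. connected C \<Longrightarrow> C \<subseteq> S1 \<Longrightarrow> C \<inter> J \<noteq> {} \<Longrightarrow> C - J \<noteq> {} \<Longrightarrow> C \<inter> E \<noteq> {}"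
  shows "card {g \<in> G. g x \<in> J} \<le> card {g \<in> G'. g x \<in> J} + 4"
proof -
  have G_D: "finite H" "H \<subseteq> \<Gamma>" "\<And>g k. g \<in> H \<Longrightarrow> k \<in> H \<Longrightarrow> g \<noteq> k \<Longrightarrow> g ` I \<inter> k ` I = {}"
    if "max_packing I H" for H
    using that by (auto simp: max_packing_def packing_def)
  have cut: "card {g \<in> H. g ` I \<inter> J \<noteq> {} \<and> g ` I - J \<noteq> {}} \<le> 2" if H: "max_packing I H" for H
  proof -
    let ?B = "{g \<in> H. g ` I \<inter> J \<noteq> {} \<and> g ` I - J \<noteq> {}}"
    have "\<exists>e. e \<in> g ` I \<inter> E" if g: "g \<in> ?B" for g
    proof -
      have "g \<in> \<Gamma>" using g G_D(2)[OF H] by auto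
      then have "connected (g ` I)" "g ` I \<subseteq> S1"
        using connected_continuous_image[OF _ I(1)] I(2) maps
          continuous_on_subset[OF Diff1_plus_continuous[OF Diff]] by blast+
      then show ?thesis using E(3)[of "g ` I"] g by auto
    qed
    then have "\<forall>g\<in>?B. \<exists>e. e \<in> g ` I \<inter> E" by blast
    from bchoice[OF this] obtain e where "\<forall>g\<in>?B. e g \<in> g ` I \<inter> E" by blast
    then have e: "e g \<in> g ` I \<inter> E" if "g \<in> ?B" for g using that by (rule bspec)
    have "inj_on e ?B"
    proof (rule inj_onI, rule ccontr)
      fix g k assume "g \<in> ?B" "k \<in> ?B" "e g = e k" "g \<noteq> k"
      moreover from this have "e g \<in> g ` I" "e g \<in> k ` I" using e[of g] e[of k] by auto
      ultimately show False using G_D(3)[OF H, of g k] by blast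
    qed
    then have "card ?B \<le> card E" using e E(1) by (intro card_inj_on_le) auto
    then show ?thesis using E(2) by simp
  qed
  define A where "A = {g \<in> G. g ` I \<subseteq> J}"
  define A' where "A' = {g \<in> G'. g ` I \<inter> J = {}}"
  have 1: "card {g \<in> G. g x \<in> J} \<le> card A + 2"
  proof -
    have "card {g \<in> G. g x \<in> J} \<le> card (A \<union> {g \<in> G. g ` I \<inter> J \<noteq> {} \<and> g ` I - J \<noteq> {}})"
      using I(3) G_D(1)[OF G] by (intro card_mono) (auto simp: A_def)
    also have "\<dots> \<le> card A + card {g \<in> G. g ` I \<inter> J \<noteq> {} \<and> g ` I - J \<noteq> {}}" by (rule card_Un_le)
    finally show ?thesis using cut[OF G] by linarith
  qed
  have 2: "card {g \<in> G'. g x \<notin> J} \<le> card A' + 2"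
  proof -
    have "card {g \<in> G'. g x \<notin> J} \<le> card (A' \<union> {g \<in> G'. g ` I \<inter> J \<noteq> {} \<and> g ` I - J \<noteq> {}})"
      using I(3) G_D(1)[OF G'] by (intro card_mono) (auto simp: A'_def)
    also have "\<dots> \<le> card A' + card {g \<in> G'. g ` I \<inter> J \<noteq> {} \<and> g ` I - J \<noteq> {}}" by (rule card_Un_le)
    finally show ?thesis using cut[OF G'] by linarith
  qed
  have disj: "g ` I \<inter> k ` I = {}" if "g \<in> A" "k \<in> A'" for g k
    using that by (auto simp: A_def A'_def)
  then have "A \<inter> A' = {}" using I(3) by blast
  have "packing I (A \<union> A')"
    unfolding packing_def
  proof (intro conjI ballI impI)
    show "A \<union> A' \<subseteq> \<Gamma>" "finite (A \<union> A')" using G_D(1,2)[OF G] G_D(1,2)[OF G'] by (auto simp: A_def A'_def)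
    fix g k assume "g \<in> A \<union> A'" "k \<in> A \<union> A'" "g \<noteq> k"
    then consider "g \<in> A" "k \<in> A" | "g \<in> A'" "k \<in> A'" | "g \<in> A" "k \<in> A'" | "k \<in> A" "g \<in> A'" by blast
    then show "g ` I \<inter> k ` I = {}"
      using G_D(3)[OF G, of g k] G_D(3)[OF G', of g k] disj[of g k] disj[of k g] \<open>g \<noteq> k\<close>
      by cases (auto simp: A_def A'_def)
  qed
  then have "card (A \<union> A') \<le> card G'" using G' by (auto simp: max_packing_def)
  moreover have "card (A \<union> A') = card A + card A'"
    using \<open>A \<inter> A' = {}\<close> G_D(1)[OF G] G_D(1)[OF G']
    by (intro card_Un_disjoint) (auto simp: A_def A'_def)
  moreover have "card G' = card {g \<in> G'. g x \<in> J} + card {g \<in> G'. g x \<notin> J}"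
    using G_D(1)[OF G'] by (subst card_Un_disjoint[symmetric]) (auto intro: arg_cong[where f = card])
  ultimately show ?thesis using 1 2 by linarith
qed

end

text \<open>Replacing \<open>\<phi>\<close> by its sample values \<open>c\<close> on the pieces \<open>\<iota> = i\<close> turns both sums into
  combinations of the counts.\<close>

lemma sums_close_if_counts_close:
  fixes \<phi> :: "'p \<Rightarrow> real" and p :: "'a \<Rightarrow> 'p" and q :: "'b \<Rightarrow> 'p" and c :: "nat \<Rightarrow> real"
    and \<epsilon> B K :: real and \<iota> :: "'p \<Rightarrow> nat" and L :: nat
  assumes fin: "finite G" "finite H"
    and idx: "\<And>g. g \<in> G \<Longrightarrow> \<iota> (p g) < L" "\<And>h. h \<in> H \<Longrightarrow> \<iota> (q h) < L"
    and near: "\<And>g. g \<in> G \<Longrightarrow> \<bar>\<phi> (p g) - c (\<iota> (p g))\<bar> \<le> \<epsilon>" "\<And>h. h \<in> H \<Longrightarrow> \<bar>\<phi> (q h) - c (\<iota> (q h))\<bar> \<le> \<epsilon>"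
    and c: "\<And>i. i < L \<Longrightarrow> \<bar>c i\<bar> \<le> B"
    and counts: "\<And>i. i < L \<Longrightarrow> \<bar>real (card {g \<in> G. \<iota> (p g) = i}) - real (card {h \<in> H. \<iota> (q h) = i})\<bar> \<le> K"
  shows "\<bar>(\<Sum>g\<in>G. \<phi> (p g)) - (\<Sum>h\<in>H. \<phi> (q h))\<bar> \<le> \<epsilon> * card G + \<epsilon> * card H + L * (B * K)"
proof -
  have step: "\<bar>(\<Sum>g\<in>A. \<phi> (r g)) - (\<Sum>i<L. c i * card {g \<in> A. \<iota> (r g) = i})\<bar> \<le> \<epsilon> * card A"
    if A: "finite A" "\<And>g. g \<in> A \<Longrightarrow> \<iota> (r g) < L" "\<And>g. g \<in> A \<Longrightarrow> \<bar>\<phi> (r g) - c (\<iota> (r g))\<bar> \<le> \<epsilon>"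
    for A :: "'c set" and r
  proof -
    have "(\<Sum>g\<in>A. c (\<iota> (r g))) = (\<Sum>i<L. \<Sum>g\<in>{g \<in> A. \<iota> (r g) = i}. c (\<iota> (r g)))"
      using A by (intro sum.group[symmetric]) auto
    also have "\<dots> = (\<Sum>i<L. c i * card {g \<in> A. \<iota> (r g) = i})"
      by (intro sum.cong refl) simp
    finally have "\<bar>(\<Sum>g\<in>A. \<phi> (r g)) - (\<Sum>i<L. c i * card {g \<in> A. \<iota> (r g) = i})\<bar> =
        \<bar>\<Sum>g\<in>A. \<phi> (r g) - c (\<iota> (r g))\<bar>" by (simp add: sum_subtractf)
    also have "\<dots> \<le> (\<Sum>g\<in>A. \<bar>\<phi> (r g) - c (\<iota> (r g))\<bar>)" by (rule sum_abs)
    also have "\<dots> \<le> card A * \<epsilon>" using A(3) by (rule sum_bounded_above)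
    finally show ?thesis by (simp add: mult.commute)
  qed
  let ?n = "\<lambda>i. real (card {g \<in> G. \<iota> (p g) = i})" and ?m = "\<lambda>i. real (card {h \<in> H. \<iota> (q h) = i})"
  have "\<bar>(\<Sum>i<L. c i * ?n i) - (\<Sum>i<L. c i * ?m i)\<bar> = \<bar>\<Sum>i<L. c i * (?n i - ?m i)\<bar>"
    by (simp add: sum_subtractf right_diff_distrib)
  also have "\<dots> \<le> (\<Sum>i<L. \<bar>c i * (?n i - ?m i)\<bar>)" by (rule sum_abs)
  also have "\<dots> \<le> (\<Sum>i<L. B * K)"
  proof (rule sum_mono)
    fix i assume "i \<in> {..<L}"
    then have "\<bar>c i\<bar> \<le> B" "\<bar>?n i - ?m i\<bar> \<le> K" using c counts by auto
    then show "\<bar>c i * (?n i - ?m i)\<bar> \<le> B * K"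
      unfolding abs_mult by (intro mult_mono) auto
  qed
  also have "\<dots> = L * (B * K)" by simp
  finally have "\<bar>(\<Sum>i<L. c i * ?n i) - (\<Sum>i<L. c i * ?m i)\<bar> \<le> L * (B * K)" .
  moreover have "\<bar>(\<Sum>g\<in>G. \<phi> (p g)) - (\<Sum>i<L. c i * ?n i)\<bar> \<le> \<epsilon> * card G"
    using fin(1) idx(1) near(1) by (rule step)
  moreover have "\<bar>(\<Sum>h\<in>H. \<phi> (q h)) - (\<Sum>i<L. c i * ?m i)\<bar> \<le> \<epsilon> * card H"
    using fin(2) idx(2) near(2) by (rule step)
  ultimately show ?thesis by linarith
qed

text \<open>The index of the half-open interval, out of \<open>L\<close> equal ones, that contains the angle of \<open>z\<close>.\<close>

definition sector :: "nat \<Rightarrow> complex \<Rightarrow> nat" where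
  "sector L z = nat \<lfloor>L * Arg2pi z / (2 * pi)\<rfloor>"

lemma sector_eq_iff:
  assumes "L > 0"
  shows "sector L z = i \<longleftrightarrow> 2 * pi * i / L \<le> Arg2pi z \<and> Arg2pi z < 2 * pi * (i + 1) / L"
proof -
  have "0 \<le> L * Arg2pi z / (2 * pi)" using Arg2pi_ge_0[of z] by simp
  then have "sector L z = i \<longleftrightarrow> \<lfloor>L * Arg2pi z / (2 * pi)\<rfloor> = int i"
    unfolding sector_def by (simp add: nat_eq_iff)
  also have "\<dots> \<longleftrightarrow> i \<le> L * Arg2pi z / (2 * pi) \<and> L * Arg2pi z / (2 * pi) < i + 1"
    by (simp add: floor_eq_iff add.commute)
  also have "\<dots> \<longleftrightarrow> 2 * pi * i / L \<le> Arg2pi z \<and> Arg2pi z < 2 * pi * (i + 1) / L"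
    using assms by (simp add: field_simps)
  finally show ?thesis .
qed

lemma sector_less: "L > 0 \<Longrightarrow> sector L z < L"
proof -
  assume L: "L > 0"
  have "2 * pi * sector L z / L \<le> Arg2pi z" using sector_eq_iff[OF L, of z "sector L z"] by blast
  also have "\<dots> < 2 * pi" by (rule Arg2pi_lt_2pi)
  finally show ?thesis using L by (simp add: field_simps)
qed

lemma (in circle_diff_group) max_packing_sector_counts:
  assumes G: "max_packing I G" and G': "max_packing I G'"
    and I: "connected I" "I \<subseteq> S1" "x \<in> I" and L: "i < L"
  shows "card {g \<in> G. sector L (g x) = i} \<le> card {g \<in> G'. sector L (g x) = i} + 4"
proof -
  have L0: "L > 0" using L by simp
  define s where "s = 2 * pi * i / L"
  define t where "t = 2 * pi * (i + 1) / L"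
  have st: "0 \<le> s" "s < t" "t \<le> 2 * pi"
  proof -
    show "0 \<le> s" "s < t" using L0 by (auto simp: s_def t_def field_simps)
    have "real i + 1 \<le> real L" using L by linarith
    then show "t \<le> 2 * pi" using L0 by (simp add: t_def divide_le_eq mult_left_mono)
  qed
  define J where "J = {z. s \<le> Arg2pi z \<and> Arg2pi z < t}"
  have "card {g \<in> G. g x \<in> J} \<le> card {g \<in> G'. g x \<in> J} + 4"
  proof (rule max_packing_counts[OF G G' I, where E = "{cis s, cis t}"])
    fix C assume C: "connected C" "C \<subseteq> S1" "C \<inter> J \<noteq> {}" "C - J \<noteq> {}"
    then obtain a b where "a \<in> C" "a \<in> J" "b \<in> C" "b \<notin> J" by blast
    then show "C \<inter> {cis s, cis t} \<noteq> {}"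
      using connected_meets_interval_ends[OF st C(1,2), of a b] by (auto simp: J_def)
  qed (auto simp: card_insert_if)
  moreover have "sector L z = i \<longleftrightarrow> z \<in> J" for z
    using sector_eq_iff[OF L0, of z i] by (simp add: J_def s_def t_def)
  ultimately show ?thesis by simp
qed

text \<open>The translate of a maximal packing by \<open>h\<close> is again maximal, so both have nearly equal counts in
  every sector. What matters is that \<open>B\<close> depends neither on the arc nor on the packing: after division by
  \<open>card G\<close> the defect is at most \<open>e\<close> plus a term that vanishes as the packings grow.\<close>

lemma (in circle_diff_group) max_packing_averages_nearly_invariant:
  fixes \<phi> :: "complex \<Rightarrow> real" and e :: real
  assumes \<phi>: "continuous_on S1 \<phi>" and h: "h \<in> \<Gamma>" and e: "e > 0"
  obtains B where "\<And>I x G. max_packing I G \<Longrightarrow> connected I \<Longrightarrow> I \<subseteq> S1 \<Longrightarrow> x \<in> I \<Longrightarrow>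
    \<bar>(\<Sum>g\<in>G. \<phi> (h (g x))) - (\<Sum>g\<in>G. \<phi> (g x))\<bar> \<le> e * card G + B"
proof -
  have "continuous_on {0..2 * pi} (\<lambda>t. \<phi> (cis t))"
    by (rule continuous_on_compose2[OF \<phi>]) (auto intro!: continuous_intros)
  then have "uniformly_continuous_on {0..2 * pi} (\<lambda>t. \<phi> (cis t))"
    by (intro compact_uniformly_continuous) auto
  then obtain d where d: "d > 0" "\<And>s t. s \<in> {0..2 * pi} \<Longrightarrow> t \<in> {0..2 * pi} \<Longrightarrow> dist s t < d \<Longrightarrow>
      dist (\<phi> (cis s)) (\<phi> (cis t)) < e / 2"
    unfolding uniformly_continuous_on_def using half_gt_zero[OF e] by blast
  obtain L :: nat where L: "2 * pi / d < L" using reals_Archimedean2 by blast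
  have L0: "L > 0" using L d(1) by (metis divide_pos_pos mult_pos_pos of_nat_0_less_iff order.strict_trans pi_gt_zero zero_less_numeral)
  have Ld: "2 * pi / L < d" using L L0 d(1) by (simp add: field_simps)
  define c where "c i = \<phi> (cis (2 * pi * real i / L))" for i :: nat
  have near: "\<bar>\<phi> z - c (sector L z)\<bar> \<le> e / 2" if z: "z \<in> S1" for z
  proof -
    let ?i = "sector L z"
    have i: "2 * pi * ?i / L \<le> Arg2pi z" "Arg2pi z < 2 * pi * (?i + 1) / L"
      using sector_eq_iff[OF L0, of z ?i] by auto
    moreover have "2 * pi * (?i + 1) / L = 2 * pi * ?i / L + 2 * pi / L"
      by (simp add: add_divide_distrib algebra_simps)
    ultimately have "dist (Arg2pi z) (2 * pi * ?i / L) < d" using Ld by (simp add: dist_real_def)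
    moreover have "Arg2pi z < 2 * pi" "0 \<le> 2 * pi * ?i / L" by (simp_all add: Arg2pi_lt_2pi)
    ultimately have "dist (\<phi> (cis (Arg2pi z))) (\<phi> (cis (2 * pi * ?i / L))) < e / 2"
      using i by (intro d(2)) (auto simp: Arg2pi_ge_0)
    then show ?thesis using cis_Arg2pi[OF z] by (simp add: c_def dist_real_def)
  qed
  have "bounded (\<phi> ` S1)"
    by (intro compact_imp_bounded compact_continuous_image \<phi> compact_sphere)
  then obtain B where B: "\<And>z. z \<in> S1 \<Longrightarrow> norm (\<phi> z) \<le> B" unfolding bounded_iff by blast
  show ?thesis
  proof (rule that[of "L * (B * 4)"])
    fix I x G assume G: "max_packing I G" and I: "connected I" "I \<subseteq> S1" "x \<in> I"
    let ?G' = "compose S1 h ` G"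
    have x: "x \<in> S1" using I by blast
    have G': "max_packing I ?G'" "card ?G' = card G" using max_packing_translate[OF G h I(2)] by auto
    have in_\<Gamma>: "G \<subseteq> \<Gamma>" "?G' \<subseteq> \<Gamma>" "finite G" using G G'(1) by (auto simp: max_packing_def packing_def)
    have "(\<Sum>k\<in>?G'. \<phi> (k x)) = (\<Sum>g\<in>G. \<phi> (compose S1 h g x))"
      using inj_on_subset[OF compose_left_inj[OF h] in_\<Gamma>(1)] by (simp add: sum.reindex)
    then have sum: "(\<Sum>k\<in>?G'. \<phi> (k x)) = (\<Sum>g\<in>G. \<phi> (h (g x)))" using x by (simp add: compose_def)
    have "\<bar>(\<Sum>k\<in>?G'. \<phi> (k x)) - (\<Sum>g\<in>G. \<phi> (g x))\<bar> \<le> e / 2 * card ?G' + e / 2 * card G + L * (B * 4)"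
    proof (rule sums_close_if_counts_close[where p = "\<lambda>k. k x" and q = "\<lambda>k. k x" and c = c and \<iota> = "sector L"])
      show "\<bar>c i\<bar> \<le> B" for i using B[of "cis (2 * pi * real i / L)"] by (simp add: c_def)
      show "\<bar>real (card {g \<in> ?G'. sector L (g x) = i}) - real (card {g \<in> G. sector L (g x) = i})\<bar> \<le> 4"
        if "i < L" for i
        using max_packing_sector_counts[OF G G'(1) I that] max_packing_sector_counts[OF G'(1) G I that]
        by linarith
    qed (use in_\<Gamma> maps x near sector_less[OF L0] in auto)
    then show "\<bar>(\<Sum>g\<in>G. \<phi> (h (g x))) - (\<Sum>g\<in>G. \<phi> (g x))\<bar> \<le> e * card G + L * (B * 4)"
      by (simp add: sum G'(2))
  qed
qed

text \<open>If no arc around \<open>x\<close> is contractible, then translates of a given arc have lengths bounded below,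
  so maximal packings exist. Their cardinalities tend to infinity as the arc shrinks, because the orbit
  of \<open>x\<close> is infinite and small arcs around finitely many of its points are disjoint. A weak limit of the
  uniform measures on the points \<open>g x\<close> is then invariant.\<close>

lemma (in circle_diff_group) contractible_arc_or_invariant_measure:
  assumes x: "x \<in> S1"
    and no_measure: "\<not> (\<exists>m. prob_space m \<and> sets m = sets (restrict_space borel S1) \<and> preserves_measure \<Gamma> m)"
  shows "\<exists>r>0. \<forall>\<delta>>0. \<exists>g\<in>\<Gamma>. \<forall>y\<in>circle_arc x r. \<forall>z\<in>circle_arc x r. dist (g y) (g z) < \<delta>"
proof (rule ccontr)
  assume "\<not> ?thesis"
  then have not_contr: "\<exists>\<delta>>0. \<forall>g\<in>\<Gamma>. \<exists>y\<in>circle_arc x r. \<exists>z\<in>circle_arc x r. \<delta> \<le> dist (g y) (g z)"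
    if "r > 0" for r
    using that by (meson not_le)
  \<comment> \<open>Arcs of radius at most \<open>1\<close>, so shorter than the circle, as the length estimates require.\<close>
  define I where "I k = circle_arc x (1 / Suc k)" for k :: nat
  have I: "compact (I k)" "connected (I k)" "I k \<subseteq> S1" "x \<in> I k" for k
    using arc_subset_S1[OF x] compact_arc connected_arc center_in_arc by (auto simp: I_def)
  have "\<exists>G. max_packing (I k) G" for k
  proof -
    let ?r = "1 / real (Suc k)"
    have r: "?r > 0" "?r < pi" using pi_gt3 by (auto intro: le_less_trans[of _ 1])
    obtain \<delta> where "\<delta> > 0"
      and \<delta>: "\<And>g. g \<in> \<Gamma> \<Longrightarrow> \<exists>y\<in>circle_arc x ?r. \<exists>z\<in>circle_arc x ?r. \<delta> \<le> dist (g y) (g z)"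
      using not_contr[OF r(1)] by blast
    moreover have "\<delta> \<le> circle_length (g ` I k)" if g: "g \<in> \<Gamma>" for g
    proof -
      obtain y z where yz: "y \<in> circle_arc x ?r" "z \<in> circle_arc x ?r" "\<delta> \<le> dist (g y) (g z)"
        using \<delta>[OF g] by blast
      then show ?thesis
        using Diff1_plus_image_arc(2)[OF Diff[OF g] x r yz(1,2)] by (simp add: I_def)
    qed
    ultimately show ?thesis using I by (intro max_packing_exists[of _ \<delta>]) auto
  qed
  then obtain G where G: "\<And>k. max_packing (I k) (G k)" by metis
  have in_\<Gamma>: "G k \<subseteq> \<Gamma>" "finite (G k)" for k
    using G[of k] by (auto simp: max_packing_def packing_def)
  have card_G: "eventually (\<lambda>k. M \<le> card (G k)) sequentially" for M
  proof -
    have "infinite ((\<lambda>g. g x) ` \<Gamma>)" using finite_orbit_imp_invariant_measure[OF x] no_measure by blast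
    then obtain P where P: "P \<subseteq> (\<lambda>g. g x) ` \<Gamma>" "finite P" "card P = M"
      using infinite_arbitrarily_large by blast
    obtain H where H: "H \<subseteq> \<Gamma>" "inj_on (\<lambda>g. g x) H" "P = (\<lambda>g. g x) ` H"
      using P(1) by (meson subset_image_inj)
    have H': "finite H" "card H = M" using H P card_image finite_imageD by metis+
    have "eventually (\<lambda>k. g ` I k \<inter> h ` I k = {}) sequentially"
      if gh: "g \<in> H" "h \<in> H" "g \<noteq> h" for g h
    proof -
      let ?e = "dist (g x) (h x) / 2"
      have "?e > 0" using gh H(2) by (auto simp: inj_on_def)
      have small: "eventually (\<lambda>k. f ` I k \<subseteq> ball (f x) ?e) sequentially" if f: "f \<in> \<Gamma>" for f
      proof -
        obtain d where d: "d > 0" "\<And>y. y \<in> S1 \<Longrightarrow> dist y x < d \<Longrightarrow> dist (f y) (f x) < ?e"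
          using Diff1_plus_continuous[OF Diff[OF f]] x \<open>?e > 0\<close> unfolding continuous_on_iff by meson
        have "eventually (\<lambda>k. 1 / real (Suc k) < d) sequentially"
          using d(1) LIMSEQ_inverse_real_of_nat by (auto simp: inverse_eq_divide dest: order_tendstoD)
        then show ?thesis
        proof eventually_elim
          case (elim k)
          show ?case
          proof
            fix w assume "w \<in> f ` I k"
            then obtain y where y: "y \<in> circle_arc x (1 / Suc k)" "w = f y" by (auto simp: I_def)
            have "dist y x < d" using dist_arc_center[OF y(1) x] elim by linarith
            moreover have "y \<in> S1" using y(1) arc_subset_S1[OF x] by blast
            ultimately show "w \<in> ball (f x) ?e" using d(2)[of y] y(2) by (simp add: dist_commute)
          qed
        qed
      qed
      have "ball (g x) ?e \<inter> ball (h x) ?e = {}" by (rule disjoint_ballI) simp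
      moreover have "g \<in> \<Gamma>" "h \<in> \<Gamma>" using gh H(1) by auto
      note eventually_conj[OF small[OF this(1)] small[OF this(2)]]
      ultimately show ?thesis by (elim eventually_mono) blast
    qed
    then have "eventually (\<lambda>k. \<forall>g\<in>H. \<forall>h\<in>H. g \<noteq> h \<longrightarrow> g ` I k \<inter> h ` I k = {}) sequentially"
      using H'(1) by (intro eventually_ball_finite ballI) (auto simp: eventually_mono)
    then show ?thesis
    proof eventually_elim
      case (elim k)
      then have "packing (I k) H" using H H' by (simp add: packing_def)
      then show ?case using G[of k] H' by (auto simp: max_packing_def)
    qed
  qed
  have G_ne: "G k \<noteq> {}" for k
  proof -
    have "packing (I k) {\<lambda>x\<in>S1. x}" using one_in by (simp add: packing_def)
    then show ?thesis using G[of k] by (force simp: max_packing_def)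
  qed
  have "g x \<in> S1" if "g \<in> G k" for g k using that in_\<Gamma> maps x by blast
  with in_\<Gamma>(2) G_ne obtain r m where r: "strict_mono (r :: nat \<Rightarrow> nat)" and m: "prob_space m"
    "sets m = sets (restrict_space borel S1)"
    and lim: "\<And>\<phi> :: complex \<Rightarrow> real. continuous_on S1 \<phi> \<Longrightarrow>
      (\<lambda>k. (\<Sum>g\<in>G (r k). \<phi> (g x)) / card (G (r k))) \<longlonglongrightarrow> (\<integral>z. \<phi> z \<partial>m)"
    by (rule uniform_measures_weak_limit[of G "\<lambda>g. g x"]) blast+
  interpret m: prob_space m by (rule m(1))
  have invariant: "(\<integral>z. \<phi> (h z) \<partial>m) = (\<integral>z. \<phi> z \<partial>m)" if h: "h \<in> \<Gamma>" and \<phi>: "continuous_on S1 \<phi>"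
    for h and \<phi> :: "complex \<Rightarrow> real"
  proof -
    have \<phi>h: "continuous_on S1 (\<lambda>z. \<phi> (h z))"
      by (rule continuous_on_compose2[OF \<phi> Diff1_plus_continuous[OF Diff[OF h]]]) (use maps h in blast)
    let ?D = "\<lambda>k. (\<Sum>g\<in>G k. \<phi> (h (g x))) / card (G k) - (\<Sum>g\<in>G k. \<phi> (g x)) / card (G k)"
    have "?D \<longlonglongrightarrow> 0"
    proof (rule LIMSEQ_I)
      fix e :: real assume e: "e > 0"
      then have "e / 2 > 0" by simp
      then obtain B where B: "\<And>I x G. max_packing I G \<Longrightarrow> connected I \<Longrightarrow> I \<subseteq> S1 \<Longrightarrow> x \<in> I \<Longrightarrow>
          \<bar>(\<Sum>g\<in>G. \<phi> (h (g x))) - (\<Sum>g\<in>G. \<phi> (g x))\<bar> \<le> e / 2 * card G + B"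
        using max_packing_averages_nearly_invariant[OF \<phi> h] by metis
      obtain M :: nat where M: "2 * B / e < M" using reals_Archimedean2 by blast
      obtain K where K: "\<And>k. k \<ge> K \<Longrightarrow> M \<le> card (G k)"
        using card_G[of M] by (auto simp: eventually_sequentially)
      have "norm (?D k - 0) < e" if k: "k \<ge> K" for k
      proof -
        let ?N = "real (card (G k))"
        have N: "?N > 0" using G_ne in_\<Gamma> by (simp add: card_gt_0_iff)
        have "2 * B / e < ?N" using M K[OF k] by (meson less_le_trans of_nat_mono)
        then have "B < e / 2 * ?N" using e by (simp add: field_simps)
        then have "\<bar>(\<Sum>g\<in>G k. \<phi> (h (g x))) - (\<Sum>g\<in>G k. \<phi> (g x))\<bar> < e * ?N"
          using B[OF G[of k] I(2-4)] by (simp add: field_simps)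
        moreover have "?D k = ((\<Sum>g\<in>G k. \<phi> (h (g x))) - (\<Sum>g\<in>G k. \<phi> (g x))) / ?N"
          by (simp add: diff_divide_distrib)
        ultimately show ?thesis using N by (simp add: abs_divide divide_less_eq)
      qed
      then show "\<exists>K. \<forall>k\<ge>K. norm (?D k - 0) < e" by blast
    qed
    then have "(\<lambda>k. ?D (r k)) \<longlonglongrightarrow> 0" using LIMSEQ_subseq_LIMSEQ[OF _ r] by (auto simp: o_def)
    moreover have "(\<lambda>k. ?D (r k)) \<longlonglongrightarrow> (\<integral>z. \<phi> (h z) \<partial>m) - (\<integral>z. \<phi> z \<partial>m)"
      by (intro tendsto_diff lim \<phi> \<phi>h)
    ultimately show ?thesis using LIMSEQ_unique by fastforce
  qed
  have "distr m m h = m" if h: "h \<in> \<Gamma>" for h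
  proof (rule measure_on_S1_eqI)
    have hm: "h \<in> measurable m m" by (rule Diff1_plus_measurable[OF Diff[OF h] m(2)])
    show "finite_measure (distr m m h)" by (rule m.finite_measure_distr[OF hm])
    fix \<phi> :: "complex \<Rightarrow> real" assume \<phi>: "continuous_on UNIV \<phi>"
    have "\<phi> \<in> borel_measurable m"
      using measurable_restrict_space1[OF borel_measurable_continuous_onI[OF \<phi>], of S1]
        measurable_cong_sets[OF m(2) refl] by blast
    then have "(\<integral>z. \<phi> z \<partial>distr m m h) = (\<integral>z. \<phi> (h z) \<partial>m)" by (rule integral_distr[OF hm])
    then show "(\<integral>z. \<phi> z \<partial>distr m m h) = (\<integral>z. \<phi> z \<partial>m)"
      using invariant[OF h continuous_on_subset[OF \<phi>]] by simp
  qed (use m in \<open>simp_all add: m.finite_measure_axioms\<close>)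
  then have "preserves_measure \<Gamma> m" by (simp add: preserves_measure_def)
  then show False using no_measure m by blast
qed

section \<open>Concentration of finite sets\<close>

locale no_invariant_measure = circle_diff_group +
  assumes no_measure: "\<not> (\<exists>m. prob_space m \<and> sets m = sets (restrict_space borel S1) \<and> preserves_measure \<Gamma> m)"
begin

lemma infinite_orbit: "x \<in> S1 \<Longrightarrow> infinite ((\<lambda>g. g x) ` \<Gamma>)"
  using finite_orbit_imp_invariant_measure no_measure by blast

text \<open>A Lebesgue number of the cover by contractible arcs. For given \<open>\<delta>\<close> the finitely many elements that
  contract the arcs of a finite subcover suffice; finiteness makes them equicontinuous in
  \<open>finite_sets_concentrate\<close>.\<close>

lemma close_pairs_contractible:
  "\<exists>\<epsilon>>0. \<forall>\<delta>>0. \<exists>F. finite F \<and> F \<subseteq> \<Gamma> \<and>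
    (\<forall>y\<in>S1. \<forall>z\<in>S1. dist y z < \<epsilon> \<longrightarrow> (\<exists>k\<in>F. dist (k y) (k z) < \<delta>))"
proof -
  have "\<forall>x\<in>S1. \<exists>e>0. \<forall>\<delta>>0. \<exists>g\<in>\<Gamma>. \<forall>y\<in>S1. \<forall>z\<in>S1. dist y x < e \<longrightarrow> dist z x < e \<longrightarrow> dist (g y) (g z) < \<delta>"
  proof
    fix x assume x: "x \<in> S1"
    obtain r where r: "r > 0"
      and contr: "\<And>\<delta>. \<delta> > 0 \<Longrightarrow> \<exists>g\<in>\<Gamma>. \<forall>y\<in>circle_arc x r. \<forall>z\<in>circle_arc x r. dist (g y) (g z) < \<delta>"
      using contractible_arc_or_invariant_measure[OF x no_measure] by blast
    obtain e where "e > 0" "\<And>y. y \<in> S1 \<Longrightarrow> dist y x < e \<Longrightarrow> y \<in> circle_arc x r"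
      using close_imp_in_arc[OF r] x by metis
    then show "\<exists>e>0. \<forall>\<delta>>0. \<exists>g\<in>\<Gamma>. \<forall>y\<in>S1. \<forall>z\<in>S1. dist y x < e \<longrightarrow> dist z x < e \<longrightarrow> dist (g y) (g z) < \<delta>"
      using contr by meson
  qed
  from bchoice[OF this] obtain e where e: "\<forall>x\<in>S1. e x > 0 \<and>
      (\<forall>\<delta>>0. \<exists>g\<in>\<Gamma>. \<forall>y\<in>S1. \<forall>z\<in>S1. dist y x < e x \<longrightarrow> dist z x < e x \<longrightarrow> dist (g y) (g z) < \<delta>)" ..
  have "S1 \<subseteq> (\<Union>x\<in>S1. ball x (e x / 2))" using e by force
  then obtain X where X: "X \<subseteq> S1" "finite X" "S1 \<subseteq> (\<Union>x\<in>X. ball x (e x / 2))"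
    using compactE_image[OF compact_sphere, of S1 "\<lambda>x. ball x (e x / 2)" 0 1] by auto
  have "(1 :: complex) \<in> S1" by simp
  then have "X \<noteq> {}" using X(3) by blast
  define \<epsilon> where "\<epsilon> = Min ((\<lambda>x. e x / 2) ` X)"
  have \<epsilon>: "\<epsilon> \<le> e x / 2" if "x \<in> X" for x unfolding \<epsilon>_def using that X(2) by (intro Min_le) auto
  show ?thesis
  proof (intro exI[of _ \<epsilon>] conjI allI impI)
    show "\<epsilon> > 0" using \<open>X \<noteq> {}\<close> X e unfolding \<epsilon>_def by (subst Min_gr_iff) auto
    fix \<delta> :: real assume \<delta>: "\<delta> > 0"
    have "\<forall>x\<in>X. \<exists>g. g \<in> \<Gamma> \<and> (\<forall>y\<in>S1. \<forall>z\<in>S1. dist y x < e x \<longrightarrow> dist z x < e x \<longrightarrow> dist (g y) (g z) < \<delta>)"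
      using e X(1) \<delta> by blast
    from bchoice[OF this] obtain k where k: "\<forall>x\<in>X. k x \<in> \<Gamma> \<and>
      (\<forall>y\<in>S1. \<forall>z\<in>S1. dist y x < e x \<longrightarrow> dist z x < e x \<longrightarrow> dist (k x y) (k x z) < \<delta>)" ..
    show "\<exists>F. finite F \<and> F \<subseteq> \<Gamma> \<and> (\<forall>y\<in>S1. \<forall>z\<in>S1. dist y z < \<epsilon> \<longrightarrow> (\<exists>k\<in>F. dist (k y) (k z) < \<delta>))"
    proof (intro exI[of _ "k ` X"] conjI ballI impI)
      fix y z assume yz: "y \<in> S1" "z \<in> S1" "dist y z < \<epsilon>"
      then obtain x where x: "x \<in> X" "dist x y < e x / 2" using X(3) by auto
      have "dist z x < e x" using x yz \<epsilon>[OF x(1)] dist_triangle[of z x y] by (simp add: dist_commute)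
      moreover have "dist y x < e x" using x(2) zero_le_dist[of x y] unfolding dist_commute[of y x] by linarith
      ultimately show "\<exists>k\<in>k ` X. dist (k y) (k z) < \<delta>" using k x(1) yz by blast
    qed (use X k in auto)
  qed
qed

text \<open>Let \<open>c0\<close> be the largest number of pairs from \<open>P\<close> that can be brought arbitrarily close together at
  once. Choose \<open>g\<close> that brings \<open>c0\<close> pairs so close that they stay close under every element of
  the finite set \<open>F\<close>. If two image points had distance at least \<open>\<delta>\<close> but below \<open>\<epsilon>\<close>, an element of \<open>F\<close> would bring
  them together as well, giving \<open>c0 + 1\<close> close pairs. So each ball of radius \<open>\<epsilon> / 2\<close> contains at most one
  cluster, and \<open>m\<close> is the number of such balls in a cover of the circle.\<close>

lemma finite_sets_concentrate:
  "\<exists>m :: nat. \<forall>P \<delta>. finite P \<longrightarrow> P \<subseteq> S1 \<longrightarrow> \<delta> > 0 \<longrightarrow>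
    (\<exists>g\<in>\<Gamma>. \<exists>q. (\<forall>i<m. q i \<in> S1) \<and> (\<forall>p\<in>P. \<exists>i<m. dist (g p) (q i) < \<delta>))"
proof -
  obtain \<epsilon> :: real where \<epsilon>: "\<epsilon> > 0" "\<forall>\<delta>>0. \<exists>F. finite F \<and> F \<subseteq> \<Gamma> \<and>
    (\<forall>y\<in>S1. \<forall>z\<in>S1. dist y z < \<epsilon> \<longrightarrow> (\<exists>k\<in>F. dist (k y) (k z) < \<delta>))"
    using close_pairs_contractible by (elim exE conjE)
  have "S1 \<subseteq> (\<Union>x\<in>S1. ball x (\<epsilon> / 2))" using \<epsilon>(1) by (intro subsetI UN_I) auto
  then obtain X where X: "X \<subseteq> S1" "finite X" "S1 \<subseteq> (\<Union>x\<in>X. ball x (\<epsilon> / 2))"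
    using compactE_image[OF compact_sphere, of S1 "\<lambda>x. ball x (\<epsilon> / 2)" 0 1] by auto
  obtain c m where c: "X = c ` {i. i < (m :: nat)}"
    using finite_imp_nat_seg_image_inj_on[OF X(2)] by blast
  show ?thesis
  proof (intro exI[of _ m] allI impI)
    fix P and \<delta> :: real assume P: "finite P" "P \<subseteq> S1" and \<delta>: "\<delta> > 0"
    define N where "N d g = card {(x, y) \<in> P \<times> P. dist (g x) (g y) < d}" for d :: real and g :: "complex \<Rightarrow> complex"
    define Q where "Q k \<longleftrightarrow> (\<forall>d>0. \<exists>g\<in>\<Gamma>. k \<le> N d g)" for k
    have fin: "finite {(x, y) \<in> P \<times> P. R x y}" for R
      by (rule finite_subset[of _ "P \<times> P"]) (use P(1) in auto)
    have bound: "k \<le> card (P \<times> P)" if k: "Q k" for k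
    proof -
      obtain g where "k \<le> N 1 g" using k unfolding Q_def by (metis zero_less_one)
      also have "\<dots> \<le> card (P \<times> P)" unfolding N_def using P(1) by (intro card_mono) auto
      finally show ?thesis .
    qed
    have Q0: "Q 0" unfolding Q_def using one_in by auto
    define c0 where "c0 = Greatest Q"
    have "Q c0" unfolding c0_def using Q0 bound by (rule GreatestI_nat)
    have "\<not> Q (Suc c0)" using Greatest_le_nat[of Q "Suc c0", OF _ bound] by (auto simp: c0_def)
    then obtain d0 where d0: "d0 > 0" "\<And>g. g \<in> \<Gamma> \<Longrightarrow> N d0 g \<le> c0"
      unfolding Q_def by (auto simp: not_le less_Suc_eq_le not_less_eq_eq)
    define \<delta>' where "\<delta>' = min \<delta> d0"
    have \<delta>': "\<delta>' > 0" "\<delta>' \<le> \<delta>" "\<delta>' \<le> d0" using \<delta> d0 by (auto simp: \<delta>'_def)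
    obtain F where F: "finite F" "F \<subseteq> \<Gamma>"
      "\<And>y z. y \<in> S1 \<Longrightarrow> z \<in> S1 \<Longrightarrow> dist y z < \<epsilon> \<Longrightarrow> \<exists>k\<in>F. dist (k y) (k z) < \<delta>'"
      using \<epsilon>(2)[rule_format, OF \<delta>'(1)] by blast
    have "\<exists>d>0. \<forall>k\<in>F. \<forall>u\<in>S1. \<forall>v\<in>S1. dist u v < d \<longrightarrow> dist (k u) (k v) < \<delta>'"
      using F(1,2)
    proof (induction F rule: finite_induct)
      case empty then show ?case by (auto intro: exI[of _ 1])
    next
      case (insert k F)
      then obtain d where d: "d > 0" "\<forall>k\<in>F. \<forall>u\<in>S1. \<forall>v\<in>S1. dist u v < d \<longrightarrow> dist (k u) (k v) < \<delta>'" by auto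
      have "uniformly_continuous_on S1 k"
        using insert.prems by (intro compact_uniformly_continuous Diff1_plus_continuous Diff compact_sphere) auto
      then obtain d' where d': "d' > 0" "\<forall>u\<in>S1. \<forall>v\<in>S1. dist v u < d' \<longrightarrow> dist (k v) (k u) < \<delta>'"
        unfolding uniformly_continuous_on_def using \<delta>'(1) by blast
      show ?case using d d' by (intro exI[of _ "min d d'"]) auto
    qed
    then obtain d where d: "d > 0" "\<And>k u v. k \<in> F \<Longrightarrow> u \<in> S1 \<Longrightarrow> v \<in> S1 \<Longrightarrow> dist u v < d \<Longrightarrow> dist (k u) (k v) < \<delta>'"
      by blast
    define d1 where "d1 = min d \<delta>'"
    have d1: "d1 > 0" "d1 \<le> d" "d1 \<le> \<delta>'" using d(1) \<delta>'(1) by (auto simp: d1_def)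
    obtain g where g: "g \<in> \<Gamma>" "c0 \<le> N d1 g" using \<open>Q c0\<close> d1(1) unfolding Q_def by blast
    have gap: "dist (g x) (g y) < \<delta>" if xy: "x \<in> P" "y \<in> P" "dist (g x) (g y) < \<epsilon>" for x y
    proof (rule ccontr)
      assume far: "\<not> ?thesis"
      have S: "g z \<in> S1" if "z \<in> P" for z using maps[OF g(1)] that P(2) by blast
      obtain k where k: "k \<in> F" "dist (k (g x)) (k (g y)) < \<delta>'" using F(3)[OF S S] xy by blast
      have kg: "compose S1 k g \<in> \<Gamma>" using k F(2) g compose_in by blast
      have kg_apply: "compose S1 k g z = k (g z)" if "z \<in> P" for z using that P(2) by (auto simp: compose_def)
      have "insert (x, y) {(x, y) \<in> P \<times> P. dist (g x) (g y) < d1} \<subseteq>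
          {(x, y) \<in> P \<times> P. dist (compose S1 k g x) (compose S1 k g y) < d0}"
      proof
        fix w assume w: "w \<in> insert (x, y) {(x, y) \<in> P \<times> P. dist (g x) (g y) < d1}"
        obtain a b where ab: "w = (a, b)" by (cases w)
        then have P': "a \<in> P" "b \<in> P" and "(a, b) = (x, y) \<or> dist (g a) (g b) < d1" using w xy by auto
        then have "dist (k (g a)) (k (g b)) < \<delta>'"
          using k d(2)[OF k(1) S S, of a b] d1(2) by auto
        then show "w \<in> {(x, y) \<in> P \<times> P. dist (compose S1 k g x) (compose S1 k g y) < d0}"
          using ab P' \<delta>'(3) by (simp add: kg_apply)
      qed
      then have "card (insert (x, y) {(x, y) \<in> P \<times> P. dist (g x) (g y) < d1}) \<le> N d0 (compose S1 k g)"
        unfolding N_def by (intro card_mono fin)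
      moreover have "(x, y) \<notin> {(x, y) \<in> P \<times> P. dist (g x) (g y) < d1}" using far d1(3) \<delta>'(2) by auto
      ultimately have "Suc (N d1 g) \<le> N d0 (compose S1 k g)" using fin by (simp add: N_def)
      then show False using d0(2)[OF kg] g(2) by simp
    qed
    define q where "q i = (if \<exists>p\<in>P. g p \<in> ball (c i) (\<epsilon> / 2) then g (SOME p. p \<in> P \<and> g p \<in> ball (c i) (\<epsilon> / 2)) else 1)" for i
    have q: "\<exists>p'\<in>P. q i = g p' \<and> g p' \<in> ball (c i) (\<epsilon> / 2)" if "p \<in> P" "g p \<in> ball (c i) (\<epsilon> / 2)" for p i
    proof -
      have "\<exists>p. p \<in> P \<and> g p \<in> ball (c i) (\<epsilon> / 2)" using that by blast
      from someI_ex[OF this] show ?thesis using that unfolding q_def by auto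
    qed
    have "\<exists>i<m. dist (g p) (q i) < \<delta>" if p: "p \<in> P" for p
    proof -
      have "g p \<in> S1" using p P(2) maps[OF g(1)] by blast
      then obtain i where i: "i < m" "g p \<in> ball (c i) (\<epsilon> / 2)" using X(3) c by blast
      then obtain p' where p': "p' \<in> P" "q i = g p'" "g p' \<in> ball (c i) (\<epsilon> / 2)" using q[OF p] by blast
      have "dist (g p) (g p') < \<epsilon>"
        using i(2) p'(3) dist_triangle[of "g p" "g p'" "c i"] by (simp add: dist_commute)
      then show ?thesis using gap[OF p p'(1)] i(1) p'(2) by auto
    qed
    moreover have "q i \<in> S1" for i
    proof (cases "\<exists>p\<in>P. g p \<in> ball (c i) (\<epsilon> / 2)")
      case True
      then obtain p' where "p' \<in> P" "q i = g p'" using q by blast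
      then show ?thesis using maps[OF g(1)] P(2) by auto
    qed (simp add: q_def)
    ultimately show "\<exists>g\<in>\<Gamma>. \<exists>q. (\<forall>i<m. q i \<in> S1) \<and> (\<forall>p\<in>P. \<exists>i<m. dist (g p) (q i) < \<delta>)"
      using g(1) by blast
  qed
qed

end

lemma finite_family_convergent_subsequence:
  fixes q :: "nat \<Rightarrow> 'i \<Rightarrow> 'a :: metric_space"
  assumes "finite I" "compact K" "\<And>n i. i \<in> I \<Longrightarrow> q n i \<in> K"
  shows "\<exists>r l. strict_mono (r :: nat \<Rightarrow> nat) \<and> (\<forall>i\<in>I. l i \<in> K \<and> (\<lambda>n. q (r n) i) \<longlonglongrightarrow> l i)"
  using assms(1,3)
proof (induction I rule: finite_induct)
  case empty
  show ?case by (intro exI[of _ id]) (auto simp: strict_mono_def)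
next
  case (insert j I)
  have "\<exists>r l. strict_mono (r :: nat \<Rightarrow> nat) \<and> (\<forall>i\<in>I. l i \<in> K \<and> (\<lambda>n. q (r n) i) \<longlonglongrightarrow> l i)"
    by (rule insert.IH) (use insert.prems in blast)
  then obtain r l where r: "strict_mono (r :: nat \<Rightarrow> nat)"
    and l: "\<And>i. i \<in> I \<Longrightarrow> l i \<in> K \<and> (\<lambda>n. q (r n) i) \<longlonglongrightarrow> l i"
    by blast
  have "seq_compact K" using assms(2) by (simp add: compact_eq_seq_compact_metric)
  then obtain a s where a: "a \<in> K" "strict_mono (s :: nat \<Rightarrow> nat)" "((\<lambda>n. q (r n) j) \<circ> s) \<longlonglongrightarrow> a"
    by (rule seq_compactE[where f = "\<lambda>n. q (r n) j"]) (use insert.prems in blast)+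
  have "(\<lambda>n. q ((r \<circ> s) n) i) \<longlonglongrightarrow> l i" if "i \<in> I" for i
    using LIMSEQ_subseq_LIMSEQ[OF conjunct2[OF l[OF that]] a(2)] by (simp add: o_def)
  then show ?case
    using l a insert.hyps strict_mono_o[OF r a(2)]
    by (intro exI[of _ "r \<circ> s"] exI[of _ "l(j := a)"]) (auto simp: o_def)
qed

section \<open>Collapsing the complement of a finite set\<close>

lemma cis_root_of_unity:
  fixes j :: int
  assumes "n > 0"
  shows "cis (2 * pi * j / n) ^ n = 1"
proof -
  have "cis (2 * pi * j / n) ^ n = cis (2 * pi * j)" using assms unfolding Complex.DeMoivre by (intro arg_cong[where f = cis]) simp
  also have "\<dots> = 1" by (rule cis_multiple_2pi) simp
  finally show ?thesis .
qed

lemma connected_avoiding_multiples: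
  fixes U :: "real set"
  assumes U: "connected U" "x \<in> U" "y \<in> U" and d: "d > 0"
    and avoid: "\<And>j :: int. d * j \<notin> U"
  shows "\<bar>x - y\<bar> \<le> d"
proof -
  have *: "y - x \<le> d" if "x \<in> U" "y \<in> U" for x y
  proof (rule ccontr)
    assume far: "\<not> ?thesis"
    define j where "j = \<lceil>x / d\<rceil>"
    have "x / d \<le> j" "j < x / d + 1" unfolding j_def by linarith+
    then have "x \<le> d * j" "d * j < x + d" using d by (simp_all add: field_simps)
    moreover from this have "d * j \<le> y" using far by linarith
    ultimately have "d * j \<in> U" using connectedD_interval[OF U(1) that] by blast
    then show False using avoid by blast
  qed
  show ?thesis using *[OF U(2,3)] *[OF U(3,2)] by linarith
qed

context no_invariant_measure
begin

text \<open>Elements of the group take the complement of any neighbourhood of the repelling set \<open>R\<close> into any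
  neighbourhood of the attracting set \<open>A\<close>.\<close>

definition collapses :: "complex set \<Rightarrow> complex set \<Rightarrow> bool" where
  "collapses R A \<longleftrightarrow> finite R \<and> finite A \<and> R \<subseteq> S1 \<and> A \<subseteq> S1 \<and> A \<noteq> {} \<and>
    (\<forall>e>0. \<exists>f\<in>\<Gamma>. \<forall>p\<in>S1. (\<forall>x\<in>R. e \<le> dist p x) \<longrightarrow> (\<exists>y\<in>A. dist (f p) y < e))"

text \<open>Let \<open>g n\<close> concentrate the \<open>n + 1\<close>-st roots of unity near \<open>m\<close> points, and let \<open>R\<close> consist of the limits of
  these points along a subsequence. Away from \<open>R\<close> the inverse \<open>f n\<close> of \<open>g n\<close> takes no such root of unity as
  a value if \<open>n\<close> is a late index of the subsequence, so by the intermediate value theorem for a lift it moves the ends of an interval that avoids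
  \<open>R\<close> to points at distance at most \<open>2 * pi / (n + 1)\<close>. It therefore suffices to choose one base point
  in each of the finitely many components of the complement of \<open>R\<close>; limits of their images form \<open>A\<close>. The
  point \<open>1\<close> is added to \<open>R\<close> so that components become intervals of angles in \<open>[0, 2 * pi]\<close>, and to \<open>A\<close> so
  that \<open>A\<close> is nonempty.\<close>

lemma collapses_exists: "\<exists>R A. collapses R A"
proof -
  obtain m :: nat where m: "\<forall>P \<delta>. finite P \<longrightarrow> P \<subseteq> S1 \<longrightarrow> \<delta> > 0 \<longrightarrow>
    (\<exists>g\<in>\<Gamma>. \<exists>q. (\<forall>i<m. q i \<in> S1) \<and> (\<forall>p\<in>P. \<exists>i<m. dist (g p) (q i) < \<delta>))"
    using finite_sets_concentrate by (elim exE)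
  define P where "P n = {z :: complex. z ^ Suc n = 1}" for n
  have P: "finite (P n)" "P n \<subseteq> S1" for n
  proof -
    show "finite (P n)" unfolding P_def by (rule finite_roots_unity) simp
    show "P n \<subseteq> S1"
    proof
      fix z assume "z \<in> P n"
      then have "norm z = 1 \<or> Suc n = 0" unfolding P_def by (intro power_eq_1_iff) simp
      then show "z \<in> S1" by simp
    qed
  qed
  have "\<exists>g q. g \<in> \<Gamma> \<and> (\<forall>i<m. q i \<in> S1) \<and> (\<forall>p\<in>P n. \<exists>i<m. dist (g p) (q i) < 1 / Suc n)" for n
    using m[rule_format, OF P[of n], of "1 / Suc n"] by auto
  then obtain g q where g: "\<And>n. g n \<in> \<Gamma>" and q: "\<And>n i. i < m \<Longrightarrow> q n i \<in> S1"
    and gq: "\<And>n p. p \<in> P n \<Longrightarrow> \<exists>i<m. dist (g n p) (q n i) < 1 / Suc n"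
    by metis
  have "\<exists>r l. strict_mono (r :: nat \<Rightarrow> nat) \<and> (\<forall>i\<in>{..<m}. l i \<in> S1 \<and> (\<lambda>n. q (r n) i) \<longlonglongrightarrow> l i)"
    by (rule finite_family_convergent_subsequence) (use q compact_sphere in auto)
  then obtain r l where r: "strict_mono (r :: nat \<Rightarrow> nat)"
    and l: "\<And>i. i < m \<Longrightarrow> l i \<in> S1" "\<And>i. i < m \<Longrightarrow> (\<lambda>n. q (r n) i) \<longlonglongrightarrow> l i"
    by blast
  define R where "R = insert 1 (l ` {..<m})"
  have R: "finite R" "R \<subseteq> S1" using l(1) by (auto simp: R_def)
  define \<Theta> where "\<Theta> = insert 0 (insert (2 * pi) (Arg2pi ` R))"
  have \<Theta>: "finite \<Theta>" "\<Theta> \<noteq> {}" using R(1) by (auto simp: \<Theta>_def)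
  have \<Theta>_R: "cis \<theta> \<in> R" if "\<theta> \<in> \<Theta>" for \<theta>
    using that R(2) cis_Arg2pi by (auto simp: \<Theta>_def) (auto simp: R_def)
  define T where "T = {0..2 * pi} - \<Theta>"
  \<comment> \<open>Two angles outside \<open>\<Theta>\<close> lie in the same component exactly if \<open>\<sigma>\<close> agrees on them.\<close>
  define \<sigma> where "\<sigma> t = {\<theta> \<in> \<Theta>. \<theta> < t}" for t :: real
  define \<beta> where "\<beta> s = (SOME t. t \<in> T \<and> \<sigma> t = s)" for s
  have \<beta>: "\<beta> (\<sigma> t) \<in> T" "\<sigma> (\<beta> (\<sigma> t)) = \<sigma> t" if "t \<in> T" for t
    using someI[of "\<lambda>u. u \<in> T \<and> \<sigma> u = \<sigma> t" t] that by (auto simp: \<beta>_def)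
  define B where "B = (\<lambda>t. \<beta> (\<sigma> t)) ` T"
  have "\<sigma> ` T \<subseteq> Pow \<Theta>" by (auto simp: \<sigma>_def)
  then have "finite (\<sigma> ` T)" using \<Theta>(1) finite_subset by blast
  then have "finite (\<beta> ` \<sigma> ` T)" by (rule finite_imageI)
  moreover have "\<beta> ` \<sigma> ` T = B" by (simp add: B_def image_image)
  ultimately have B: "finite B" "B \<subseteq> T" unfolding B_def using \<beta>(1) by auto
  define f where "f n = circle_inv (g n)" for n
  have f: "f n \<in> \<Gamma>" for n using inv_in g by (simp add: f_def)
  have "\<exists>r' a. strict_mono (r' :: nat \<Rightarrow> nat) \<and>
      (\<forall>b\<in>B. a b \<in> S1 \<and> (\<lambda>n. f (r (r' n)) (cis b)) \<longlonglongrightarrow> a b)"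
    by (rule finite_family_convergent_subsequence[of B S1 "\<lambda>n b. f (r n) (cis b)"])
      (use B(1) maps[OF f] compact_sphere in auto)
  then obtain r' a where r': "strict_mono (r' :: nat \<Rightarrow> nat)"
    and a: "\<And>b. b \<in> B \<Longrightarrow> a b \<in> S1" "\<And>b. b \<in> B \<Longrightarrow> (\<lambda>n. f (r (r' n)) (cis b)) \<longlonglongrightarrow> a b"
    by blast
  define A where "A = insert 1 (a ` B)"
  have A: "finite A" "A \<subseteq> S1" "A \<noteq> {}" using a(1) B(1) by (auto simp: A_def)
  have "\<exists>f\<in>\<Gamma>. \<forall>p\<in>S1. (\<forall>x\<in>R. e \<le> dist p x) \<longrightarrow> (\<exists>y\<in>A. dist (f p) y < e)" if e: "e > 0" for e
  proof -
    define e' where "e' = Min (insert e ((\<lambda>(b, \<theta>). \<bar>b - \<theta>\<bar>) ` (B \<times> \<Theta>)))"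
    have fin: "finite (insert e ((\<lambda>(b, \<theta>). \<bar>b - \<theta>\<bar>) ` (B \<times> \<Theta>)))" using B(1) \<Theta>(1) by simp
    have "e' > 0" unfolding e'_def using fin e B(2) by (subst Min_gr_iff) (auto simp: T_def)
    have "e' \<le> e" unfolding e'_def using fin by (intro Min_le) auto
    have e'_le: "e' \<le> \<bar>b - \<theta>\<bar>" if "b \<in> B" "\<theta> \<in> \<Theta>" for b \<theta>
      unfolding e'_def using fin that by (intro Min_le) (auto intro!: image_eqI[where x = "(b, \<theta>)"])
    \<comment> \<open>Compact, contains the base points, and stays away from \<open>R\<close> after projection to the circle.\<close>
    define V where "V = {s \<in> {0..2 * pi}. \<forall>\<theta>\<in>\<Theta>. e' \<le> \<bar>s - \<theta>\<bar>}"
    have "V = {0..2 * pi} \<inter> (\<Inter>\<theta>\<in>\<Theta>. {s. e' \<le> \<bar>s - \<theta>\<bar>})" by (auto simp: V_def)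
    moreover have "closed {s. e' \<le> \<bar>s - \<theta>\<bar>}" for \<theta> by (intro closed_Collect_le continuous_intros)
    ultimately have "compact V" by (auto intro!: compact_Int_closed closed_INT)
    then have "compact (cis ` V)" by (intro compact_continuous_image continuous_intros)
    moreover have "closed R" using R(1) by (rule finite_imp_closed)
    moreover have "cis ` V \<inter> R = {}"
    proof (rule ccontr)
      assume "\<not> ?thesis"
      then obtain s where s: "s \<in> V" "cis s \<in> R" by blast
      let ?\<theta> = "Arg2pi (cis s)"
      have \<theta>: "?\<theta> \<in> \<Theta>" "cis s = cis ?\<theta>" using s(2) cis_Arg2pi by (auto simp: \<Theta>_def)
      have "e' \<le> \<bar>s - 2 * pi\<bar>" using s(1) by (auto simp: V_def \<Theta>_def)
      then have "\<bar>s - ?\<theta>\<bar> < 2 * pi"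
        using s(1) Arg2pi_ge_0[of "cis s"] Arg2pi_lt_2pi[of "cis s"] \<open>e' > 0\<close> by (auto simp: V_def)
      then have "s = ?\<theta>" by (rule cis_eq_imp_eq[OF \<theta>(2)])
      then have "e' \<le> \<bar>s - s\<bar>" using s(1) \<theta>(1) unfolding V_def by auto
      then show False using \<open>e' > 0\<close> by simp
    qed
    ultimately obtain \<eta> where \<eta>: "\<eta> > 0" "\<And>z x. z \<in> cis ` V \<Longrightarrow> x \<in> R \<Longrightarrow> \<eta> \<le> dist z x"
      using separate_compact_closed[of "cis ` V" R] by blast
    let ?r = "\<lambda>n. r (r' n)"
    have sub: "strict_mono ?r" using strict_mono_o[OF r r'] by (simp add: o_def)
    have "eventually (\<lambda>n. dist (q (?r n) i) (l i) < \<eta> / 2) sequentially" if "i < m" for i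
    proof -
      have "(\<lambda>n. q (?r n) i) \<longlonglongrightarrow> l i" using LIMSEQ_subseq_LIMSEQ[OF l(2)[OF that] r'] by (simp add: o_def)
      then show ?thesis using \<eta>(1) by (intro tendstoD) auto
    qed
    then have 1: "eventually (\<lambda>n. \<forall>i\<in>{..<m}. dist (q (?r n) i) (l i) < \<eta> / 2) sequentially"
      by (intro eventually_ball_finite) auto
    have 2: "eventually (\<lambda>n. \<forall>b\<in>B. dist (f (?r n) (cis b)) (a b) < e / 2) sequentially"
      using a(2) e B(1) by (intro eventually_ball_finite ballI tendstoD) auto
    have "(\<lambda>n. 1 / real (Suc (?r n))) \<longlonglongrightarrow> 0"
      using LIMSEQ_subseq_LIMSEQ[OF LIMSEQ_inverse_real_of_nat sub] by (simp add: o_def inverse_eq_divide)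
    moreover have "min (\<eta> / 2) (e / 2 / (2 * pi)) > 0" using \<eta> e by simp
    ultimately have 3: "eventually (\<lambda>n. 1 / real (Suc (?r n)) < min (\<eta> / 2) (e / 2 / (2 * pi))) sequentially"
      by (rule order_tendstoD)
    have "eventually (\<lambda>n. (\<forall>i\<in>{..<m}. dist (q (?r n) i) (l i) < \<eta> / 2) \<and>
      (\<forall>b\<in>B. dist (f (?r n) (cis b)) (a b) < e / 2) \<and>
      1 / real (Suc (?r n)) < min (\<eta> / 2) (e / 2 / (2 * pi))) sequentially"
      using 1 2 3 by eventually_elim blast
    from eventually_happens'[OF sequentially_bot this]
    obtain n where n: "\<forall>i\<in>{..<m}. dist (q (?r n) i) (l i) < \<eta> / 2"
      "\<forall>b\<in>B. dist (f (?r n) (cis b)) (a b) < e / 2"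
      "1 / real (Suc (?r n)) < min (\<eta> / 2) (e / 2 / (2 * pi))"
      by blast
    define N where "N = ?r n"
    have avoid: "f N z \<notin> P N" if z: "z \<in> cis ` V" for z
    proof
      assume "f N z \<in> P N"
      then obtain i where i: "i < m" "dist (g N (f N z)) (q N i) < 1 / Suc N" using gq by blast
      have "g N (f N z) = z" using apply_inv[OF g, of z N] z by (auto simp: f_def)
      then have "dist z (q N i) < \<eta> / 2" using i(2) n(3) by (simp add: N_def)
      moreover have "dist (q N i) (l i) < \<eta> / 2" using n(1) i(1) by (simp add: N_def)
      ultimately have "dist z (l i) < \<eta>" using dist_triangle[of z "l i" "q N i"] by linarith
      moreover have "l i \<in> R" using i(1) by (simp add: R_def)
      ultimately show False using \<eta>(2)[OF z] by fastforce
    qed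
    obtain F where F: "\<And>t. f N (cis t) = cis (F t)"
      "\<And>t. (F has_real_derivative circle_deriv (f N) (cis t)) (at t)"
      using Diff1_plus_lift[OF Diff[OF f]] by metis
    have contF: "continuous_on U F" for U
      using F(2) by (meson DERIV_isCont continuous_at_imp_continuous_on)
    have "\<exists>y\<in>A. dist (f N p) y < e" if p: "p \<in> S1" "\<forall>x\<in>R. e \<le> dist p x" for p
    proof -
      define t where "t = Arg2pi p"
      have t: "cis t = p" "0 \<le> t" "t \<le> 2 * pi"
        using cis_Arg2pi[OF p(1)] Arg2pi_ge_0[of p] Arg2pi_lt_2pi[of p] by (auto simp: t_def)
      have t\<theta>: "e' \<le> \<bar>t - \<theta>\<bar>" if "\<theta> \<in> \<Theta>" for \<theta>
      proof -
        have "e \<le> dist (cis t) (cis \<theta>)" using p(2) \<Theta>_R[OF that] t(1) by auto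
        then show ?thesis using dist_cis_le[of t \<theta>] \<open>e' \<le> e\<close> by linarith
      qed
      then have "t \<in> T" using t \<open>e' > 0\<close> unfolding T_def by force
      define b where "b = \<beta> (\<sigma> t)"
      have b: "b \<in> B" "b \<in> T" "\<sigma> b = \<sigma> t" using \<beta>[OF \<open>t \<in> T\<close>] \<open>t \<in> T\<close> by (auto simp: b_def B_def)
      have seg: "u \<in> V" if u: "u \<in> {min t b..max t b}" for u
      proof -
        have "e' \<le> \<bar>u - \<theta>\<bar>" if \<theta>: "\<theta> \<in> \<Theta>" for \<theta>
        proof -
          have "\<theta> < b \<longleftrightarrow> \<theta> < t" using b(3) \<theta> by (auto simp: \<sigma>_def)
          then show ?thesis using t\<theta>[OF \<theta>] e'_le[OF b(1) \<theta>] u by (auto simp: min_def max_def split: if_splits)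
        qed
        moreover have "u \<in> {0..2 * pi}" using u t b(2) by (auto simp: T_def)
        ultimately show ?thesis by (simp add: V_def)
      qed
      have "\<bar>F t - F b\<bar> \<le> 2 * pi / Suc N"
      proof (rule connected_avoiding_multiples[where U = "F ` {min t b..max t b}"])
        show "connected (F ` {min t b..max t b})" by (intro connected_continuous_image contF) simp
        show "F t \<in> F ` {min t b..max t b}" "F b \<in> F ` {min t b..max t b}" by auto
        fix j :: int
        show "2 * pi / real (Suc N) * j \<notin> F ` {min t b..max t b}"
        proof
          assume "2 * pi / real (Suc N) * j \<in> F ` {min t b..max t b}"
          then obtain u where u: "u \<in> {min t b..max t b}" "2 * pi / real (Suc N) * j = F u" by blast
          have "2 * pi * j / Suc N = F u" using u(2) by simp
          then have "f N (cis u) = cis (2 * pi * j / Suc N)" by (simp only: F(1))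
          then have "f N (cis u) \<in> P N" using cis_root_of_unity[of "Suc N" j] by (simp add: P_def)
          then show False using avoid seg[OF u(1)] by blast
        qed
      qed simp
      then have "dist (f N p) (f N (cis b)) \<le> 2 * pi * (1 / Suc N)"
        using dist_cis_le[of "F t" "F b"] F(1) t(1) by auto
      also have "\<dots> < 2 * pi * (e / 2 / (2 * pi))"
        using n(3) by (intro mult_strict_left_mono) (auto simp: N_def)
      finally have "dist (f N p) (f N (cis b)) < e / 2" by simp
      moreover have "dist (f N (cis b)) (a b) < e / 2" using n(2) b(1) by (simp add: N_def)
      ultimately have "dist (f N p) (a b) < e"
        using dist_triangle[of "f N p" "a b" "f N (cis b)"] by linarith
      then show ?thesis using b(1) by (auto simp: A_def)
    qed
    then show ?thesis using f by blast
  qed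
  then have "collapses R A" using R A by (simp add: collapses_def)
  then show ?thesis by blast
qed

end

section \<open>Separation of finite sets and ping-pong\<close>

lemma finite_imp_separated:
  fixes X :: "'a :: metric_space set"
  assumes "finite X"
  obtains \<eta> where "\<eta> > 0" "\<And>x y. x \<in> X \<Longrightarrow> y \<in> X \<Longrightarrow> x \<noteq> y \<Longrightarrow> \<eta> \<le> dist x y"
proof -
  let ?S = "insert 1 ((\<lambda>(x, y). dist x y) ` {(x, y) \<in> X \<times> X. x \<noteq> y})"
  have "finite {(x, y) \<in> X \<times> X. x \<noteq> y}" by (rule finite_subset[of _ "X \<times> X"]) (use assms in auto)
  then have fin: "finite ?S" by simp
  show ?thesis
  proof (rule that[of "Min ?S"])
    show "Min ?S > 0" using fin by (subst Min_gr_iff) auto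
    show "Min ?S \<le> dist x y" if "x \<in> X" "y \<in> X" "x \<noteq> y" for x y
      using fin that by (intro Min_le) (auto intro!: image_eqI[where x = "(x, y)"])
  qed
qed

text \<open>The closed \<open>r\<close>-neighbourhood of \<open>X\<close> in the angular metric.\<close>

definition arcs :: "complex set \<Rightarrow> real \<Rightarrow> complex set" where
  "arcs X r = (\<Union>x\<in>X. circle_arc x r)"

lemma arcs_Un: "arcs (X \<union> Y) r = arcs X r \<union> arcs Y r"
  by (auto simp: arcs_def)

lemma arcs_mono: "r \<le> s \<Longrightarrow> arcs X r \<subseteq> arcs X s"
  unfolding arcs_def using arc_mono by blast

lemma compact_arcs: "finite X \<Longrightarrow> compact (arcs X r)"
  unfolding arcs_def by (intro compact_UN compact_arc)

context no_invariant_measure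
begin

text \<open>B. H. Neumann's lemma, in terms of the action: for \<open>x\<close> of infinite orbit the elements with
  \<open>g x = y\<close> form a coset of a subgroup of infinite index, and finitely many such cosets do not cover
  the group. If they did, pick a coset of the stabilizer of \<open>x0\<close> that is not on the list; it is disjoint
  from the listed cosets of this stabilizer, hence covered by the others. Translates of that cover
  replace every listed coset of the stabilizer of \<open>x0\<close>, which leaves a cover that involves fewer
  stabilizers.\<close>

lemma avoid_finitely_many_cosets:
  assumes "finite X" "X \<subseteq> S1" "finite F" "fst ` F \<subseteq> X"
  shows "\<exists>g\<in>\<Gamma>. \<forall>(x, y)\<in>F. g x \<noteq> y"
  using assms
proof (induction X arbitrary: F rule: finite_induct)
  case empty
  then have "F = {}" by auto
  then show ?case using one_in by auto
next
  case (insert x0 X)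
  have x0: "x0 \<in> S1" using insert.prems by simp
  have "finite (snd ` {p \<in> F. fst p = x0})" using insert.prems by simp
  then have "\<not> (\<lambda>g. g x0) ` \<Gamma> \<subseteq> snd ` {p \<in> F. fst p = x0}"
    using infinite_orbit[OF x0] finite_subset by blast
  then obtain c where c: "c \<in> \<Gamma>" "c x0 \<notin> snd ` {p \<in> F. fst p = x0}" by blast
  then have c': "(x0, c x0) \<notin> F" by force
  \<comment> \<open>A representative of the coset of elements that take \<open>x0\<close> to \<open>y\<close>; arbitrary if there are none.\<close>
  define u where "u y = (SOME g. g \<in> \<Gamma> \<and> g x0 = y)" for y
  have u: "u y \<in> \<Gamma> \<and> u y x0 = y" if "g \<in> \<Gamma>" "g x0 = y" for g y
    unfolding u_def by (rule someI[of _ g]) (use that in blast)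
  define F1 where "F1 = {p \<in> F. fst p \<noteq> x0}"
  define t where "t q y' = u (snd q) (circle_inv c y')" for q :: "complex \<times> complex" and y'
  define F' where "F' = F1 \<union> (\<lambda>(p, q). (fst p, t q (snd p))) ` (F1 \<times> F)"
  have F1: "finite F1" "F1 \<subseteq> F" using insert.prems by (auto simp: F1_def)
  have "finite F'" using F1 insert.prems unfolding F'_def by blast
  moreover have "fst ` F1 \<subseteq> X" using insert.prems by (auto simp: F1_def)
  then have "fst ` F' \<subseteq> X" unfolding F'_def by (auto simp: image_iff)
  ultimately obtain g where g: "g \<in> \<Gamma>" "\<forall>(x, y)\<in>F'. g x \<noteq> y"
    using insert.IH[of F'] insert.prems by auto
  show ?case
  proof (rule ccontr)
    assume "\<not> ?case"
    then have cover: "\<exists>(x, y)\<in>F. h x = y" if "h \<in> \<Gamma>" for h using that by auto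
    obtain x y where xy: "(x, y) \<in> F" "g x = y" using cover[OF g(1)] by auto
    have "x = x0"
    proof (rule ccontr)
      assume "x \<noteq> x0"
      then have "(x, y) \<in> F'" using xy by (auto simp: F1_def F'_def)
      then show False using g(2) xy by auto
    qed
    then have uy: "u y \<in> \<Gamma>" "u y x0 = y" using u[OF g(1)] xy(2) by auto
    \<comment> \<open>Translating \<open>g\<close> into the coset of \<open>c\<close>, which is absent from the list.\<close>
    define h where "h = compose S1 c (compose S1 (circle_inv (u y)) g)"
    have h: "h \<in> \<Gamma>" using c uy g inv_in compose_in by (simp add: h_def)
    have h_apply: "h z = c (circle_inv (u y) (g z))" if "z \<in> S1" for z
      using that by (simp add: h_def compose_def)
    obtain x' y' where xy': "(x', y') \<in> F" "h x' = y'" using cover[OF h] by auto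
    have "circle_inv (u y) (g x0) = x0"
      using inv_apply[OF uy(1) x0] xy(2) unfolding uy(2) \<open>x = x0\<close> by (simp only:)
    then have "h x0 = c x0" using h_apply[OF x0] by (simp only:)
    then have "x' \<noteq> x0" using xy' c' by auto
    then have in_F1: "(x', y') \<in> F1" using xy' by (simp add: F1_def)
    have x': "x' \<in> S1" using xy'(1) insert.prems by force
    have gx': "g x' \<in> S1" "circle_inv (u y) (g x') \<in> S1"
      using maps[OF g(1) x'] maps[OF inv_in[OF uy(1)]] by auto
    have "circle_inv c y' = circle_inv (u y) (g x')"
      using inv_apply[OF c(1) gx'(2)] h_apply[OF x'] xy'(2) by simp
    then have "t (x, y) y' = g x'" using apply_inv[OF uy(1) gx'(1)] by (simp add: t_def)
    moreover have "(x', t (x, y) y') \<in> F'"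
      unfolding F'_def using in_F1 xy(1) by (intro UnI2 image_eqI[where x = "((x', y'), (x, y))"]) auto
    ultimately show False using g(2) by auto
  qed
qed

lemma separate_finite_sets:
  assumes "finite X" "finite Y" "X \<subseteq> S1"
  obtains g where "g \<in> \<Gamma>" "g ` X \<inter> Y = {}"
proof -
  have "\<exists>g\<in>\<Gamma>. \<forall>(x, y)\<in>X \<times> Y. g x \<noteq> y"
    using assms by (intro avoid_finitely_many_cosets[of X]) auto
  then show ?thesis using that by blast
qed

lemma collapses_image_right:
  assumes RA: "collapses R A" and h: "h \<in> \<Gamma>"
  shows "collapses R (h ` A)"
  unfolding collapses_def
proof (intro conjI allI impI)
  show "finite R" "finite (h ` A)" "R \<subseteq> S1" "h ` A \<subseteq> S1" "h ` A \<noteq> {}"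
    using RA maps[OF h] by (auto simp: collapses_def)
  fix e :: real assume e: "e > 0"
  have "uniformly_continuous_on S1 h"
    by (intro compact_uniformly_continuous Diff1_plus_continuous Diff h compact_sphere)
  then obtain d where d: "d > 0" "\<And>u v. u \<in> S1 \<Longrightarrow> v \<in> S1 \<Longrightarrow> dist v u < d \<Longrightarrow> dist (h v) (h u) < e"
    unfolding uniformly_continuous_on_def using e by blast
  have "min d e > 0" using d e by simp
  then obtain f where f: "f \<in> \<Gamma>"
    "\<forall>p\<in>S1. (\<forall>x\<in>R. min d e \<le> dist p x) \<longrightarrow> (\<exists>y\<in>A. dist (f p) y < min d e)"
    using RA unfolding collapses_def by blast
  show "\<exists>f\<in>\<Gamma>. \<forall>p\<in>S1. (\<forall>x\<in>R. e \<le> dist p x) \<longrightarrow> (\<exists>y\<in>h ` A. dist (f p) y < e)"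
  proof (intro bexI[of _ "compose S1 h f"] ballI impI)
    fix p assume p: "p \<in> S1" "\<forall>x\<in>R. e \<le> dist p x"
    then obtain y where y: "y \<in> A" "dist (f p) y < min d e" using f(2) by force
    then have "dist (h (f p)) (h y) < e" using RA maps[OF f(1) p(1)] by (intro d(2)) (auto simp: collapses_def)
    then show "\<exists>y\<in>h ` A. dist (compose S1 h f p) y < e" using y p by (auto simp: compose_def)
  qed (use compose_in h f in blast)
qed

lemma collapses_image_left:
  assumes RA: "collapses R A" and h: "h \<in> \<Gamma>"
  shows "collapses (h ` R) A"
  unfolding collapses_def
proof (intro conjI allI impI)
  show "finite (h ` R)" "finite A" "h ` R \<subseteq> S1" "A \<subseteq> S1" "A \<noteq> {}"
    using RA maps[OF h] by (auto simp: collapses_def)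
  fix e :: real assume e: "e > 0"
  have "uniformly_continuous_on S1 h"
    by (intro compact_uniformly_continuous Diff1_plus_continuous Diff h compact_sphere)
  then obtain d where d: "d > 0" "\<And>u v. u \<in> S1 \<Longrightarrow> v \<in> S1 \<Longrightarrow> dist v u < d \<Longrightarrow> dist (h v) (h u) < e"
    unfolding uniformly_continuous_on_def using e by blast
  have "min d e > 0" using d e by simp
  then obtain f where f: "f \<in> \<Gamma>"
    "\<forall>p\<in>S1. (\<forall>x\<in>R. min d e \<le> dist p x) \<longrightarrow> (\<exists>y\<in>A. dist (f p) y < min d e)"
    using RA unfolding collapses_def by blast
  show "\<exists>f\<in>\<Gamma>. \<forall>p\<in>S1. (\<forall>x\<in>h ` R. e \<le> dist p x) \<longrightarrow> (\<exists>y\<in>A. dist (f p) y < e)"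
  proof (intro bexI[of _ "compose S1 f (circle_inv h)"] ballI impI)
    fix p assume p: "p \<in> S1" "\<forall>x\<in>h ` R. e \<le> dist p x"
    let ?q = "circle_inv h p"
    have q: "?q \<in> S1" "h ?q = p" using maps[OF inv_in[OF h] p(1)] apply_inv[OF h p(1)] by auto
    have "min d e \<le> dist ?q x" if x: "x \<in> R" for x
    proof (rule ccontr)
      assume "\<not> ?thesis"
      moreover have "x \<in> S1" using x RA by (auto simp: collapses_def)
      ultimately have "dist (h ?q) (h x) < e" using q(1) by (intro d(2)) auto
      then show False using p(2) x q(2) by fastforce
    qed
    then obtain y where "y \<in> A" "dist (f ?q) y < min d e" using f(2) q(1) by blast
    then show "\<exists>y\<in>A. dist (compose S1 f (circle_inv h) p) y < e" using p(1) by (auto simp: compose_def)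
  qed (use compose_in h f inv_in in blast)
qed

lemma collapses_arcs:
  assumes RA: "collapses R A" and \<rho>: "\<rho> > 0"
  obtains f where "f \<in> \<Gamma>" "f ` (S1 - arcs R \<rho>) \<subseteq> arcs A \<rho>"
proof -
  obtain e where e: "e > 0" "\<And>x y. x \<in> S1 \<Longrightarrow> y \<in> S1 \<Longrightarrow> dist y x < e \<Longrightarrow> y \<in> circle_arc x \<rho>"
    using close_imp_in_arc[OF \<rho>] by metis
  have S: "R \<subseteq> S1" "A \<subseteq> S1" using RA by (auto simp: collapses_def)
  obtain f where f: "f \<in> \<Gamma>" "\<forall>p\<in>S1. (\<forall>x\<in>R. e \<le> dist p x) \<longrightarrow> (\<exists>y\<in>A. dist (f p) y < e)"
    using RA e(1) unfolding collapses_def by blast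
  have "f p \<in> arcs A \<rho>" if p: "p \<in> S1 - arcs R \<rho>" for p
  proof -
    have "e \<le> dist p x" if "x \<in> R" for x
    proof (rule ccontr)
      assume "\<not> ?thesis"
      then have "p \<in> circle_arc x \<rho>" using e(2)[of x p] S(1) that p by auto
      then show False using p that by (auto simp: arcs_def)
    qed
    then obtain y where y: "y \<in> A" "dist (f p) y < e" using f(2) p by blast
    then have "f p \<in> circle_arc y \<rho>" using e(2)[of y "f p"] S(2) maps[OF f(1), of p] p by auto
    then show ?thesis using y(1) by (auto simp: arcs_def)
  qed
  then show ?thesis using that f(1) by blast
qed

text \<open>First move the attracting set off the repelling one, then conjugate by an element that moves
  both off themselves. The doubled radius \<open>2 * \<rho>\<close> in the separation of the arcs leaves room for an arc of
  radius \<open>\<rho>\<close> around every point outside the larger arcs.\<close>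

lemma ping_pong:
  obtains a b A R A' R' \<rho> where
    "a \<in> \<Gamma>" "b \<in> \<Gamma>" "finite (A \<union> R \<union> A' \<union> R')" "A \<union> R \<union> A' \<union> R' \<subseteq> S1" "A \<noteq> {}" "A' \<noteq> {}" "0 < \<rho>" "\<rho> < pi"
    "a ` (S1 - arcs R \<rho>) \<subseteq> arcs A \<rho>" "b ` (S1 - arcs R' \<rho>) \<subseteq> arcs A' \<rho>"
    "A \<inter> A' = {}" "R \<inter> R' = {}" "(A \<union> A') \<inter> (R \<union> R') = {}"
    "\<And>x y. x \<in> A \<union> R \<union> A' \<union> R' \<Longrightarrow> y \<in> A \<union> R \<union> A' \<union> R' \<Longrightarrow> x \<noteq> y \<Longrightarrow>
       circle_arc x (2 * \<rho>) \<inter> circle_arc y (2 * \<rho>) = {}"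
proof -
  obtain R A0 where RA0: "collapses R A0" using collapses_exists by blast
  then obtain g where g: "g \<in> \<Gamma>" "g ` A0 \<inter> R = {}"
    using separate_finite_sets[of A0 R] by (auto simp: collapses_def)
  define A where "A = g ` A0"
  have RA: "collapses R A" unfolding A_def by (rule collapses_image_right[OF RA0 g(1)])
  then have fin: "finite A" "finite R" "A \<subseteq> S1" "R \<subseteq> S1" "A \<noteq> {}" by (auto simp: collapses_def)
  obtain h where h: "h \<in> \<Gamma>" "h ` (A \<union> R) \<inter> (A \<union> R) = {}"
    using separate_finite_sets[of "A \<union> R" "A \<union> R"] fin by auto
  define A' where "A' = h ` A"
  define R' where "R' = h ` R"
  have RA': "collapses R' A'" unfolding A'_def R'_def
    by (intro collapses_image_right collapses_image_left RA h)
  then have fin': "finite A'" "finite R'" "A' \<subseteq> S1" "R' \<subseteq> S1" "A' \<noteq> {}" by (auto simp: collapses_def)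
  let ?X = "A \<union> R \<union> A' \<union> R'"
  have X: "finite ?X" "?X \<subseteq> S1" using fin fin' by auto
  have "h ` A \<inter> h ` R = {}"
    using inj_on_image_Int[OF Diff1_plus_inj_on[OF Diff[OF h(1)]] fin(3,4)] g(2) by (simp add: A_def)
  then have "A' \<inter> R' = {}" by (simp add: A'_def R'_def)
  moreover have "(A' \<union> R') \<inter> (A \<union> R) = {}" using h(2) by (simp add: A'_def R'_def image_Un)
  moreover have "A \<inter> R = {}" using g(2) by (simp add: A_def)
  ultimately have disj: "A \<inter> A' = {}" "R \<inter> R' = {}" "(A \<union> A') \<inter> (R \<union> R') = {}" by blast+
  obtain \<eta> where \<eta>: "\<eta> > 0" "\<And>x y. x \<in> ?X \<Longrightarrow> y \<in> ?X \<Longrightarrow> x \<noteq> y \<Longrightarrow> \<eta> \<le> dist x y"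
    using finite_imp_separated[OF X(1)] by blast
  \<comment> \<open>Any factor below \<open>1 / 4\<close> would do: two arcs of radius \<open>2 * \<rho>\<close> that meet have centers at distance at most \<open>4 * \<rho>\<close>.\<close>
  define \<rho> where "\<rho> = min 1 (\<eta> / 5)"
  have \<rho>: "\<rho> > 0" "\<rho> < pi" "4 * \<rho> < \<eta>" using \<eta>(1) pi_gt3 by (auto simp: \<rho>_def min_def)
  have arcs_disj: "circle_arc x (2 * \<rho>) \<inter> circle_arc y (2 * \<rho>) = {}"
    if xy: "x \<in> ?X" "y \<in> ?X" "x \<noteq> y" for x y
  proof (rule ccontr)
    assume "\<not> ?thesis"
    then obtain z where z: "z \<in> circle_arc x (2 * \<rho>)" "z \<in> circle_arc y (2 * \<rho>)" by blast
    have "dist z x \<le> 2 * \<rho>" "dist z y \<le> 2 * \<rho>"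
      using dist_arc_center[OF z(1)] dist_arc_center[OF z(2)] xy X(2) by blast+
    then have "dist x y \<le> 4 * \<rho>" using dist_triangle3[of x y z] by linarith
    then show False using \<eta>(2)[OF xy] \<rho>(3) by linarith
  qed
  obtain a where a: "a \<in> \<Gamma>" "a ` (S1 - arcs R \<rho>) \<subseteq> arcs A \<rho>" using collapses_arcs[OF RA \<rho>(1)] by blast
  obtain b where b: "b \<in> \<Gamma>" "b ` (S1 - arcs R' \<rho>) \<subseteq> arcs A' \<rho>" using collapses_arcs[OF RA' \<rho>(1)] by blast
  show ?thesis
    by (rule that[OF a(1) b(1) X fin(5) fin'(5) \<rho>(1,2) a(2) b(2) disj arcs_disj])
qed

end

section \<open>Counting contracting words\<close>

lemma Diff1_plus_bounded_distortion:
  assumes f: "f \<in> Diff1_plus"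
  obtains C \<delta> where "C \<ge> 1" "\<delta> > 0"
    "\<And>u v. u \<in> S1 \<Longrightarrow> v \<in> S1 \<Longrightarrow> circle_deriv f u \<le> C * circle_deriv f v"
    "\<And>u v. u \<in> S1 \<Longrightarrow> v \<in> S1 \<Longrightarrow> dist u v < \<delta> \<Longrightarrow> circle_deriv f u \<le> 3 / 2 * circle_deriv f v"
proof -
  note cont = Diff1_plus_deriv_continuous[OF f]
  have ne: "S1 \<noteq> {}" by simp
  obtain a where a: "a \<in> S1" "\<And>u. u \<in> S1 \<Longrightarrow> circle_deriv f a \<le> circle_deriv f u"
    using continuous_attains_inf[OF compact_sphere ne cont] by blast
  obtain b where b: "b \<in> S1" "\<And>u. u \<in> S1 \<Longrightarrow> circle_deriv f u \<le> circle_deriv f b"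
    using continuous_attains_sup[OF compact_sphere ne cont] by blast
  have m: "circle_deriv f a > 0" by (rule Diff1_plus_deriv_pos[OF f a(1)])
  have "uniformly_continuous_on S1 (circle_deriv f)"
    by (rule compact_uniformly_continuous[OF cont compact_sphere])
  then obtain d where d: "d > 0"
    "\<And>u v. u \<in> S1 \<Longrightarrow> v \<in> S1 \<Longrightarrow> dist v u < d \<Longrightarrow> dist (circle_deriv f v) (circle_deriv f u) < circle_deriv f a / 2"
    unfolding uniformly_continuous_on_def using half_gt_zero[OF m] by blast
  show ?thesis
  proof (rule that[of "circle_deriv f b / circle_deriv f a" d])
    show "1 \<le> circle_deriv f b / circle_deriv f a" using a(2)[OF b(1)] m by simp
    fix u v :: complex assume uv: "u \<in> S1" "v \<in> S1"
    have "circle_deriv f u \<le> circle_deriv f b / circle_deriv f a * circle_deriv f a" using b(2)[OF uv(1)] m by simp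
    also have "\<dots> \<le> circle_deriv f b / circle_deriv f a * circle_deriv f v"
      using a(2)[OF uv(2)] a(2)[OF b(1)] m by (intro mult_left_mono) auto
    finally show "circle_deriv f u \<le> circle_deriv f b / circle_deriv f a * circle_deriv f v" .
    assume "dist u v < d"
    then have "circle_deriv f u < circle_deriv f v + circle_deriv f a / 2"
      using d(2)[OF uv(2,1)] unfolding dist_real_def by linarith
    then show "circle_deriv f u \<le> 3 / 2 * circle_deriv f v" using a(2)[OF uv(2)] by simp
  qed (rule d(1))
qed

text \<open>The last letter acts first, so the suffixes of a word are the partial products along its orbit.\<close>

primrec word_map :: "(bool \<Rightarrow> complex \<Rightarrow> complex) \<Rightarrow> bool list \<Rightarrow> complex \<Rightarrow> complex" where
  "word_map s [] = (\<lambda>x\<in>S1. x)"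
| "word_map s (c # cs) = compose S1 (s c) (word_map s cs)"

lemma finite_bool_lists: "finite {ws :: bool list. length ws = n \<and> Q ws}"
  by (rule finite_subset[OF _ finite_lists_length_eq[of "UNIV :: bool set" n]]) auto

lemma card_bool_lists: "card {ws :: bool list. length ws = n} = 2 ^ n"
  using card_lists_length_eq[of "UNIV :: bool set" n] by simp

context circle_diff_group
begin

lemma word_map_in: "(\<And>c. s c \<in> \<Gamma>) \<Longrightarrow> word_map s ws \<in> \<Gamma>"
  by (induction ws) (auto simp: one_in compose_in)

lemma word_map_Cons: "x \<in> S1 \<Longrightarrow> word_map s (c # ws) x = s c (word_map s ws x)"
  by (simp add: compose_def)

end

text \<open>Both letters map the complement \<open>K\<close> of the repellers into disjoint attractors inside \<open>K\<close>. Positive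
  words suffice; inverses form another instance.\<close>

locale ping_pong_semigroup = circle_diff_group +
  fixes s :: "bool \<Rightarrow> complex \<Rightarrow> complex" and K :: "complex set" and D :: "bool \<Rightarrow> complex set"
  assumes s: "s c \<in> \<Gamma>"
    and K: "K \<subseteq> S1" "compact (S1 - K)"
    and D: "s c ` K \<subseteq> D c" "D c \<subseteq> K" "D True \<inter> D False = {}"
begin

abbreviation w :: "bool list \<Rightarrow> complex \<Rightarrow> complex" where
  "w \<equiv> word_map s"

lemma w_in: "w ws \<in> \<Gamma>"
  by (rule word_map_in) (rule s)

lemma image_Cons: "w (c # ws) ` K = s c ` w ws ` K"
  using K(1) by (force simp: compose_def)

lemma image_subset: "w ws ` K \<subseteq> K"
proof (induction ws)
  case Nil then show ?case using K(1) by auto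
next
  case (Cons c ws)
  then show ?case unfolding image_Cons using D(1,2)[of c] by blast
qed

lemma image_Cons_subset: "w (c # ws) ` K \<subseteq> D c"
  unfolding image_Cons using image_subset[of ws] D(1)[of c] by blast

lemma image_disjoint:
  "length us = length vs \<Longrightarrow> us \<noteq> vs \<Longrightarrow> w us ` K \<inter> w vs ` K = {}"
proof (induction us arbitrary: vs)
  case (Cons c us)
  then obtain d vs' where vs: "vs = d # vs'" "length us = length vs'" by (cases vs) auto
  show ?case
  proof (cases "c = d")
    case False
    then have "D c \<inter> D d = {}" using D(3) by (cases c; cases d) auto
    then show ?thesis using image_Cons_subset[of c us] image_Cons_subset[of d vs'] vs(1) by blast
  next
    case True
    then have "w us ` K \<inter> w vs' ` K = {}" using Cons.IH[OF vs(2)] Cons.prems vs by auto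
    moreover have sub: "w us ` K \<subseteq> S1" "w vs' ` K \<subseteq> S1" using image_subset K(1) by blast+
    have "s d ` (w us ` K \<inter> w vs' ` K) = s d ` w us ` K \<inter> s d ` w vs' ` K"
      by (rule inj_on_image_Int[OF Diff1_plus_inj_on[OF Diff[OF s[of d]]] sub])
    ultimately have "s d ` w us ` K \<inter> s d ` w vs' ` K = {}" by simp
    then show ?thesis unfolding vs(1) True image_Cons .
  qed
qed simp

lemma image_borel: "w ws ` K \<in> sets borel"
proof -
  let ?f = "w ws"
  have "K = S1 - (S1 - K)" using K(1) by blast
  then have "?f ` K = ?f ` S1 - ?f ` (S1 - K)"
    using inj_on_image_set_diff[OF Diff1_plus_inj_on[OF Diff[OF w_in[of ws]]], of S1 "S1 - K"] by auto
  also have "?f ` S1 = S1" using Diff1_plus_bij_betw[OF Diff[OF w_in]] by (auto simp: bij_betw_def)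
  finally have "?f ` K = S1 - ?f ` (S1 - K)" .
  moreover have "compact (?f ` (S1 - K))"
    using continuous_on_subset[OF Diff1_plus_continuous[OF Diff[OF w_in]]] K(2)
    by (intro compact_continuous_image) auto
  ultimately show ?thesis by (metis borel_closed closed_sphere compact_imp_closed sets.Diff)
qed

definition image_length :: "bool list \<Rightarrow> real" where
  "image_length ws = circle_length (w ws ` K)"

text \<open>Distinct words of equal length have disjoint images of \<open>K\<close>, of total length at most \<open>2 * pi\<close>.\<close>

lemma card_large_words:
  "real (card {ws. length ws = n \<and> \<delta> \<le> image_length ws}) * \<delta> \<le> 2 * pi"
proof -
  let ?L = "{ws. length ws = n \<and> \<delta> \<le> image_length ws}"
  have "real (card ?L) * \<delta> \<le> (\<Sum>ws\<in>?L. circle_length (w ws ` K))"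
    by (intro sum_bounded_below[where 'a = real]) (simp add: image_length_def)
  also have "\<dots> \<le> 2 * pi"
    using image_disjoint
    by (intro sum_circle_length_le finite_bool_lists image_borel) (auto simp: disjoint_family_on_def)
  finally show ?thesis .
qed

text \<open>The words along which small distortion is not guaranteed: after more than \<open>k\<close> letters the image of
  \<open>K\<close> still has length at least \<open>\<delta>\<close>.\<close>

definition has_large_suffix :: "nat \<Rightarrow> real \<Rightarrow> bool list \<Rightarrow> bool" where
  "has_large_suffix k \<delta> ws \<longleftrightarrow> (\<exists>us cs. ws = us @ cs \<and> k < length cs \<and> \<delta> \<le> image_length cs)"

lemma has_large_suffix_Cons: "has_large_suffix k \<delta> (c # ws) \<longleftrightarrow> has_large_suffix k \<delta> ws \<or> k < Suc (length ws) \<and> \<delta> \<le> image_length (c # ws)"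
proof
  assume "has_large_suffix k \<delta> (c # ws)"
  then obtain us cs where "c # ws = us @ cs" "k < length cs" "\<delta> \<le> image_length cs"
    unfolding has_large_suffix_def by blast
  then show "has_large_suffix k \<delta> ws \<or> k < Suc (length ws) \<and> \<delta> \<le> image_length (c # ws)"
    unfolding has_large_suffix_def by (cases us) auto
next
  assume "has_large_suffix k \<delta> ws \<or> k < Suc (length ws) \<and> \<delta> \<le> image_length (c # ws)"
  then show "has_large_suffix k \<delta> (c # ws)"
  proof
    assume "has_large_suffix k \<delta> ws"
    then obtain us cs where "ws = us @ cs" "k < length cs" "\<delta> \<le> image_length cs"
      unfolding has_large_suffix_def by blast
    then show ?thesis unfolding has_large_suffix_def by (intro exI[of _ "c # us"] exI[of _ cs]) simp
  next
    assume "k < Suc (length ws) \<and> \<delta> \<le> image_length (c # ws)"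
    then show ?thesis unfolding has_large_suffix_def by (intro exI[of _ "[]"] exI[of _ "c # ws"]) simp
  qed
qed

text \<open>At each length beyond \<open>k\<close> at most \<open>2 * pi / \<delta>\<close> new words of this kind appear, while the old
  ones double with each letter. Adding \<open>2 * pi / \<delta>\<close> to the count makes the recursion geometric; for large \<open>k\<close>
  the proportion among the \<open>2 ^ (k + j)\<close> words is small, uniformly in \<open>j\<close>.\<close>

lemma card_has_large_suffix_le:
  assumes "\<delta> > 0"
  shows "real (card {ws. length ws = k + j \<and> has_large_suffix k \<delta> ws}) \<le> 2 * pi / \<delta> * 2 ^ j"
proof -
  define \<beta> where "\<beta> n = real (card {ws. length ws = n \<and> has_large_suffix k \<delta> ws})" for n
  have step: "\<beta> (Suc n) \<le> 2 * \<beta> n + 2 * pi / \<delta>" for n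
  proof -
    let ?B = "{ws. length ws = n \<and> has_large_suffix k \<delta> ws}" and ?L = "{ws. length ws = Suc n \<and> \<delta> \<le> image_length ws}"
    have "{ws. length ws = Suc n \<and> has_large_suffix k \<delta> ws} \<subseteq> (Cons True ` ?B \<union> Cons False ` ?B) \<union> ?L"
    proof
      fix ws assume ws: "ws \<in> {ws. length ws = Suc n \<and> has_large_suffix k \<delta> ws}"
      then obtain c cs where "ws = c # cs" "length cs = n" by (auto simp: length_Suc_conv)
      then show "ws \<in> (Cons True ` ?B \<union> Cons False ` ?B) \<union> ?L"
        using ws by (cases c) (auto simp: has_large_suffix_Cons)
    qed
    then have "card {ws. length ws = Suc n \<and> has_large_suffix k \<delta> ws} \<le> card ((Cons True ` ?B \<union> Cons False ` ?B) \<union> ?L)"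
      by (intro card_mono) (simp_all add: finite_bool_lists)
    also have "\<dots> \<le> (card ?B + card ?B) + card ?L"
      using card_Un_le[of "Cons True ` ?B \<union> Cons False ` ?B" ?L] card_Un_le[of "Cons True ` ?B" "Cons False ` ?B"]
      by (simp add: card_image)
    finally have "\<beta> (Suc n) \<le> 2 * \<beta> n + real (card ?L)" unfolding \<beta>_def by linarith
    moreover have "real (card ?L) \<le> 2 * pi / \<delta>" using card_large_words[of "Suc n" \<delta>] assms by (simp add: field_simps)
    ultimately show ?thesis by linarith
  qed
  have "\<beta> (k + j) + 2 * pi / \<delta> \<le> 2 * pi / \<delta> * 2 ^ j"
  proof (induction j)
    case 0
    have "{ws. length ws = k \<and> has_large_suffix k \<delta> ws} = {}" by (auto simp: has_large_suffix_def)
    then show ?case unfolding \<beta>_def by (simp only: add_0_right card.empty of_nat_0) simp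
  next
    case (Suc j)
    then show ?case using step[of "k + j"] by simp
  qed
  moreover have "2 * pi / \<delta> \<ge> 0" using assms by simp
  ultimately show ?thesis unfolding \<beta>_def by linarith
qed

text \<open>The first letters cost the crude factor \<open>C\<close>, here even times \<open>3 / 2\<close> for the sake of a simple
  formula. Once more than \<open>k\<close> letters have acted, the image
  of the arc is shorter than \<open>\<delta>\<close> and every further letter costs only \<open>3 / 2\<close>.\<close>

lemma word_deriv_distortion:
  assumes C: "C \<ge> 1" "\<And>c u v. u \<in> S1 \<Longrightarrow> v \<in> S1 \<Longrightarrow> circle_deriv (s c) u \<le> C * circle_deriv (s c) v"
    and \<delta>: "\<And>c u v. u \<in> S1 \<Longrightarrow> v \<in> S1 \<Longrightarrow> dist u v < \<delta> \<Longrightarrow> circle_deriv (s c) u \<le> 3 / 2 * circle_deriv (s c) v"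
    and I: "x \<in> S1" "0 < r" "r < pi" "circle_arc x r \<subseteq> K" "p \<in> circle_arc x r" "q \<in> circle_arc x r"
  shows "\<not> has_large_suffix k \<delta> ws \<Longrightarrow>
    circle_deriv (w ws) p \<le> C ^ min (length ws) (Suc k) * (3 / 2) ^ length ws * circle_deriv (w ws) q"
proof (induction ws)
  case Nil
  have "p \<in> S1" "q \<in> S1" using I K(1) by auto
  moreover have "circle_deriv (w []) z = 1" if "z \<in> S1" for z
    unfolding word_map.simps by (rule circle_deriv_id[OF that])
  ultimately have "circle_deriv (w []) p = 1" "circle_deriv (w []) q = 1" by blast+
  then show ?case by (simp only: list.size) simp
next
  case (Cons c ws)
  have pq: "p \<in> S1" "q \<in> S1" using I K(1) by auto
  let ?u = "w ws p" and ?v = "w ws q"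
  have uv: "?u \<in> S1" "?v \<in> S1" using maps[OF w_in] pq by auto
  have chain: "circle_deriv (w (c # ws)) z = circle_deriv (s c) (w ws z) * circle_deriv (w ws) z" if "z \<in> S1" for z
    using circle_deriv_compose[OF Diff[OF w_in] Diff[OF s] that] by simp
  have pos: "circle_deriv (w ws) p > 0" "circle_deriv (w ws) q > 0" "circle_deriv (s c) ?v > 0"
    using Diff1_plus_deriv_pos[OF Diff[OF w_in]] Diff1_plus_deriv_pos[OF Diff[OF s]] pq uv by auto
  let ?M = "if length ws \<le> k then C else 1"
  have *: "circle_deriv (s c) ?u \<le> ?M * (3 / 2) * circle_deriv (s c) ?v"
  proof (cases "length ws \<le> k")
    case True
    have "circle_deriv (s c) ?u \<le> C * circle_deriv (s c) ?v" by (rule C(2)[OF uv])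
    also have "\<dots> \<le> C * (3 / 2) * circle_deriv (s c) ?v" using C(1) pos by simp
    finally show ?thesis using True by simp
  next
    case False
    have "\<not> \<delta> \<le> image_length ws" using Cons.prems False unfolding has_large_suffix_def
      by (metis append_Cons append_Nil not_le)
    have "dist ?u ?v \<le> circle_length (w ws ` circle_arc x r)"
      by (rule Diff1_plus_image_arc(2)[OF Diff[OF w_in] I(1-3) I(5,6)])
    also have "\<dots> \<le> image_length ws"
      unfolding image_length_def
    proof (rule circle_length_mono)
      show "w ws ` circle_arc x r \<in> sets borel"
        using continuous_on_subset[OF Diff1_plus_continuous[OF Diff[OF w_in]]] I(4) K(1) compact_arc
        by (intro borel_closed compact_imp_closed compact_continuous_image) auto
    qed (use I(4) image_borel in auto)
    finally have "dist ?u ?v < \<delta>" using \<open>\<not> \<delta> \<le> image_length ws\<close> by simp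
    then show ?thesis using \<delta>[OF uv] False by simp
  qed
  have "circle_deriv (w (c # ws)) p \<le> (?M * (3 / 2) * circle_deriv (s c) ?v) *
      (C ^ min (length ws) (Suc k) * (3 / 2) ^ length ws * circle_deriv (w ws) q)"
    unfolding chain[OF pq(1)]
  proof (rule mult_mono[OF *])
    show "circle_deriv (w ws) p \<le> C ^ min (length ws) (Suc k) * (3 / 2) ^ length ws * circle_deriv (w ws) q"
      using Cons.IH Cons.prems by (simp add: has_large_suffix_Cons)
  qed (use C(1) pos in auto)
  also have "\<dots> = ?M * C ^ min (length ws) (Suc k) * (3 / 2) ^ length (c # ws) * circle_deriv (w (c # ws)) q"
    by (simp add: chain[OF pq(2)] del: word_map.simps)
  also have "?M * C ^ min (length ws) (Suc k) = C ^ min (length (c # ws)) (Suc k)"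
  proof (cases "length ws \<le> k")
    case True
    then have "min (length ws) (Suc k) = length ws" "min (length (c # ws)) (Suc k) = Suc (length ws)" by auto
    then show ?thesis using True by simp
  next
    case False
    then have "min (length ws) (Suc k) = Suc k" "min (length (c # ws)) (Suc k) = Suc k" by auto
    then show ?thesis using False by simp
  qed
  finally show ?case .
qed

text \<open>At most an eighth of the words has a large suffix and at most a sixteenth has an image of
  length \<open>32 * pi / 2 ^ n\<close> or more. For the others some point of the arc around \<open>p\<close> has derivative
  below \<open>16 * pi / (r * 2 ^ n)\<close>, and distortion changes this by at most \<open>C ^ Suc k * (3 / 2) ^ n\<close>. The
  product tends to zero because \<open>3 / 2 < 2\<close>.\<close>

lemma most_words_contract:
  assumes Ks: "Ks \<subseteq> S1" and r: "0 < r" "r < pi" "\<And>p. p \<in> Ks \<Longrightarrow> circle_arc p r \<subseteq> K"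
  shows "\<exists>n0. \<forall>n\<ge>n0. 4 * card {ws. length ws = n \<and> \<not> (\<forall>p\<in>Ks. circle_deriv (w ws) p < 1)} \<le> 2 ^ n"
proof -
  obtain C1 \<delta>1 where 1: "C1 \<ge> 1" "\<delta>1 > 0"
    "\<And>u v. u \<in> S1 \<Longrightarrow> v \<in> S1 \<Longrightarrow> circle_deriv (s True) u \<le> C1 * circle_deriv (s True) v"
    "\<And>u v. u \<in> S1 \<Longrightarrow> v \<in> S1 \<Longrightarrow> dist u v < \<delta>1 \<Longrightarrow> circle_deriv (s True) u \<le> 3 / 2 * circle_deriv (s True) v"
    using Diff1_plus_bounded_distortion[OF Diff[OF s[of True]]] by metis
  obtain C2 \<delta>2 where 2: "C2 \<ge> 1" "\<delta>2 > 0"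
    "\<And>u v. u \<in> S1 \<Longrightarrow> v \<in> S1 \<Longrightarrow> circle_deriv (s False) u \<le> C2 * circle_deriv (s False) v"
    "\<And>u v. u \<in> S1 \<Longrightarrow> v \<in> S1 \<Longrightarrow> dist u v < \<delta>2 \<Longrightarrow> circle_deriv (s False) u \<le> 3 / 2 * circle_deriv (s False) v"
    using Diff1_plus_bounded_distortion[OF Diff[OF s[of False]]] by metis
  define C where "C = max C1 C2"
  define \<delta> where "\<delta> = min \<delta>1 \<delta>2"
  have pos: "circle_deriv (s c) v > 0" if "v \<in> S1" for c v by (rule Diff1_plus_deriv_pos[OF Diff[OF s] that])
  have C: "C \<ge> 1" using 1(1) by (simp add: C_def)
  have C': "circle_deriv (s c) u \<le> C * circle_deriv (s c) v" if uv: "u \<in> S1" "v \<in> S1" for c u v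
  proof (cases c)
    case True
    have "C1 * circle_deriv (s c) v \<le> C * circle_deriv (s c) v"
      using pos[OF uv(2), of c] by (intro mult_right_mono) (auto simp: C_def)
    then show ?thesis using 1(3)[OF uv] True by simp
  next
    case False
    have "C2 * circle_deriv (s c) v \<le> C * circle_deriv (s c) v"
      using pos[OF uv(2), of c] by (intro mult_right_mono) (auto simp: C_def)
    then show ?thesis using 2(3)[OF uv] False by simp
  qed
  have \<delta>: "\<delta> > 0" using 1(2) 2(2) by (simp add: \<delta>_def)
  have \<delta>': "circle_deriv (s c) u \<le> 3 / 2 * circle_deriv (s c) v"
    if "u \<in> S1" "v \<in> S1" "dist u v < \<delta>" for c u v
    using 1(4)[OF that(1,2)] 2(4)[OF that(1,2)] that(3) by (cases c) (auto simp: \<delta>_def)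
  \<comment> \<open>Words with a large suffix then make up less than an eighth.\<close>
  obtain k :: nat where k: "8 * (2 * pi / \<delta>) < 2 ^ k" using real_arch_pow[of 2] by auto
  have "(\<lambda>n. C ^ Suc k * (16 * pi / r) * (3 / 4) ^ n) \<longlonglongrightarrow> C ^ Suc k * (16 * pi / r) * 0"
    by (intro tendsto_intros LIMSEQ_realpow_zero) auto
  then have "eventually (\<lambda>n. C ^ Suc k * (16 * pi / r) * (3 / 4) ^ n < 1) sequentially"
    by (intro order_tendstoD) auto
  then obtain n1 where n1: "\<And>n. n \<ge> n1 \<Longrightarrow> C ^ Suc k * (16 * pi / r) * (3 / 4) ^ n < 1"
    by (auto simp: eventually_sequentially)
  show ?thesis
  proof (intro exI[of _ "max n1 k"] allI impI)
    fix n assume n: "max n1 k \<le> n"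
    let ?B = "{ws. length ws = n \<and> has_large_suffix k \<delta> ws}"
    let ?L = "{ws. length ws = n \<and> 32 * pi / 2 ^ n \<le> image_length ws}"
    have "circle_deriv (w ws) p < 1"
      if ws: "length ws = n" "\<not> has_large_suffix k \<delta> ws" "\<not> 32 * pi / 2 ^ n \<le> image_length ws" and p: "p \<in> Ks" for ws p
    proof -
      have pS: "p \<in> S1" using p Ks by blast
      obtain q where q: "q \<in> circle_arc p r" "2 * r * circle_deriv (w ws) q \<le> circle_length (w ws ` circle_arc p r)"
        using Diff1_plus_image_arc(1)[OF Diff[OF w_in] pS r(1,2)] by blast
      have "circle_length (w ws ` circle_arc p r) \<le> image_length ws"
        unfolding image_length_def
      proof (rule circle_length_mono)
        show "w ws ` circle_arc p r \<in> sets borel"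
          using continuous_on_subset[OF Diff1_plus_continuous[OF Diff[OF w_in]]] arc_subset_S1[OF pS] compact_arc
          by (intro borel_closed compact_imp_closed compact_continuous_image) auto
      qed (use r(3)[OF p] image_borel in auto)
      then have "2 * r * circle_deriv (w ws) q < 32 * pi / 2 ^ n" using q(2) ws(3) by linarith
      then have dq: "circle_deriv (w ws) q < 16 * pi / r * (1 / 2 ^ n)" using r(1) by (simp add: field_simps)
      have "circle_deriv (w ws) p \<le> C ^ min (length ws) (Suc k) * (3 / 2) ^ length ws * circle_deriv (w ws) q"
        using C C' \<delta>' pS r(1,2) r(3)[OF p] center_in_arc[of r p] r(1) q(1) ws(2)
        by (intro word_deriv_distortion[where \<delta> = \<delta> and x = p and r = r]) auto
      also have "\<dots> \<le> C ^ Suc k * (3 / 2) ^ length ws * circle_deriv (w ws) q"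
      proof -
        have "q \<in> S1" using q(1) arc_subset_S1[OF pS] by blast
        then have "circle_deriv (w ws) q > 0" by (rule Diff1_plus_deriv_pos[OF Diff[OF w_in]])
        moreover have "C ^ min (length ws) (Suc k) \<le> C ^ Suc k" using C by (intro power_increasing) auto
        ultimately show ?thesis by (intro mult_right_mono) auto
      qed
      also have "\<dots> \<le> C ^ Suc k * (3 / 2) ^ length ws * (16 * pi / r * (1 / 2 ^ n))"
        using dq C by (intro mult_left_mono) auto
      also have "\<dots> = C ^ Suc k * (16 * pi / r) * (3 / 4) ^ n"
      proof -
        have "(3 / 4 :: real) ^ n = (3 / 2) ^ n * (1 / 2 ^ n)"
          by (simp add: power_divide power_mult_distrib[symmetric])
        then show ?thesis using ws(1) by simp
      qed
      also have "\<dots> < 1" using n1 n by simp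
      finally show ?thesis .
    qed
    then have "{ws. length ws = n \<and> \<not> (\<forall>p\<in>Ks. circle_deriv (w ws) p < 1)} \<subseteq> ?B \<union> ?L" by blast
    then have "card {ws. length ws = n \<and> \<not> (\<forall>p\<in>Ks. circle_deriv (w ws) p < 1)} \<le> card (?B \<union> ?L)"
      by (intro card_mono) (simp_all add: finite_bool_lists)
    also have "\<dots> \<le> card ?B + card ?L" by (rule card_Un_le)
    finally have "real (card {ws. length ws = n \<and> \<not> (\<forall>p\<in>Ks. circle_deriv (w ws) p < 1)}) \<le> real (card ?B) + real (card ?L)"
      by linarith
    moreover have "8 * real (card ?B) \<le> 2 ^ n"
    proof -
      obtain j where j: "n = k + j" using n le_Suc_ex by auto
      have "8 * real (card ?B) \<le> 8 * (2 * pi / \<delta> * 2 ^ j)" using card_has_large_suffix_le[OF \<delta>, of k j] j by simp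
      also have "\<dots> = 8 * (2 * pi / \<delta>) * 2 ^ j" by (simp only: mult.assoc)
      also have "\<dots> \<le> 2 ^ k * 2 ^ j" by (rule mult_right_mono) (use k in auto)
      finally show ?thesis by (simp add: j power_add)
    qed
    moreover have "16 * real (card ?L) \<le> 2 ^ n"
      using card_large_words[of n "32 * pi / 2 ^ n"] by (simp add: field_simps)
    ultimately have "4 * real (card {ws. length ws = n \<and> \<not> (\<forall>p\<in>Ks. circle_deriv (w ws) p < 1)}) \<le> 2 ^ n" by linarith
    then have "real (4 * card {ws. length ws = n \<and> \<not> (\<forall>p\<in>Ks. circle_deriv (w ws) p < 1)}) \<le> real (2 ^ n)" by simp
    then show "4 * card {ws. length ws = n \<and> \<not> (\<forall>p\<in>Ks. circle_deriv (w ws) p < 1)} \<le> 2 ^ n"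
      by (simp only: of_nat_le_iff)
  qed
qed

end

section \<open>The hyperbolic element\<close>

lemma connected_subset_one_of_disjoint_closed:
  assumes Z: "connected Z" "Z \<noteq> {}" "Z \<subseteq> (\<Union>x\<in>X. S x)"
    and X: "finite X" "\<And>x. x \<in> X \<Longrightarrow> closed (S x)"
      "\<And>x y. x \<in> X \<Longrightarrow> y \<in> X \<Longrightarrow> x \<noteq> y \<Longrightarrow> S x \<inter> S y = {}"
  shows "\<exists>x\<in>X. Z \<subseteq> S x"
proof -
  obtain z x where z: "z \<in> Z" "x \<in> X" "z \<in> S x" using Z by blast
  let ?U = "\<Union>y\<in>X - {x}. S y"
  have "S x \<inter> Z = {} \<or> ?U \<inter> Z = {}"
  proof (rule connected_closedD[OF Z(1)])
    show "S x \<inter> ?U \<inter> Z = {}" using X(3) z(2) by blast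
    show "Z \<subseteq> S x \<union> ?U" using Z(3) by blast
    show "closed (S x)" by (rule X(2)[OF z(2)])
    show "closed ?U" using X(1,2) by (intro closed_UN) auto
  qed
  then have "Z \<subseteq> S x" using z Z(3) by blast
  then show ?thesis using z(2) by blast
qed

lemma finite_self_map_periodic:
  assumes "finite X" "X \<noteq> {}" "\<And>x. x \<in> X \<Longrightarrow> f x \<in> X"
  obtains x k where "x \<in> X" "k > 0" "(f ^^ k) x = x"
proof -
  obtain x0 where x0: "x0 \<in> X" using assms(2) by blast
  have in_X: "(f ^^ n) x0 \<in> X" for n by (induction n) (use x0 assms(3) in auto)
  have "finite (range (\<lambda>n. (f ^^ n) x0))" by (rule finite_subset[OF _ assms(1)]) (use in_X in auto)
  then have "\<not> inj (\<lambda>n. (f ^^ n) x0)" using finite_imageD infinite_UNIV_nat by blast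
  then obtain i j where ij: "i < j" "(f ^^ i) x0 = (f ^^ j) x0"
    by (metis (no_types, lifting) injI nat_neq_iff)
  have "(f ^^ (j - i)) ((f ^^ i) x0) = (f ^^ (j - i + i)) x0" by (simp only: funpow_add o_apply)
  also have "\<dots> = (f ^^ i) x0" using ij by simp
  finally have "(f ^^ (j - i)) ((f ^^ i) x0) = (f ^^ i) x0" .
  then show ?thesis using that[of "(f ^^ i) x0" "j - i"] in_X ij by simp
qed

text \<open>An arc shorter than the circle is homeomorphic to a compact interval.\<close>

lemma circle_arc_fixpoint:
  assumes x: "x \<in> S1" and r: "0 \<le> r" "r < pi"
    and h: "continuous_on (circle_arc x r) h" "h ` circle_arc x r \<subseteq> circle_arc x r"
  shows "\<exists>y\<in>circle_arc x r. h y = y"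
proof -
  obtain \<theta> where \<theta>: "x = cis \<theta>" using S1_eq_cis[OF x] by blast
  have "inj_on cis {\<theta> - r..\<theta> + r}"
    using r by (intro inj_onI cis_eq_imp_eq) auto
  then have "{\<theta> - r..\<theta> + r} homeomorphic circle_arc x r"
    unfolding \<theta> arc_cis
    by (intro homeomorphic_compact[where f = cis] continuous_intros) auto
  moreover have "\<exists>u\<in>{\<theta> - r..\<theta> + r}. g u = u"
    if "continuous_on {\<theta> - r..\<theta> + r} g \<and> g \<in> {\<theta> - r..\<theta> + r} \<rightarrow> {\<theta> - r..\<theta> + r}" for g :: "real \<Rightarrow> real"
    using that r by (metis brouwer[of "{\<theta> - r..\<theta> + r}" g] compact_Icc convex_real_interval(5) atLeastAtMost_iff
        diff_le_eq empty_iff le_add_same_cancel1 le_add_same_cancel2 order_refl)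
  ultimately have "\<forall>g. continuous_on (circle_arc x r) g \<and> g \<in> circle_arc x r \<rightarrow> circle_arc x r \<longrightarrow>
      (\<exists>y\<in>circle_arc x r. g y = y)"
    using homeomorphic_fixpoint_property[of "{\<theta> - r..\<theta> + r}" "circle_arc x r"] by blast
  then show ?thesis using h by blast
qed

primrec circle_power :: "(complex \<Rightarrow> complex) \<Rightarrow> nat \<Rightarrow> complex \<Rightarrow> complex" where
  "circle_power f 0 = (\<lambda>x\<in>S1. x)"
| "circle_power f (Suc k) = compose S1 f (circle_power f k)"

context circle_diff_group
begin

lemma circle_power_in: "g \<in> \<Gamma> \<Longrightarrow> circle_power g k \<in> \<Gamma>"
  by (induction k) (auto simp: one_in compose_in)

lemma circle_power_apply: "x \<in> S1 \<Longrightarrow> circle_power g k x = (g ^^ k) x"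
  by (induction k) (auto simp: compose_def)

lemma circle_power_deriv_less_1:
  assumes g: "g \<in> \<Gamma>" and K: "K \<subseteq> S1" "g ` K \<subseteq> K" "\<And>p. p \<in> K \<Longrightarrow> circle_deriv g p < 1"
    and p: "p \<in> K"
  shows "circle_deriv (circle_power g (Suc k)) p < 1"
proof (induction k)
  have *: "circle_deriv (circle_power g (Suc k)) p = circle_deriv g (circle_power g k p) * circle_deriv (circle_power g k) p" for k
    using circle_deriv_compose[OF Diff[OF circle_power_in[OF g]] Diff[OF g]] p K(1) by auto
  have in_K: "circle_power g k p \<in> K" for k
  proof (induction k)
    case (Suc k) then show ?case using p K(1,2) by (auto simp: compose_def)
  qed (use p K(1) in auto)
  {
    case 0
    have "circle_deriv (circle_power g 0) p = 1" unfolding circle_power.simps using p K(1) by (intro circle_deriv_id) auto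
    then show ?case using *[of 0] K(3)[OF in_K[of 0]] by (simp del: circle_power.simps)
  next
    case (Suc k)
    have "circle_deriv g (circle_power g (Suc k) p) < 1" by (rule K(3)[OF in_K])
    moreover have "circle_deriv (circle_power g (Suc k)) p > 0"
      using Diff1_plus_deriv_pos[OF Diff[OF circle_power_in[OF g]]] p K(1) by blast
    ultimately show ?case using Suc *[of "Suc k"] by (smt (verit) mult_less_cancel_right1)
  }
qed

lemma word_map_append: "x \<in> S1 \<Longrightarrow> (\<And>c. s c \<in> \<Gamma>) \<Longrightarrow> word_map s (us @ vs) x = word_map s us (word_map s vs x)"
proof (induction us)
  case Nil
  then show ?case using maps[OF word_map_in[of s vs]] by simp
next
  case (Cons c us)
  have "word_map s vs x \<in> S1" using maps[OF word_map_in] Cons.prems by blast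
  then show ?case using Cons by (simp add: compose_def)
qed

lemma word_map_rev_inverse:
  assumes s: "\<And>c. s c \<in> \<Gamma>" and x: "x \<in> S1"
  shows "word_map (\<lambda>c. circle_inv (s c)) (rev ws) (word_map s ws x) = x"
proof (induction ws)
  case Nil then show ?case using x by simp
next
  case (Cons c ws)
  let ?t = "\<lambda>c. circle_inv (s c)"
  have t: "?t c \<in> \<Gamma>" for c using inv_in s by blast
  have y: "word_map s ws x \<in> S1" using maps[OF word_map_in[OF s] x] .
  have sy: "s c (word_map s ws x) \<in> S1" using maps[OF s y] .
  have "word_map ?t (rev (c # ws)) (word_map s (c # ws) x) = word_map ?t (rev ws @ [c]) (s c (word_map s ws x))"
    using word_map_Cons[OF x] by simp
  also have "\<dots> = word_map ?t (rev ws) (word_map ?t [c] (s c (word_map s ws x)))"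
    by (rule word_map_append[OF sy t])
  also have "word_map ?t [c] (s c (word_map s ws x)) = circle_inv (s c) (s c (word_map s ws x))"
    using word_map_Cons[OF sy, of ?t c "[]"] sy by simp
  also have "\<dots> = word_map s ws x" by (rule inv_apply[OF s y])
  finally show ?case using Cons by simp
qed

end

text \<open>Letters are indexed by \<open>bool\<close>, with attractors \<open>A c\<close> and repellers \<open>R c\<close>, so that exchanging \<open>A\<close>
  and \<open>R\<close> covers the inverse letters. Points outside the arcs of radius \<open>2 * \<rho>\<close> have an arc of radius \<open>\<rho>\<close>
  inside \<open>K\<close>.\<close>

lemma (in circle_diff_group) ping_pong_words_contract:
  fixes A R :: "bool \<Rightarrow> complex set"
  assumes s: "\<And>c. s c \<in> \<Gamma>" and fin: "\<And>c. finite (A c)" "\<And>c. finite (R c)"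
    and S: "\<And>c. A c \<subseteq> S1" "\<And>c. R c \<subseteq> S1" and \<rho>: "0 < \<rho>" "\<rho> < pi"
    and pp: "\<And>c. s c ` (S1 - arcs (R c) \<rho>) \<subseteq> arcs (A c) \<rho>"
    and disj: "arcs (A True) \<rho> \<inter> arcs (A False) \<rho> = {}" "\<And>c d. arcs (A c) \<rho> \<inter> arcs (R d) \<rho> = {}"
  shows "\<exists>n0. \<forall>n\<ge>n0. 4 * card {ws. length ws = n \<and>
      \<not> (\<forall>p\<in>S1 - arcs (R True \<union> R False) (2 * \<rho>). circle_deriv (word_map s ws) p < 1)} \<le> 2 ^ n"
    and "word_map s (c # ws) ` (S1 - arcs (R True \<union> R False) \<rho>) \<subseteq> arcs (A c) \<rho>"
proof -
  define K where "K = S1 - arcs (R True \<union> R False) \<rho>"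
  have arcs_S: "arcs X r \<subseteq> S1" if "X \<subseteq> S1" for X r using arc_subset_S1 that by (fastforce simp: arcs_def)
  interpret P: ping_pong_semigroup \<Gamma> s K "\<lambda>c. arcs (A c) \<rho>"
  proof
    show "s c \<in> \<Gamma>" for c by (rule s)
    show "K \<subseteq> S1" by (auto simp: K_def)
    have "S1 - K = arcs (R True \<union> R False) \<rho>" using arcs_S[of "R True \<union> R False"] S unfolding K_def by blast
    then show "compact (S1 - K)" using fin by (simp add: compact_arcs)
    have "K \<subseteq> S1 - arcs (R c) \<rho>" for c by (cases c) (auto simp: K_def arcs_Un)
    then show "s c ` K \<subseteq> arcs (A c) \<rho>" for c using pp[of c] by blast
    show "arcs (A c) \<rho> \<subseteq> K" for c
      using arcs_S[OF S(1)] disj(2)[of c True] disj(2)[of c False] by (auto simp: K_def arcs_Un)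
    show "arcs (A True) \<rho> \<inter> arcs (A False) \<rho> = {}" by (rule disj(1))
  qed
  show "word_map s (c # ws) ` (S1 - arcs (R True \<union> R False) \<rho>) \<subseteq> arcs (A c) \<rho>"
    using P.image_Cons_subset unfolding K_def .
  have "circle_arc p \<rho> \<subseteq> K" if p: "p \<in> S1 - arcs (R True \<union> R False) (2 * \<rho>)" for p
  proof
    fix z assume z: "z \<in> circle_arc p \<rho>"
    have "z \<notin> arcs (R True \<union> R False) \<rho>"
    proof
      assume "z \<in> arcs (R True \<union> R False) \<rho>"
      then obtain x where x: "x \<in> R True \<union> R False" "z \<in> circle_arc x \<rho>" by (auto simp: arcs_def)
      have "p \<in> circle_arc x (2 * \<rho>)" using arc_overlap[OF x(2) z] by simp
      then show False using p x(1) by (auto simp: arcs_def)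
    qed
    moreover have "z \<in> S1" using z p arc_subset_S1 by blast
    ultimately show "z \<in> K" by (simp add: K_def)
  qed
  then show "\<exists>n0. \<forall>n\<ge>n0. 4 * card {ws. length ws = n \<and>
      \<not> (\<forall>p\<in>S1 - arcs (R True \<union> R False) (2 * \<rho>). circle_deriv (word_map s ws) p < 1)} \<le> 2 ^ n"
    using \<rho> by (intro P.most_words_contract) auto
qed

text \<open>Fewer than all words fail to contract in one of the two directions, so some word \<open>w\<close> contracts on
  \<open>Ks\<close>, away from the repellers, and its inverse \<open>v\<close> on \<open>Kt\<close>, away from the attractors. The set
  \<open>Ks\<close> is invariant under \<open>w\<close> and \<open>Kt\<close> under \<open>v\<close>, and together they cover the circle; so a fixed point of a power of \<open>w\<close> is attracting if
  it lies near the attractors and repelling otherwise. A power is needed because \<open>w\<close> may permute the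
  attracting arcs.\<close>

lemma (in no_invariant_measure) hyperbolic_element_exists:
  "\<exists>g\<in>\<Gamma>. (\<exists>x\<in>S1. g x = x) \<and> (\<forall>x\<in>S1. g x = x \<longrightarrow> hyperbolic_fixed_point g x)"
proof (rule ping_pong)
  fix a b A1 R1 A2 R2 \<rho>
  assume ab: "a \<in> \<Gamma>" "b \<in> \<Gamma>"
    and X: "finite (A1 \<union> R1 \<union> A2 \<union> R2)" "A1 \<union> R1 \<union> A2 \<union> R2 \<subseteq> S1"
    and ne: "A1 \<noteq> {}" "A2 \<noteq> {}" and \<rho>: "0 < \<rho>" "\<rho> < pi"
    and pp: "a ` (S1 - arcs R1 \<rho>) \<subseteq> arcs A1 \<rho>" "b ` (S1 - arcs R2 \<rho>) \<subseteq> arcs A2 \<rho>"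
    and disj: "A1 \<inter> A2 = {}" "R1 \<inter> R2 = {}" "(A1 \<union> A2) \<inter> (R1 \<union> R2) = {}"
    and sep: "\<And>x y. x \<in> A1 \<union> R1 \<union> A2 \<union> R2 \<Longrightarrow> y \<in> A1 \<union> R1 \<union> A2 \<union> R2 \<Longrightarrow> x \<noteq> y \<Longrightarrow>
       circle_arc x (2 * \<rho>) \<inter> circle_arc y (2 * \<rho>) = {}"
  define s where "s c = (if c then a else b)" for c
  define A where "A c = (if c then A1 else A2)" for c
  define R where "R c = (if c then R1 else R2)" for c
  define t where "t c = circle_inv (s c)" for c
  let ?X = "A1 \<union> R1 \<union> A2 \<union> R2"
  have s: "s c \<in> \<Gamma>" and t: "t c \<in> \<Gamma>" for c using ab inv_in by (auto simp: s_def t_def)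
  have AR: "A c \<subseteq> ?X" "R c \<subseteq> ?X" for c by (auto simp: A_def R_def)
  have fin: "finite (A c)" "finite (R c)" for c
    by (rule finite_subset[OF AR(1) X(1)], rule finite_subset[OF AR(2) X(1)])
  have S: "A c \<subseteq> S1" "R c \<subseteq> S1" for c
    by (rule order_trans[OF AR(1) X(2)], rule order_trans[OF AR(2) X(2)])
  have arcs_disj: "arcs U (2 * \<rho>) \<inter> arcs V (2 * \<rho>) = {}" if "U \<subseteq> ?X" "V \<subseteq> ?X" "U \<inter> V = {}" for U V
  proof -
    have "circle_arc x (2 * \<rho>) \<inter> circle_arc y (2 * \<rho>) = {}" if "x \<in> U" "y \<in> V" for x y
      using sep[of x y] that \<open>U \<subseteq> ?X\<close> \<open>V \<subseteq> ?X\<close> \<open>U \<inter> V = {}\<close> by blast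
    then show ?thesis unfolding arcs_def by blast
  qed
  have small: "arcs U \<rho> \<subseteq> arcs U (2 * \<rho>)" for U using \<rho>(1) by (intro arcs_mono) simp
  have disj_A: "arcs (A True) \<rho> \<inter> arcs (A False) \<rho> = {}"
    using arcs_disj[of A1 A2] disj(1) small unfolding A_def by fastforce
  have disj_R: "arcs (R True) \<rho> \<inter> arcs (R False) \<rho> = {}"
    using arcs_disj[of R1 R2] disj(2) small unfolding R_def by fastforce
  have disj2: "arcs (A True \<union> A False) (2 * \<rho>) \<inter> arcs (R True \<union> R False) (2 * \<rho>) = {}"
    using disj(3) by (intro arcs_disj) (auto simp: A_def R_def)
  have disj_AR: "arcs (A c) \<rho> \<inter> arcs (R d) \<rho> = {}" for c d
  proof -
    have "arcs (A c) (2 * \<rho>) \<subseteq> arcs (A True \<union> A False) (2 * \<rho>)"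
      "arcs (R d) (2 * \<rho>) \<subseteq> arcs (R True \<union> R False) (2 * \<rho>)"
      by (cases c; cases d; simp add: arcs_Un)+
    then show ?thesis using disj2 small by blast
  qed
  have pp_s: "s c ` (S1 - arcs (R c) \<rho>) \<subseteq> arcs (A c) \<rho>" for c
    using pp by (cases c) (simp_all add: s_def A_def R_def)
  have pp_t: "t c ` (S1 - arcs (A c) \<rho>) \<subseteq> arcs (R c) \<rho>" for c
  proof
    fix z assume "z \<in> t c ` (S1 - arcs (A c) \<rho>)"
    then obtain y where y: "y \<in> S1" "y \<notin> arcs (A c) \<rho>" "z = t c y" by blast
    then have "z \<in> S1" "s c z = y" using maps[OF t y(1)] apply_inv[OF s y(1)] by (auto simp: t_def)
    then show "z \<in> arcs (R c) \<rho>" using pp_s[of c] y(2) by blast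
  qed
  have disj_RA: "arcs (R c) \<rho> \<inter> arcs (A d) \<rho> = {}" for c d using disj_AR[of d c] by blast
  define Ks where "Ks = S1 - arcs (R True \<union> R False) (2 * \<rho>)"
  define Kt where "Kt = S1 - arcs (A True \<union> A False) (2 * \<rho>)"
  obtain n1 where n1: "\<And>n. n \<ge> n1 \<Longrightarrow> 4 * card {ws. length ws = n \<and> \<not> (\<forall>p\<in>Ks. circle_deriv (word_map s ws) p < 1)} \<le> 2 ^ n"
    using ping_pong_words_contract(1)[where s = s and A = A and R = R, OF s fin S \<rho> pp_s disj_A disj_AR]
    unfolding Ks_def by blast
  obtain n2 where n2: "\<And>n. n \<ge> n2 \<Longrightarrow> 4 * card {ws. length ws = n \<and> \<not> (\<forall>p\<in>Kt. circle_deriv (word_map t ws) p < 1)} \<le> 2 ^ n"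
    using ping_pong_words_contract(1)[where s = t and A = R and R = A, OF t fin(2,1) S(2,1) \<rho> pp_t disj_R disj_RA]
    unfolding Kt_def by blast
  define n where "n = Suc (max n1 n2)"
  let ?B1 = "{ws. length ws = n \<and> \<not> (\<forall>p\<in>Ks. circle_deriv (word_map s ws) p < 1)}"
  let ?B2 = "{ws. length ws = n \<and> \<not> (\<forall>p\<in>Kt. circle_deriv (word_map t ws) p < 1)}"
  have "\<exists>ws. length ws = n \<and> ws \<notin> ?B1 \<and> rev ws \<notin> ?B2"
  proof (rule ccontr)
    assume "\<not> ?thesis"
    then have none: "ws \<in> ?B1 \<or> rev ws \<in> ?B2" if "length ws = n" for ws :: "bool list"
      using that by blast
    have "{ws. length ws = n} \<subseteq> ?B1 \<union> rev ` ?B2"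
    proof
      fix ws :: "bool list" assume "ws \<in> {ws. length ws = n}"
      then have "ws \<in> ?B1 \<or> rev ws \<in> ?B2" using none by blast
      then show "ws \<in> ?B1 \<union> rev ` ?B2" using image_eqI[of ws rev "rev ws" ?B2] by auto
    qed
    then have "card {ws :: bool list. length ws = n} \<le> card (?B1 \<union> rev ` ?B2)"
      by (intro card_mono) (simp_all add: finite_bool_lists)
    also have "\<dots> \<le> card ?B1 + card ?B2"
      using card_Un_le[of ?B1 "rev ` ?B2"] card_image_le[of ?B2 rev] finite_bool_lists by fastforce
    finally have "(2 :: nat) ^ n \<le> card ?B1 + card ?B2" by (simp add: card_bool_lists)
    moreover have "4 * card ?B1 \<le> 2 ^ n" by (rule n1) (simp add: n_def)
    moreover have "4 * card ?B2 \<le> 2 ^ n" by (rule n2) (simp add: n_def)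
    moreover have "(0 :: nat) < 2 ^ n" by simp
    ultimately show False by linarith
  qed
  then obtain ws where len: "length ws = n"
    and Ks: "\<And>p. p \<in> Ks \<Longrightarrow> circle_deriv (word_map s ws) p < 1"
    and Kt: "\<And>p. p \<in> Kt \<Longrightarrow> circle_deriv (word_map t (rev ws)) p < 1"
    by auto
  define w where "w = word_map s ws"
  define v where "v = word_map t (rev ws)"
  have w: "w \<in> \<Gamma>" and v: "v \<in> \<Gamma>" using word_map_in s t by (auto simp: w_def v_def)
  have vw: "v (w x) = x" if "x \<in> S1" for x
  proof -
    have t_eq: "t = (\<lambda>c. circle_inv (s c))" by (rule ext) (rule t_def)
    show ?thesis unfolding w_def v_def t_eq by (rule word_map_rev_inverse[where s = s, OF s that])
  qed
  obtain c cs where cs: "ws = c # cs" using len by (cases ws) (auto simp: n_def)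
  have w_image: "w ` (S1 - arcs (R True \<union> R False) \<rho>) \<subseteq> arcs (A c) \<rho>"
    unfolding w_def cs
    by (rule ping_pong_words_contract(2)[where s = s and A = A and R = R, OF s fin S \<rho> pp_s disj_A disj_AR])
  obtain d ds where ds: "rev ws = d # ds" using len by (cases "rev ws") (auto simp: n_def)
  have v_image: "v ` (S1 - arcs (A True \<union> A False) \<rho>) \<subseteq> arcs (R d) \<rho>"
    unfolding v_def ds
    by (rule ping_pong_words_contract(2)[where s = t and A = R and R = A, OF t fin(2,1) S(2,1) \<rho> pp_t disj_R disj_RA])
  have arcs_S: "arcs (A c) r \<subseteq> S1" "arcs (R c) r \<subseteq> S1" for c r
    using arc_subset_S1 S by (fastforce simp: arcs_def)+
  have A_Ks: "arcs (A c) \<rho> \<subseteq> Ks" for c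
    using disj2 small[of "A c"] arcs_S(1)[of c \<rho>] by (cases c) (auto simp: Ks_def arcs_Un)
  have R_Kt: "arcs (R c) \<rho> \<subseteq> Kt" for c
    using disj2 small[of "R c"] arcs_S(2)[of c \<rho>] by (cases c) (auto simp: Kt_def arcs_Un)
  have Ks_sub: "Ks \<subseteq> S1 - arcs (R True \<union> R False) \<rho>" using small by (auto simp: Ks_def)
  have Kt_sub: "Kt \<subseteq> S1 - arcs (A True \<union> A False) \<rho>" using small by (auto simp: Kt_def)
  have w_Ks: "w ` Ks \<subseteq> Ks" using w_image Ks_sub A_Ks[of c] by blast
  have v_Kt: "v ` Kt \<subseteq> Kt" using v_image Kt_sub R_Kt[of d] by blast
  have "\<exists>y\<in>A c. w ` circle_arc x \<rho> \<subseteq> circle_arc y \<rho>" if x: "x \<in> A c" for x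
  proof (rule connected_subset_one_of_disjoint_closed)
    have arc: "circle_arc x \<rho> \<subseteq> arcs (A c) \<rho>" using x by (auto simp: arcs_def)
    then show "connected (w ` circle_arc x \<rho>)"
      using arcs_S(1)
      by (intro connected_continuous_image connected_arc
          continuous_on_subset[OF Diff1_plus_continuous[OF Diff[OF w]]]) blast
    show "w ` circle_arc x \<rho> \<noteq> {}" using center_in_arc[of \<rho> x] \<rho>(1) by auto
    have "circle_arc x \<rho> \<subseteq> S1 - arcs (R True \<union> R False) \<rho>" using arc A_Ks[of c] Ks_sub by blast
    then have "w ` circle_arc x \<rho> \<subseteq> arcs (A c) \<rho>" using w_image by blast
    then show "w ` circle_arc x \<rho> \<subseteq> (\<Union>y\<in>A c. circle_arc y \<rho>)" by (simp only: arcs_def)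
    show "circle_arc y \<rho> \<inter> circle_arc z \<rho> = {}" if "y \<in> A c" "z \<in> A c" "y \<noteq> z" for y z
    proof -
      have "y \<in> ?X" "z \<in> ?X" by (rule subsetD[OF AR(1) that(1)], rule subsetD[OF AR(1) that(2)])
      then have "circle_arc y (2 * \<rho>) \<inter> circle_arc z (2 * \<rho>) = {}" using that(3) by (rule sep)
      moreover have "circle_arc u \<rho> \<subseteq> circle_arc u (2 * \<rho>)" for u using \<rho>(1) by (intro arc_mono) simp
      ultimately show ?thesis by blast
    qed
  qed (auto intro: fin compact_imp_closed compact_arc)
  then have "\<forall>x\<in>A c. \<exists>y. y \<in> A c \<and> w ` circle_arc x \<rho> \<subseteq> circle_arc y \<rho>" by blast
  from bchoice[OF this] obtain \<pi> where \<pi>: "\<forall>x\<in>A c. \<pi> x \<in> A c \<and> w ` circle_arc x \<rho> \<subseteq> circle_arc (\<pi> x) \<rho>" ..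
  obtain x k where x: "x \<in> A c" and k: "k > 0" "(\<pi> ^^ k) x = x"
    using finite_self_map_periodic[of "A c" \<pi>] fin(1) ne \<pi> by (metis A_def)
  have iter: "(\<pi> ^^ j) x \<in> A c \<and> (w ^^ j) ` circle_arc x \<rho> \<subseteq> circle_arc ((\<pi> ^^ j) x) \<rho>" for j
  proof (induction j)
    case (Suc j)
    then have "w ` circle_arc ((\<pi> ^^ j) x) \<rho> \<subseteq> circle_arc (\<pi> ((\<pi> ^^ j) x)) \<rho>" using \<pi> by blast
    then show ?case using Suc \<pi> by (auto simp: image_subset_iff)
  qed (use x in auto)
  define g where "g = circle_power w k"
  have g: "g \<in> \<Gamma>" unfolding g_def by (rule circle_power_in[OF w])
  have g_apply: "g z = (w ^^ k) z" if "z \<in> S1" for z unfolding g_def by (rule circle_power_apply[OF that])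
  have xS: "x \<in> S1" using x S(1) by blast
  have arc_S: "circle_arc x \<rho> \<subseteq> S1" by (rule arc_subset_S1[OF xS])
  have "g ` circle_arc x \<rho> \<subseteq> circle_arc x \<rho>"
    using iter[of k] k(2) g_apply arc_S by (auto simp: image_subset_iff)
  then have "\<exists>y\<in>circle_arc x \<rho>. g y = y"
    using \<rho> continuous_on_subset[OF Diff1_plus_continuous[OF Diff[OF g]] arc_S]
    by (intro circle_arc_fixpoint[OF xS]) auto
  then have fixed: "\<exists>y\<in>S1. g y = y" using arc_S by blast
  obtain k' where k': "k = Suc k'" using k(1) by (cases k) auto
  have "hyperbolic_fixed_point g p" if p: "p \<in> S1" "g p = p" for p
  proof -
    have "circle_deriv g p \<noteq> 1"
    proof (cases "p \<in> arcs (A True \<union> A False) (2 * \<rho>)")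
      case True
      then have "p \<in> Ks" using disj2 p(1) by (auto simp: Ks_def)
      then have "circle_deriv g p < 1"
        unfolding g_def k' using w_Ks Ks by (intro circle_power_deriv_less_1[OF w, of Ks]) (auto simp: Ks_def w_def)
      then show ?thesis by simp
    next
      case False
      define h where "h = circle_power v k"
      have h: "h \<in> \<Gamma>" unfolding h_def by (rule circle_power_in[OF v])
      have "p \<in> Kt" using False p(1) by (simp add: Kt_def)
      then have hp: "circle_deriv h p < 1"
        unfolding h_def k' using v_Kt Kt by (intro circle_power_deriv_less_1[OF v, of Kt]) (auto simp: Kt_def v_def)
      have inverse: "(v ^^ j) ((w ^^ j) z) = z \<and> (w ^^ j) z \<in> S1" if "z \<in> S1" for j z
      proof (induction j)
        case (Suc j)
        have "(v ^^ Suc j) ((w ^^ Suc j) z) = (v ^^ j) (v (w ((w ^^ j) z)))" by (simp add: funpow_swap1)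
        then show ?case using Suc vw maps[OF w] by simp
      qed (use that in simp)
      have "compose S1 h g = (\<lambda>x\<in>S1. x)"
      proof
        fix z
        show "compose S1 h g z = (\<lambda>x\<in>S1. x) z"
        proof (cases "z \<in> S1")
          case True
          then have "h (g z) = (v ^^ k) ((w ^^ k) z)"
            using circle_power_apply[of "g z" v k] maps[OF g True] g_apply[OF True] by (simp add: h_def)
          then show ?thesis using inverse[OF True] True by (simp add: compose_def)
        qed (simp add: compose_def)
      qed
      then have "circle_deriv h (g p) * circle_deriv g p = 1"
        using circle_deriv_compose[OF Diff[OF g] Diff[OF h] p(1)] circle_deriv_id[OF p(1)] by simp
      then show ?thesis using hp p(2) by auto
    qed
    then show ?thesis using p by (simp add: hyperbolic_fixed_point_def)
  qed
  then show ?thesis using g fixed by blast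
qed

lemma circle_diff_group_if_subgroup:
  assumes "subgroup \<Gamma> Diff1_plus_group"
  shows "circle_diff_group \<Gamma>"
proof
  have \<Gamma>: "\<Gamma> \<subseteq> Diff1_plus" using subgroup.subset[OF assms] by (simp add: Diff1_plus_group_def)
  then show D: "g \<in> Diff1_plus" if "g \<in> \<Gamma>" for g using that by blast
  show "(\<lambda>x\<in>S1. x) \<in> \<Gamma>"
    using subgroup.one_closed[OF assms] by (simp add: Diff1_plus_group_def BijGroup_def)
  show "compose S1 g h \<in> \<Gamma>" if "g \<in> \<Gamma>" "h \<in> \<Gamma>" for g h
    using subgroup.m_closed[OF assms that] Diff1_plus_Bij[OF D[OF that(1)]] Diff1_plus_Bij[OF D[OF that(2)]]
    by (simp add: Diff1_plus_group_def BijGroup_def)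
  show "circle_inv g \<in> \<Gamma>" if "g \<in> \<Gamma>" for g
  proof -
    have "inv\<^bsub>Diff1_plus_group\<^esub> g = inv\<^bsub>BijGroup S1\<^esub> g"
      unfolding Diff1_plus_group_def
      by (rule group.m_inv_consistent[OF group_BijGroup subgroup_Diff1_plus D[OF that]])
    then show ?thesis
      using subgroup.m_inv_closed[OF assms that] inv_BijGroup[OF Diff1_plus_Bij[OF D[OF that]]] by simp
  qed
qed

theorem mainTheorem4:
  fixes \<Gamma> :: "(complex \<Rightarrow> complex) set"
  assumes "subgroup \<Gamma> Diff1_plus_group"
    and "countable \<Gamma>"
    and "\<not> (\<exists>m :: complex measure. prob_space m \<and> sets m = sets (restrict_space borel S1) \<and>
              preserves_measure \<Gamma> m)"
  shows "\<exists>g\<in>\<Gamma>. (\<exists>x\<in>S1. g x = x) \<and> (\<forall>x\<in>S1. g x = x \<longrightarrow> hyperbolic_fixed_point g x)"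
proof -
  interpret circle_diff_group \<Gamma> by (rule circle_diff_group_if_subgroup[OF assms(1)])
  interpret no_invariant_measure \<Gamma> by unfold_locales (rule assms(3))
  show ?thesis by (rule hyperbolic_element_exists)
qed

end
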